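(* Let $X$ be an irreducible affine $\mathrm{GL}$-variety over a field $K$ of characteristic $0$. Then the invariant function field $K(X)^{\mathrm{GL}}$ is a finitely generated field extension of $K$.
   Context: $\mathrm{GL}=\bigcup_{n\ge1}\mathrm{GL}_n(K)$ (a discrete group) and $\mathbf{V}=\bigcup_{n\ge1}K^n$ is its standard representation. A polynomial representation of $\mathrm{GL}$ is a subquotient of a (possibly infinite) direct sum of tensor powers of $\mathbf{V}$. A $\mathrm{GL}$-algebra is a (commutative) $K$-algebra with an action of $\mathrm{GL}$ by algebra automorphisms that is a polynomial representation; it is finitely $\mathrm{GL}$-generated if it is generated as a $K$-algebra by the $\mathrm{GL}$-orbits of finitely many elements. An affine $\mathrm{GL}$-variety is a reduced affine scheme with $\mathrm{GL}$-action whose coordinate ring is a finitely $\mathrm{GL}$-generated $\mathrm{GL}$-algebra. For $X$ irreducible, $K(X)$ is its function field and $K(X)^{\mathrm{GL}}$ is the fixed field of $\mathrm{GL}$ acting on $K(X)$. *)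

theory Defs
  imports
    "Jordan_Normal_Form.Matrix"
    "HOL-Algebra.Group_Action"
    "HOL-Library.Groups_Big_Fun"
    "HOL-Library.Function_Algebras"
    "HOL-Analysis.Abstract_Topology"
begin

section \<open>The infinite general linear group and its standard representation\<close>

text \<open>
  \<open>GL\<^sub>n(K)\<close> is embedded into \<open>GL\<^sub>n\<^sub>+\<^sub>1(K)\<close> by \<open>A \<mapsto> diag(A, 1)\<close>, so an element of the union is an
  infinite matrix that agrees with the identity outside a finite block.
\<close>

definition stabilise :: "'k::field mat \<Rightarrow> nat \<Rightarrow> nat \<Rightarrow> 'k" where
  "stabilise A = (\<lambda>i j. if i < dim_row A \<and> j < dim_col A then A $$ (i, j) else if i = j then 1 else 0)"

text \<open>\<^const>\<open>Sum_any\<close> sums over the support, which is finite in all the uses below.\<close>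

definition GL :: "(nat \<Rightarrow> nat \<Rightarrow> 'k::field) monoid" where
  "GL = \<lparr>carrier = (\<Union>n\<in>{1..}. stabilise ` {A \<in> carrier_mat n n. invertible_mat A}),
         mult = (\<lambda>g h i j. Sum_any (\<lambda>k. g i k * h k j)),
         one = (\<lambda>i j. if i = j then 1 else 0)\<rparr>"

definition std_space :: "(nat \<Rightarrow> 'k::field) set" where
  "std_space = {v. finite {i. v i \<noteq> 0}}"

definition std_act :: "(nat \<Rightarrow> nat \<Rightarrow> 'k::field) \<Rightarrow> (nat \<Rightarrow> 'k) \<Rightarrow> (nat \<Rightarrow> 'k)" where
  "std_act g v = (\<lambda>i. Sum_any (\<lambda>j. g i j * v j))"


section \<open>Direct sums of tensor powers\<close>

text \<open>
  The direct sum over \<open>i\<close> of the tensor powers of \<open>V\<close> of degree \<open>d i\<close>, in coordinates: a basis is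
  given by the pairs \<open>(i, w)\<close> with \<open>w\<close> a word of length \<open>d i\<close>, standing for the pure tensor
  \<open>e\<^bsub>w!0\<^esub> \<otimes> e\<^bsub>w!1\<^esub> \<otimes> \<dots>\<close> in the \<open>i\<close>-th summand.
\<close>

definition tensor_sum :: "('i \<Rightarrow> nat) \<Rightarrow> ('i \<times> nat list \<Rightarrow> 'k::field) set" where
  "tensor_sum d = {t. finite {x. t x \<noteq> 0} \<and> (\<forall>i w. t (i, w) \<noteq> 0 \<longrightarrow> length w = d i)}"

definition tensor_scale :: "'k::field \<Rightarrow> ('i \<times> nat list \<Rightarrow> 'k) \<Rightarrow> ('i \<times> nat list \<Rightarrow> 'k)" where
  "tensor_scale c t = (\<lambda>x. c * t x)"

definition tensor_act ::
  "(nat \<Rightarrow> nat \<Rightarrow> 'k::field) \<Rightarrow> ('i \<times> nat list \<Rightarrow> 'k) \<Rightarrow> ('i \<times> nat list \<Rightarrow> 'k)" where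
  "tensor_act g t = (\<lambda>(i, v).
     Sum_any (\<lambda>w. if length w = length v then (\<Prod>k<length v. g (v ! k) (w ! k)) * t (i, w) else 0))"

text \<open>
  That \<^const>\<open>tensor_act\<close> is the diagonal action is witnessed by the lemma \<open>tensor_act_pure_tensor\<close> below.
\<close>

definition pure_tensor :: "'i \<Rightarrow> (nat \<Rightarrow> 'k::field) list \<Rightarrow> ('i \<times> nat list \<Rightarrow> 'k)" where
  "pure_tensor i vs = (\<lambda>(j, w).
     if j = i \<and> length w = length vs then (\<Prod>k<length vs. (vs ! k) (w ! k)) else 0)"


section \<open>Polynomial representations and GL-algebras\<close>

definition GL_representation ::
  "('k::field \<Rightarrow> 'w::ab_group_add \<Rightarrow> 'w) \<Rightarrow> ((nat \<Rightarrow> nat \<Rightarrow> 'k) \<Rightarrow> 'w \<Rightarrow> 'w) \<Rightarrow> bool" where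
  "GL_representation scale act \<longleftrightarrow>
     vector_space scale \<and> group_action GL UNIV act \<and>
     (\<forall>g\<in>carrier GL. Vector_Spaces.linear scale scale (act g))"

definition tensor_subrep :: "('i \<Rightarrow> nat) \<Rightarrow> ('i \<times> nat list \<Rightarrow> 'k::field) set \<Rightarrow> bool" where
  "tensor_subrep d M \<longleftrightarrow>
     M \<subseteq> tensor_sum d \<and> module.subspace tensor_scale M \<and>
     (\<forall>g\<in>carrier GL. \<forall>t\<in>M. tensor_act g t \<in> M)"

text \<open>
  The map \<open>\<phi>\<close> induces a \<open>GL\<close>-equivariant linear isomorphism from \<open>M / N\<close> onto the representation.
  The index type \<open>'i\<close> of the direct sum is a type variable in the theorem, hence arbitrary.
\<close>

definition polynomial_representation ::
  "'i itself \<Rightarrow> ('k::field \<Rightarrow> 'w::ab_group_add \<Rightarrow> 'w) \<Rightarrow> ((nat \<Rightarrow> nat \<Rightarrow> 'k) \<Rightarrow> 'w \<Rightarrow> 'w) \<Rightarrow> bool" where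
  "polynomial_representation (_ :: 'i itself) scale act \<longleftrightarrow>
     GL_representation scale act \<and>
     (\<exists>(d :: 'i \<Rightarrow> nat) M N \<phi>.
        tensor_subrep d M \<and> tensor_subrep d N \<and> N \<subseteq> M \<and>
        (\<forall>s\<in>M. \<forall>t\<in>M. \<phi> (s + t) = \<phi> s + \<phi> t) \<and>
        (\<forall>c. \<forall>t\<in>M. \<phi> (tensor_scale c t) = scale c (\<phi> t)) \<and>
        (\<forall>g\<in>carrier GL. \<forall>t\<in>M. \<phi> (tensor_act g t) = act g (\<phi> t)) \<and>
        \<phi> ` M = UNIV \<and> {t \<in> M. \<phi> t = 0} = N)"

definition K_algebra :: "('k::field \<Rightarrow> 'a::comm_ring_1 \<Rightarrow> 'a) \<Rightarrow> bool" where
  "K_algebra scale \<longleftrightarrow> vector_space scale \<and> (\<forall>c x y. scale c x * y = scale c (x * y))"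

definition subalgebra :: "('k::field \<Rightarrow> 'a::comm_ring_1 \<Rightarrow> 'a) \<Rightarrow> 'a set \<Rightarrow> bool" where
  "subalgebra scale B \<longleftrightarrow> module.subspace scale B \<and> 1 \<in> B \<and> (\<forall>x\<in>B. \<forall>y\<in>B. x * y \<in> B)"

definition GL_algebra ::
  "'i itself \<Rightarrow> ('k::field \<Rightarrow> 'a::comm_ring_1 \<Rightarrow> 'a) \<Rightarrow> ((nat \<Rightarrow> nat \<Rightarrow> 'k) \<Rightarrow> 'a \<Rightarrow> 'a) \<Rightarrow> bool" where
  "GL_algebra (I :: 'i itself) scale act \<longleftrightarrow>
     K_algebra scale \<and> polynomial_representation I scale act \<and>
     (\<forall>g\<in>carrier GL. comm_ring_hom (act g))"

definition finitely_GL_generated ::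
  "('k::field \<Rightarrow> 'a::comm_ring_1 \<Rightarrow> 'a) \<Rightarrow> ((nat \<Rightarrow> nat \<Rightarrow> 'k) \<Rightarrow> 'a \<Rightarrow> 'a) \<Rightarrow> bool" where
  "finitely_GL_generated scale act \<longleftrightarrow>
     (\<exists>S. finite S \<and> subalgebra scale hull (\<Union>s\<in>S. orbit GL act s) = UNIV)"


section \<open>Affine GL-varieties\<close>

definition reduced_ring :: "'a::comm_ring_1 itself \<Rightarrow> bool" where
  "reduced_ring (_ :: 'a itself) \<longleftrightarrow> (\<forall>(x::'a) n. x ^ n = 0 \<longrightarrow> x = 0)"

text \<open>
  An affine \<open>GL\<close>-variety \<open>X = Spec A\<close> is given by its coordinate ring \<open>A\<close>, the type \<open>'a\<close>, with the
  \<open>K\<close>-algebra structure \<open>scale\<close> and the action \<open>act\<close> of \<open>GL\<close>.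
\<close>

definition affine_GL_variety ::
  "'i itself \<Rightarrow> ('k::field \<Rightarrow> 'a::comm_ring_1 \<Rightarrow> 'a) \<Rightarrow> ((nat \<Rightarrow> nat \<Rightarrow> 'k) \<Rightarrow> 'a \<Rightarrow> 'a) \<Rightarrow> bool" where
  "affine_GL_variety (I :: 'i itself) scale act \<longleftrightarrow>
     GL_algebra I scale act \<and> finitely_GL_generated scale act \<and> reduced_ring TYPE('a)"

definition prime_ideal :: "'a::comm_ring_1 set \<Rightarrow> bool" where
  "prime_ideal P \<longleftrightarrow>
     0 \<in> P \<and> (\<forall>x\<in>P. \<forall>y\<in>P. x + y \<in> P) \<and> (\<forall>r. \<forall>x\<in>P. r * x \<in> P) \<and>
     1 \<notin> P \<and> (\<forall>x y. x * y \<in> P \<longrightarrow> x \<in> P \<or> y \<in> P)"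

text \<open>The prime spectrum with the Zariski topology, generated by the principal open sets.\<close>

definition Spec :: "'a::comm_ring_1 set topology" where
  "Spec = topology_generated_by (range (\<lambda>f. {P. prime_ideal P \<and> f \<notin> P}))"

definition irreducible_space :: "'x topology \<Rightarrow> bool" where
  "irreducible_space X \<longleftrightarrow>
     topspace X \<noteq> {} \<and>
     (\<forall>C D. closedin X C \<and> closedin X D \<and> C \<union> D = topspace X \<longrightarrow> C = topspace X \<or> D = topspace X)"


section \<open>The invariant function field\<close>

text \<open>
  \<open>\<iota>\<close> exhibits the field \<open>'l\<close> as the field of fractions of \<open>'a\<close>, that is, as the function field of
  the integral scheme \<open>Spec 'a\<close>. It is determined up to unique isomorphism over \<open>'a\<close>.
\<close>

definition fraction_field :: "('a::comm_ring_1 \<Rightarrow> 'l::field) \<Rightarrow> bool" where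
  "fraction_field \<iota> \<longleftrightarrow>
     comm_ring_hom \<iota> \<and> inj \<iota> \<and> (\<forall>x. \<exists>a b. b \<noteq> 0 \<and> x = \<iota> a / \<iota> b)"

text \<open>The map \<open>\<iota> a / \<iota> b \<mapsto> \<iota> (f a) / \<iota> (f b)\<close>; see the lemma \<open>fraction_map_divide\<close> below.\<close>

definition fraction_map :: "('a::comm_ring_1 \<Rightarrow> 'l::field) \<Rightarrow> ('a \<Rightarrow> 'a) \<Rightarrow> 'l \<Rightarrow> 'l" where
  "fraction_map \<iota> f x = (THE y. \<exists>a b. b \<noteq> 0 \<and> x = \<iota> a / \<iota> b \<and> y = \<iota> (f a) / \<iota> (f b))"

definition invariant_field ::
  "('a::comm_ring_1 \<Rightarrow> 'l::field) \<Rightarrow> ((nat \<Rightarrow> nat \<Rightarrow> 'k::field) \<Rightarrow> 'a \<Rightarrow> 'a) \<Rightarrow> 'l set" where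
  "invariant_field \<iota> act = {x. \<forall>g\<in>carrier GL. fraction_map \<iota> (act g) x = x}"

definition constant_field ::
  "('k::field \<Rightarrow> 'a::comm_ring_1 \<Rightarrow> 'a) \<Rightarrow> ('a \<Rightarrow> 'l::field) \<Rightarrow> 'l set" where
  "constant_field scale \<iota> = range (\<lambda>c. \<iota> (scale c 1))"

definition is_subfield :: "'l::field set \<Rightarrow> bool" where
  "is_subfield F \<longleftrightarrow>
     0 \<in> F \<and> 1 \<in> F \<and> (\<forall>x\<in>F. \<forall>y\<in>F. x + y \<in> F \<and> x * y \<in> F) \<and> (\<forall>x\<in>F. - x \<in> F \<and> inverse x \<in> F)"

definition finitely_generated_extension :: "'l::field set \<Rightarrow> 'l set \<Rightarrow> bool" where
  "finitely_generated_extension k F \<longleftrightarrow>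
     (\<exists>S. finite S \<and> S \<subseteq> F \<and> is_subfield hull (k \<union> S) = F)"


section \<open>Consistency of the definitions\<close>

lemma stabilise_mult:
  assumes "A \<in> carrier_mat n n" "B \<in> carrier_mat n n"
  shows "stabilise A \<otimes>\<^bsub>GL\<^esub> stabilise B = stabilise (A * B)"
proof (intro ext)
  fix i j
  let ?f = "\<lambda>k. stabilise A i k * stabilise B k j"
  have "{k. ?f k \<noteq> 0} \<subseteq> insert i {..<n}"
    using assms by (auto simp: stabilise_def split: if_splits)
  hence "Sum_any ?f = sum ?f (insert i {..<n})"
    by (intro Sum_any.expand_superset) auto
  also have "\<dots> = stabilise (A * B) i j"
  proof (cases "i < n")
    case True
    hence *: "insert i {..<n} = {0..<n}" by auto
    show ?thesis
    proof (cases "j < n")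
      case jn: True
      show ?thesis unfolding * using True jn assms
        by (auto simp: stabilise_def scalar_prod_def intro!: sum.cong)
    next
      case False
      thus ?thesis unfolding * using True assms
        by (auto simp: stabilise_def intro!: sum.neutral)
    qed
  next
    case False
    have "sum ?f {..<n} = 0"
      using False assms by (intro sum.neutral) (auto simp: stabilise_def)
    thus ?thesis using False assms
      by (auto simp: stabilise_def)
  qed
  finally show "(stabilise A \<otimes>\<^bsub>GL\<^esub> stabilise B) i j = stabilise (A * B) i j"
    by (simp add: GL_def)
qed

lemma stabilise_one: "stabilise (1\<^sub>m n) = \<one>\<^bsub>GL\<^esub>"
  by (auto simp: stabilise_def GL_def intro!: ext)

lemma stabilise_inject:
  assumes "A \<in> carrier_mat n n" "B \<in> carrier_mat n n" "stabilise A = stabilise B"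
  shows "A = B"
proof (rule eq_matI)
  fix i j assume "i < dim_row B" "j < dim_col B"
  thus "A $$ (i, j) = B $$ (i, j)"
    using assms(1,2) fun_cong[OF fun_cong[OF assms(3)], of i j] unfolding stabilise_def by simp
qed (use assms in auto)

lemma invertible_mat_iff:
  assumes "A \<in> carrier_mat n n"
  shows "invertible_mat A \<longleftrightarrow> (\<exists>B\<in>carrier_mat n n. A * B = 1\<^sub>m n \<and> B * A = 1\<^sub>m n)"
proof
  assume "invertible_mat A"
  then obtain B where B: "A * B = 1\<^sub>m n" "B * A = 1\<^sub>m (dim_row B)"
    using assms unfolding invertible_mat_def inverts_mat_def by auto
  have "dim_col B = n" using arg_cong[OF B(1), of dim_col] by simp
  moreover have "dim_row B = n" using arg_cong[OF B(2), of dim_col] assms by simp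
  ultimately show "\<exists>B\<in>carrier_mat n n. A * B = 1\<^sub>m n \<and> B * A = 1\<^sub>m n"
    using B by (metis carrier_matI)
next
  assume "\<exists>B\<in>carrier_mat n n. A * B = 1\<^sub>m n \<and> B * A = 1\<^sub>m n"
  thus "invertible_mat A" using assms
    unfolding invertible_mat_def inverts_mat_def by auto
qed

lemma stabilise_enlarge:
  assumes A: "A \<in> carrier_mat n n" "invertible_mat A" and "n \<le> m"
  shows "\<exists>A'\<in>carrier_mat m m. invertible_mat A' \<and> stabilise A' = stabilise A"
proof -
  define up where "up = (\<lambda>A :: 'a mat. mat m m (\<lambda>(i, j). stabilise A i j))"
  have up: "up C \<in> carrier_mat m m" "stabilise (up C) = stabilise C" if "C \<in> carrier_mat n n" for C
    using that \<open>n \<le> m\<close> by (auto simp: up_def stabilise_def intro!: ext)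
  obtain B where B: "B \<in> carrier_mat n n" "A * B = 1\<^sub>m n" "B * A = 1\<^sub>m n"
    using A invertible_mat_iff by blast
  have "stabilise (up A * up B) = stabilise (1\<^sub>m m)" "stabilise (up B * up A) = stabilise (1\<^sub>m m)"
    using A B up by (metis stabilise_mult stabilise_one)+
  hence "up A * up B = 1\<^sub>m m" "up B * up A = 1\<^sub>m m"
    using A B up by (metis mult_carrier_mat one_carrier_mat stabilise_inject)+
  thus ?thesis using A B up invertible_mat_iff by metis
qed

lemma GL_at_level:
  assumes "finite G" "G \<subseteq> carrier (GL :: (nat \<Rightarrow> nat \<Rightarrow> 'k::field) monoid)"
  shows "\<exists>n\<ge>1. G \<subseteq> stabilise ` {A \<in> carrier_mat n n. invertible_mat (A :: 'k mat)}"
  using assms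
proof (induction G rule: finite_induct)
  case (insert g G)
  then obtain n where n: "n \<ge> 1" "G \<subseteq> stabilise ` {A \<in> carrier_mat n n. invertible_mat (A :: 'k mat)}"
    by auto
  obtain m A where A: "A \<in> carrier_mat m m" "invertible_mat A" "g = stabilise A"
    using insert.prems by (auto simp: GL_def)
  let ?N = "max n m"
  have *: "stabilise C \<in> stabilise ` {A \<in> carrier_mat ?N ?N. invertible_mat (A :: 'k mat)}"
    if "C \<in> carrier_mat r r" "invertible_mat C" "r \<le> ?N" for C r
    using stabilise_enlarge[OF that] by (metis (mono_tags, lifting) image_eqI mem_Collect_eq)
  have "insert g G \<subseteq> stabilise ` {A \<in> carrier_mat ?N ?N. invertible_mat A}"
    using n A *[of _ n] *[of A m] by (auto simp: subset_iff)
  thus ?case using n by (intro exI[of _ ?N]) auto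
qed auto

lemma stabilise_in_GL:
  "n \<ge> 1 \<Longrightarrow> A \<in> carrier_mat n n \<Longrightarrow> invertible_mat A \<Longrightarrow> stabilise A \<in> carrier GL"
  by (auto simp: GL_def)

theorem group_GL: "group (GL :: (nat \<Rightarrow> nat \<Rightarrow> 'k::field) monoid)"
proof (rule groupI)
  fix x y :: "nat \<Rightarrow> nat \<Rightarrow> 'k" assume "x \<in> carrier GL" "y \<in> carrier GL"
  then obtain n A B where *: "n \<ge> 1" "A \<in> carrier_mat n n" "invertible_mat A" "x = stabilise A"
      "B \<in> carrier_mat n n" "invertible_mat B" "y = stabilise B"
    using GL_at_level[of "{x, y}"] by auto
  obtain A' B' where **: "A' \<in> carrier_mat n n" "A * A' = 1\<^sub>m n" "A' * A = 1\<^sub>m n"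
    "B' \<in> carrier_mat n n" "B * B' = 1\<^sub>m n" "B' * B = 1\<^sub>m n"
    using * invertible_mat_iff by metis
  have assoc: "P * (Q * R) = (P * Q) * R"
    if "P \<in> carrier_mat n n" "Q \<in> carrier_mat n n" "R \<in> carrier_mat n n" for P Q R :: "'k mat"
    using assoc_mult_mat[OF that] by simp
  have "(A * B) * (B' * A') = (A * (B * B')) * A'"
    using *(2,5) **(1,4) by (metis assoc mult_carrier_mat)
  moreover have "(B' * A') * (A * B) = (B' * (A' * A)) * B"
    using *(2,5) **(1,4) by (metis assoc mult_carrier_mat)
  ultimately have "(A * B) * (B' * A') = 1\<^sub>m n" "(B' * A') * (A * B) = 1\<^sub>m n"
    using * ** by simp_all
  moreover have "A * B \<in> carrier_mat n n" "B' * A' \<in> carrier_mat n n"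
    using * ** by auto
  ultimately have "invertible_mat (A * B)"
    using invertible_mat_iff by metis
  thus "x \<otimes>\<^bsub>GL\<^esub> y \<in> carrier GL"
    using * by (auto simp: stabilise_mult intro!: stabilise_in_GL[of n])
next
  have "invertible_mat (1\<^sub>m 1 :: 'k mat)"
    by (subst invertible_mat_iff[of _ 1]) (auto intro!: bexI[of _ "1\<^sub>m 1"])
  thus "\<one>\<^bsub>GL\<^esub> \<in> carrier (GL :: (nat \<Rightarrow> nat \<Rightarrow> 'k) monoid)"
    using stabilise_in_GL[of 1 "1\<^sub>m 1"] by (simp add: stabilise_one)
next
  fix x y z :: "nat \<Rightarrow> nat \<Rightarrow> 'k"
  assume "x \<in> carrier GL" "y \<in> carrier GL" "z \<in> carrier GL"
  then obtain n A B C where *: "A \<in> carrier_mat n n" "x = stabilise A"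
      "B \<in> carrier_mat n n" "y = stabilise B" "C \<in> carrier_mat n n" "z = stabilise C"
    using GL_at_level[of "{x, y, z}"] by auto
  show "x \<otimes>\<^bsub>GL\<^esub> y \<otimes>\<^bsub>GL\<^esub> z = x \<otimes>\<^bsub>GL\<^esub> (y \<otimes>\<^bsub>GL\<^esub> z)"
    using * by (simp add: stabilise_mult[of _ n] assoc_mult_mat[of _ n n _ n _ n])
next
  fix x :: "nat \<Rightarrow> nat \<Rightarrow> 'k" assume "x \<in> carrier GL"
  then obtain n A where *: "n \<ge> 1" "A \<in> carrier_mat n n" "invertible_mat A" "x = stabilise A"
    using GL_at_level[of "{x}"] by auto
  show "\<one>\<^bsub>GL\<^esub> \<otimes>\<^bsub>GL\<^esub> x = x"
    using * by (simp add: stabilise_mult[of _ n] flip: stabilise_one[of n])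
  obtain B where B: "B \<in> carrier_mat n n" "A * B = 1\<^sub>m n" "B * A = 1\<^sub>m n"
    using * invertible_mat_iff by metis
  hence "invertible_mat B" using * invertible_mat_iff by metis
  thus "\<exists>y\<in>carrier GL. y \<otimes>\<^bsub>GL\<^esub> x = \<one>\<^bsub>GL\<^esub>"
    using * B by (auto simp: stabilise_mult[of _ n] stabilise_one intro!: bexI[of _ "stabilise B"] stabilise_in_GL[of n])
qed

lemma vector_space_tensor_scale: "vector_space tensor_scale"
  by unfold_locales (auto simp: tensor_scale_def algebra_simps intro!: ext)

lemma sum_product_words:
  fixes f :: "nat \<Rightarrow> nat \<Rightarrow> 'k::field"
  assumes "finite J"
  shows "(\<Sum>w | length w = n \<and> set w \<subseteq> J. \<Prod>k<n. f k (w ! k)) = (\<Prod>k<n. \<Sum>j\<in>J. f k j)"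
proof (induction n arbitrary: f)
  case (Suc n)
  have words: "{w. length w = Suc n \<and> set w \<subseteq> J} =
      (\<lambda>(j, w). j # w) ` (J \<times> {w. length w = n \<and> set w \<subseteq> J})"
    by (auto simp: length_Suc_conv image_iff)
  have "(\<Sum>w | length w = Suc n \<and> set w \<subseteq> J. \<Prod>k<Suc n. f k (w ! k)) =
      (\<Sum>(j, w) \<in> J \<times> {w. length w = n \<and> set w \<subseteq> J}. f 0 j * (\<Prod>k<n. f (Suc k) (w ! k)))"
    unfolding words
    by (subst sum.reindex) (auto simp: inj_on_def prod.lessThan_Suc_shift case_prod_beta simp del: prod.lessThan_Suc)
  also have "\<dots> = (\<Sum>j\<in>J. f 0 j) * (\<Prod>k<n. \<Sum>j\<in>J. f (Suc k) j)"
    unfolding Suc.IH[symmetric] sum_product sum.cartesian_product by (rule refl)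
  finally show ?case by (simp add: prod.lessThan_Suc_shift del: prod.lessThan_Suc)
qed (simp add: Collect_conv_if)

lemma tensor_act_pure_tensor:
  assumes "set vs \<subseteq> std_space"
  shows "tensor_act g (pure_tensor i vs) = pure_tensor i (map (std_act g) vs)"
proof (intro ext)
  fix x :: "'b \<times> nat list"
  obtain j u where x: "x = (j, u)" by force
  define J where "J = (\<Union>v\<in>set vs. {m. v m \<noteq> 0})"
  define n where "n = length vs"
  have J: "finite J" using assms by (auto simp: J_def std_space_def)
  let ?h = "\<lambda>w. if length w = length u then (\<Prod>k<length u. g (u ! k) (w ! k)) * pure_tensor i vs (j, w) else 0"
  show "tensor_act g (pure_tensor i vs) x = pure_tensor i (map (std_act g) vs) x"
  proof (cases "j = i \<and> length u = n")
    case True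
    have zero: "?h w = 0" if "w \<notin> {w. length w = n \<and> set w \<subseteq> J}" for w
    proof (cases "length w = n")
      case len: True
      hence "\<not> set w \<subseteq> J" using that by simp
      then obtain k where k: "k < n" "w ! k \<notin> J"
        using len by (metis in_set_conv_nth subsetI)
      hence "(vs ! k) (w ! k) = 0" by (auto simp: J_def n_def)
      hence "(\<Prod>k<n. (vs ! k) (w ! k)) = 0" using k by (intro prod_zero) auto
      thus ?thesis using True len by (auto simp: pure_tensor_def n_def)
    qed (use True in auto)
    have "tensor_act g (pure_tensor i vs) x = Sum_any ?h"
      by (simp add: tensor_act_def x)
    also have "\<dots> = sum ?h {w. length w = n \<and> set w \<subseteq> J}"
    proof (rule Sum_any.expand_superset)
      show "finite {w. length w = n \<and> set w \<subseteq> J}"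
        using finite_lists_length_eq[OF J, of n] by (simp add: conj_commute)
      show "{w. ?h w \<noteq> 0} \<subseteq> {w. length w = n \<and> set w \<subseteq> J}"
        using zero by blast
    qed
    also have "\<dots> = (\<Sum>w | length w = n \<and> set w \<subseteq> J. \<Prod>k<n. g (u ! k) (w ! k) * (vs ! k) (w ! k))"
      using True by (intro sum.cong) (auto simp: pure_tensor_def n_def prod.distrib)
    also have "\<dots> = (\<Prod>k<n. \<Sum>m\<in>J. g (u ! k) m * (vs ! k) m)"
      by (rule sum_product_words[OF J])
    also have "\<dots> = (\<Prod>k<n. std_act g (vs ! k) (u ! k))"
      unfolding std_act_def using J
      by (intro prod.cong refl Sum_any.expand_superset[symmetric]) (auto simp: J_def n_def intro!: bexI[OF _ nth_mem])
    finally show ?thesis using True by (simp add: pure_tensor_def x n_def)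
  next
    case False
    hence "?h = (\<lambda>_. 0)" by (auto simp: pure_tensor_def n_def)
    hence "Sum_any ?h = 0" by (simp only: Sum_any.neutral)
    hence "tensor_act g (pure_tensor i vs) x = 0" by (simp add: tensor_act_def x)
    thus ?thesis using False by (auto simp: pure_tensor_def x n_def)
  qed
qed

lemma closedin_Spec_zeros: "closedin Spec {P. prime_ideal P \<and> S \<subseteq> P}"
proof -
  have top: "topspace Spec = {P :: 'a set. prime_ideal P}"
    by (auto simp: Spec_def prime_ideal_def)
  have "{P. prime_ideal P} - {P. prime_ideal P \<and> S \<subseteq> P} = (\<Union>f\<in>S. {P. prime_ideal P \<and> f \<notin> P})"
    by auto
  moreover have "openin Spec {P. prime_ideal P \<and> f \<notin> P}" for f :: 'a
    unfolding Spec_def by (intro topology_generated_by_Basis) auto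
  ultimately show ?thesis
    unfolding closedin_def top by auto
qed

lemma fraction_map_divide:
  assumes "fraction_field \<iota>" "comm_ring_hom f" "inj f" "b \<noteq> 0"
  shows "fraction_map \<iota> f (\<iota> a / \<iota> b) = \<iota> (f a) / \<iota> (f b)"
proof -
  interpret i: comm_ring_hom \<iota> using assms by (simp add: fraction_field_def)
  interpret f: comm_ring_hom f by fact
  have i0: "\<iota> x = 0 \<longleftrightarrow> x = 0" for x
    using assms(1) i.hom_zero unfolding fraction_field_def inj_def by metis
  have f0: "f x = 0 \<longleftrightarrow> x = 0" for x
    using assms(3) f.hom_zero unfolding inj_def by metis
  have "\<iota> (f c) / \<iota> (f d) = \<iota> (f a) / \<iota> (f b)" if "d \<noteq> 0" "\<iota> a / \<iota> b = \<iota> c / \<iota> d" for c d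
  proof -
    have "\<iota> (a * d) = \<iota> (c * b)" using that assms(4) by (simp add: i0 field_simps i.hom_mult)
    hence "a * d = c * b" using assms(1) by (auto simp: fraction_field_def inj_def)
    hence "\<iota> (f a) * \<iota> (f d) = \<iota> (f c) * \<iota> (f b)"
      by (metis f.hom_mult i.hom_mult)
    thus ?thesis using that assms(4) by (simp add: i0 f0 frac_eq_eq)
  qed
  thus ?thesis unfolding fraction_map_def using assms(4) by (intro the_equality) blast+
qed

end

theory Submission
  imports Defs "HOL-Computational_Algebra.Polynomial"
begin

text \<open>
  Let \<open>A\<close> be the coordinate ring, \<open>K(X)\<close> its field of fractions and \<open>L\<close> the field of invariants. The proof
  replaces the group by derivations and eliminates tensors degree by degree.

  The transvection \<open>e\<^sub>a \<mapsto> e\<^sub>a + t e\<^sub>b\<close> acts on \<open>A\<close> polynomially in \<open>t\<close>, because \<open>A\<close> is a polynomial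
  representation. The coefficient of \<open>t\<close> is a derivation of \<open>A\<close> and extends to a derivation \<open>D a b\<close> of
  \<open>K(X)\<close> that kills \<open>L\<close>. In characteristic \<open>0\<close>, polarisation shows that \<open>A\<close> is generated by the values of
  finitely many equivariant maps \<open>y\<close> from tensor powers of the standard representation
  (\<open>span_equivariant_tensors\<close>). Such a map is given by its values \<open>y w\<close> on words \<open>w\<close> in the letters
  \<open>0, 1, 2, \<dots>\<close>, and \<open>D a b\<close> sends \<open>y w\<close> to the sum of the values at the words in which one occurrence of
  \<open>a\<close> in \<open>w\<close> is replaced by \<open>b\<close>.

  Let \<open>d\<close> be the highest degree of these maps. Suppose that some \<open>f \<in> L\<close> is not in the field generated by
  the values of degree less than \<open>d\<close>. Being a rational function of those values and of finitely many
  values of degree \<open>d\<close>, it makes one value \<open>y w\<close> of degree \<open>d\<close> algebraic over \<open>f\<close> and the others. Now regard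
  the letters that occur in this relation as constants, and apply \<open>d\<close> derivations that replace the letters
  of \<open>w\<close> by new letters. By the Leibniz rule, modulo terms of lower degree, this operator is a derivation,
  and it kills \<open>f\<close>. Differentiating the relation thus expresses the values of \<open>y\<close> at all words of new
  letters with the order pattern of \<open>w\<close> by other values of degree \<open>d\<close> and values of lower degree
  (\<open>eliminate_one_top_tensor\<close>). There are only finitely many pairs of a map and a pattern. So after finitely
  many elements \<open>f\<close> have been adjoined to the ground field, \<open>L\<close> is contained in the field generated by the
  values of lower degree, and by induction on \<open>d\<close> it is contained in a finitely generated extension of \<open>K\<close>
  (\<open>constants_in_finitely_generated_field\<close>).

  It remains to see that an intermediate field of a finitely generated extension is finitely generated
  (\<open>intermediate_field_finitely_generated\<close>). This, too, works by adjoining elements of \<open>L\<close> one at a time: each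
  new element yields an equation of lower degree for a generator.
\<close>

section \<open>Generated subfields\<close>

abbreviation gen_field :: "'l::field set \<Rightarrow> 'l set" where
  "gen_field X \<equiv> is_subfield hull X"

lemma subfield_closed:
  assumes "is_subfield F"
  shows "0 \<in> F" "1 \<in> F"
    and "x \<in> F \<Longrightarrow> y \<in> F \<Longrightarrow> x + y \<in> F" "x \<in> F \<Longrightarrow> y \<in> F \<Longrightarrow> x * y \<in> F"
    and "x \<in> F \<Longrightarrow> - x \<in> F" "x \<in> F \<Longrightarrow> inverse x \<in> F"
    and "x \<in> F \<Longrightarrow> y \<in> F \<Longrightarrow> x - y \<in> F" "x \<in> F \<Longrightarrow> y \<in> F \<Longrightarrow> x / y \<in> F"
  using assms unfolding is_subfield_def by (auto simp: divide_inverse) (metis diff_conv_add_uminus)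

lemma subfield_sum:
  assumes "is_subfield F" "\<And>i. i \<in> I \<Longrightarrow> f i \<in> F"
  shows "sum f I \<in> F"
  using assms(2) by (induction I rule: infinite_finite_induct) (auto simp: subfield_closed[OF assms(1)])

lemma subfield_of_nat: "is_subfield F \<Longrightarrow> of_nat n \<in> F"
  by (induction n) (auto simp: subfield_closed)

lemma subfield_gen_field [simp]: "is_subfield (gen_field X)"
proof (rule hull_in)
  show "is_subfield (\<Inter> T)" if "Ball T is_subfield" for T :: "'a set set"
    using that by (auto simp: is_subfield_def)
qed

lemma gen_field_least: "is_subfield F \<Longrightarrow> X \<subseteq> F \<Longrightarrow> gen_field X \<subseteq> F"
  by (rule hull_minimal)

lemma gen_field_subset: "X \<subseteq> gen_field Y \<Longrightarrow> gen_field X \<subseteq> gen_field Y"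
  by (intro gen_field_least) simp_all

lemma gen_field_gen_field_Un: "gen_field (gen_field X \<union> Y) = gen_field (X \<union> Y)"
  by (intro subset_antisym gen_field_subset Un_least order.trans[OF _ hull_subset]
        hull_mono) (auto intro: hull_inc)

lemma gen_field_finite:
  assumes "x \<in> gen_field X"
  shows "\<exists>Y. finite Y \<and> Y \<subseteq> X \<and> x \<in> gen_field Y"
proof -
  define F' where "F' = {x. \<exists>Y. finite Y \<and> Y \<subseteq> X \<and> x \<in> gen_field Y}"
  have bin: "f x y \<in> F'" if "x \<in> F'" "y \<in> F'"
    "\<And>F x y. is_subfield F \<Longrightarrow> x \<in> F \<Longrightarrow> y \<in> F \<Longrightarrow> f x y \<in> F" for x y and f :: "'a \<Rightarrow> 'a \<Rightarrow> 'a"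
  proof -
    from that(1,2)[unfolded F'_def] obtain Y Z where "finite Y" "Y \<subseteq> X" "x \<in> gen_field Y" "finite Z" "Z \<subseteq> X" "y \<in> gen_field Z"
      by blast
    thus ?thesis
      using hull_mono[of Y "Y \<union> Z" is_subfield] hull_mono[of Z "Y \<union> Z" is_subfield]
      by (auto simp: F'_def intro!: exI[of _ "Y \<union> Z"] that(3))
  qed
  have un: "f x \<in> F'" if "x \<in> F'" "\<And>F x. is_subfield F \<Longrightarrow> x \<in> F \<Longrightarrow> f x \<in> F" for x f
    using that(1) that(2)[OF subfield_gen_field] unfolding F'_def by blast
  have "0 \<in> F'" "1 \<in> F'"
    using subfield_closed(1,2)[OF subfield_gen_field] unfolding F'_def by blast+
  moreover have "x + y \<in> F'" if "x \<in> F'" "y \<in> F'" for x y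
    by (rule bin[of x y "(+)", OF that subfield_closed(3)])
  moreover have "x * y \<in> F'" if "x \<in> F'" "y \<in> F'" for x y
    by (rule bin[of x y "(*)", OF that subfield_closed(4)])
  moreover have "- x \<in> F'" if "x \<in> F'" for x
    by (rule un[of x uminus, OF that subfield_closed(5)])
  moreover have "inverse x \<in> F'" if "x \<in> F'" for x
    by (rule un[of x inverse, OF that subfield_closed(6)])
  ultimately have "is_subfield F'"
    unfolding is_subfield_def[of F'] by simp
  moreover have "X \<subseteq> F'"
    unfolding F'_def by (auto intro!: exI[of _ "{_}"] hull_inc)
  ultimately show ?thesis using gen_field_least[of F' X] assms unfolding F'_def by blast
qed

section \<open>Intermediate fields of finitely generated extensions\<close>

definition coeffs_in :: "'l::field set \<Rightarrow> 'l poly \<Rightarrow> bool" where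
  "coeffs_in k p \<longleftrightarrow> (\<forall>i. coeff p i \<in> k)"

lemma coeffs_in_closed:
  assumes "is_subfield k"
  shows "coeffs_in k 0" "coeffs_in k 1"
    and "coeffs_in k p \<Longrightarrow> coeffs_in k q \<Longrightarrow> coeffs_in k (p + q)"
    and "coeffs_in k p \<Longrightarrow> coeffs_in k q \<Longrightarrow> coeffs_in k (p - q)"
    and "coeffs_in k p \<Longrightarrow> coeffs_in k q \<Longrightarrow> coeffs_in k (p * q)"
    and "coeffs_in k p \<Longrightarrow> coeffs_in k (- p)"
    and "c \<in> k \<Longrightarrow> coeffs_in k p \<Longrightarrow> coeffs_in k (smult c p)"
    and "c \<in> k \<Longrightarrow> coeffs_in k (monom c n)"
    and "coeffs_in k (pCons c p) \<longleftrightarrow> c \<in> k \<and> coeffs_in k p"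
    and "coeffs_in k p \<Longrightarrow> coeffs_in k (pderiv p)"
  unfolding coeffs_in_def
  using assms
  by (auto simp: coeff_mult coeff_pderiv coeff_pCons split: nat.splits
      intro!: subfield_closed subfield_sum subfield_of_nat)

lemma coeffs_in_mono: "coeffs_in k p \<Longrightarrow> k \<subseteq> k' \<Longrightarrow> coeffs_in k' p"
  by (auto simp: coeffs_in_def)

lemma poly_in_subfield:
  assumes "is_subfield k" "coeffs_in k p" "x \<in> k"
  shows "poly p x \<in> k"
  using assms(2) by (induction p) (auto simp: coeffs_in_closed[OF assms(1)] subfield_closed[OF assms(1)] assms(3))

lemma gen_field_insert_rational:
  assumes k: "is_subfield k" and "x \<in> gen_field (insert u k)"
  shows "\<exists>p q. coeffs_in k p \<and> coeffs_in k q \<and> poly q u \<noteq> 0 \<and> x = poly p u / poly q u"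
proof -
  note cl = coeffs_in_closed[OF k]
  let ?F = "{x. \<exists>p q. coeffs_in k p \<and> coeffs_in k q \<and> poly q u \<noteq> 0 \<and> x = poly p u / poly q u}"
  have "is_subfield ?F"
    unfolding is_subfield_def
  proof (intro conjI ballI)
    have "0 = poly 0 u / poly 1 u" "poly 1 u \<noteq> 0" by simp_all
    thus "0 \<in> ?F" using cl(1,2) by blast
    have "1 = poly 1 u / poly 1 u" "poly 1 u \<noteq> 0" by simp_all
    thus "1 \<in> ?F" using cl(2) by blast
  next
    fix x y assume "x \<in> ?F" "y \<in> ?F"
    then obtain p q r s where *: "coeffs_in k p" "coeffs_in k q" "poly q u \<noteq> 0" "x = poly p u / poly q u"
      "coeffs_in k r" "coeffs_in k s" "poly s u \<noteq> 0" "y = poly r u / poly s u" by auto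
    have "x + y = poly (p * s + r * q) u / poly (q * s) u" "x * y = poly (p * r) u / poly (q * s) u"
      using *(3,7) unfolding *(4,8) by (simp_all add: add_frac_eq)
    moreover have "poly (q * s) u \<noteq> 0" "coeffs_in k (p * s + r * q)" "coeffs_in k (q * s)" "coeffs_in k (p * r)"
      using * cl by auto
    ultimately show "x + y \<in> ?F" "x * y \<in> ?F" by blast+
  next
    fix x assume "x \<in> ?F"
    then obtain p q where *: "coeffs_in k p" "coeffs_in k q" "poly q u \<noteq> 0" "x = poly p u / poly q u" by auto
    show "- x \<in> ?F"
      using * cl(6)[OF *(1)] by (intro CollectI exI[of _ "- p"] exI[of _ q]) simp
    show "inverse x \<in> ?F"
    proof (cases "poly p u = 0")
      case True
      thus ?thesis using * cl(1,2) by (intro CollectI exI[of _ 0] exI[of _ 1]) simp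
    next
      case False
      thus ?thesis using * by (intro CollectI exI[of _ q] exI[of _ p]) simp
    qed
  qed
  moreover have "insert u k \<subseteq> ?F"
  proof -
    have "x \<in> ?F" if "coeffs_in k p" "poly p u = x" for p x
      using that cl(2) by (intro CollectI exI[of _ p] exI[of _ 1]) simp
    from this[of "[:0, 1:]"] this[of "[:_:]"] show ?thesis
      using subfield_closed(1,2)[OF k] by (auto simp: cl)
  qed
  ultimately show ?thesis using gen_field_least assms(2) by blast
qed

text \<open>
  Division with remainder by \<open>m\<close>, carried out with coefficients in the subfield \<open>k\<close>.
\<close>

lemma poly_value_lower_degree:
  assumes k: "is_subfield k" and m: "coeffs_in k m" "m \<noteq> 0" "poly m u = 0" and p: "coeffs_in k p"
  shows "\<exists>q. coeffs_in k q \<and> poly q u = poly p u \<and> degree q < degree m"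
  using p
proof (induction "degree p" arbitrary: p rule: less_induct)
  case less
  note cl = coeffs_in_closed[OF k]
  have m0: "degree m > 0"
  proof (rule ccontr)
    assume "\<not> ?thesis"
    then obtain c where "m = [:c:]" using degree_eq_zeroE by blast
    thus False using m by auto
  qed
  show ?case
  proof (cases "degree p < degree m")
    case True thus ?thesis using less.prems by blast
  next
    case False
    define c where "c = coeff p (degree p) / coeff m (degree m)"
    define r where "r = p - monom c (degree p - degree m) * m"
    have ck: "c \<in> k" unfolding c_def
      using less.prems m k by (auto simp: coeffs_in_def intro!: subfield_closed)
    have rk: "coeffs_in k r" unfolding r_def using less.prems m ck cl by auto
    have ru: "poly r u = poly p u" using m by (simp add: r_def)
    have deg: "degree (monom c (degree p - degree m) * m) \<le> degree p"
      using False degree_mult_le[of "monom c (degree p - degree m)" m] degree_monom_le[of c "degree p - degree m"]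
      by linarith
    have lt: "degree r < degree p"
    proof (rule ccontr)
      assume a: "\<not> ?thesis"
      have "degree r \<le> degree p" unfolding r_def using deg by (intro degree_diff_le) auto
      hence e: "degree r = degree p" using a by simp
      have "coeff (monom c (degree p - degree m) * m) (degree p) = c * coeff m (degree m)"
        using False by (simp add: coeff_monom_mult)
      hence "coeff r (degree p) = 0" using m by (simp add: r_def c_def)
      hence "r = 0" using e by (metis leading_coeff_0_iff)
      thus False using e False m0 by simp
    qed
    thus ?thesis using less.hyps[OF lt rk] ru by auto
  qed
qed

text \<open>
  Write \<open>f = p(u) / q(u)\<close>; then \<open>u\<close> is a root of \<open>f q - p\<close>, which is not the zero polynomial because
  \<open>f \<notin> k\<close>. If \<open>u\<close> is algebraic over \<open>k\<close>, then \<open>p\<close> and \<open>q\<close> can be reduced modulo an equation of \<open>u\<close>,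
  and the degree drops.
\<close>

lemma new_equation_from_rational_function:
  assumes k: "is_subfield k" and f: "f \<in> gen_field (insert u k)" "f \<notin> k"
  shows "\<exists>p. coeffs_in (gen_field (insert f k)) p \<and> p \<noteq> 0 \<and> poly p u = 0"
    and "coeffs_in k m \<Longrightarrow> m \<noteq> 0 \<Longrightarrow> poly m u = 0 \<Longrightarrow>
      \<exists>p. coeffs_in (gen_field (insert f k)) p \<and> p \<noteq> 0 \<and> poly p u = 0 \<and> degree p < degree m"
proof -
  let ?k' = "gen_field (insert f k)"
  have kk': "k \<subseteq> ?k'" and fk': "f \<in> ?k'" by (auto intro: hull_inc)
  note cl = coeffs_in_closed[OF subfield_gen_field[of "insert f k"]]
  have eq: "coeffs_in ?k' (smult f q - p) \<and> smult f q - p \<noteq> 0 \<and> poly (smult f q - p) u = 0"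
    if pq: "coeffs_in k p" "coeffs_in k q" "poly q u \<noteq> 0" "f = poly p u / poly q u" for p q
  proof (intro conjI notI)
    show "coeffs_in ?k' (smult f q - p)"
      using pq(1,2) kk' fk' cl by (meson coeffs_in_mono)
    show "poly (smult f q - p) u = 0" using pq(3,4) by simp
    assume "smult f q - p = 0"
    hence *: "f * coeff q i = coeff p i" for i by (metis coeff_smult eq_iff_diff_eq_0)
    obtain i where i: "coeff q i \<noteq> 0" using pq(3) by (metis coeff_0 poly_0 poly_eqI)
    hence "f = coeff p i / coeff q i" using *[of i] by (simp add: field_simps)
    thus False using f(2) pq(1,2) subfield_closed[OF k] by (auto simp: coeffs_in_def)
  qed
  obtain p q where pq: "coeffs_in k p" "coeffs_in k q" "poly q u \<noteq> 0" "f = poly p u / poly q u"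
    using gen_field_insert_rational[OF k f(1)] by blast
  show "\<exists>p. coeffs_in ?k' p \<and> p \<noteq> 0 \<and> poly p u = 0" using eq[OF pq] by blast
  assume m: "coeffs_in k m" "m \<noteq> 0" "poly m u = 0"
  obtain p' where p': "coeffs_in k p'" "poly p' u = poly p u" "degree p' < degree m"
    using poly_value_lower_degree[OF k m pq(1)] by blast
  obtain q' where q': "coeffs_in k q'" "poly q' u = poly q u" "degree q' < degree m"
    using poly_value_lower_degree[OF k m pq(2)] by blast
  have "degree (smult f q' - p') < degree m"
    using p' q' by (meson degree_diff_less degree_smult_le order_le_less_trans)
  thus "\<exists>p. coeffs_in ?k' p \<and> p \<noteq> 0 \<and> poly p u = 0 \<and> degree p < degree m"
    using eq[of p' q'] p' q' pq by auto
qed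

text \<open>
  If \<open>L\<close> were not finitely generated over \<open>k\<close>, one could go on adjoining elements of \<open>L\<close>, and by
  \<open>new_equation_from_rational_function\<close> the least degree of an equation of \<open>u\<close> would drop each time.
\<close>

lemma intermediate_field_of_simple_extension:
  assumes k: "is_subfield k" and L: "is_subfield L" "k \<subseteq> L" "L \<subseteq> gen_field (insert u k)"
  shows "\<exists>S. finite S \<and> S \<subseteq> L \<and> gen_field (k \<union> S) = L"
proof (rule ccontr)
  assume none: "\<not> ?thesis"
  have ex: "\<exists>f. f \<in> L \<and> f \<notin> gen_field (k \<union> S)" if "finite S" "S \<subseteq> L" for S
    using none that gen_field_least[OF L(1), of "k \<union> S"] L(2) by blast
  have step: "f \<in> gen_field (insert u (gen_field (k \<union> S)))"
    "gen_field (insert f (gen_field (k \<union> S))) = gen_field (k \<union> insert f S)" if "f \<in> L" for f S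
  proof -
    have "insert u k \<subseteq> insert u (gen_field (k \<union> S))" by (auto intro: hull_inc)
    thus "f \<in> gen_field (insert u (gen_field (k \<union> S)))" using L(3) that hull_mono by blast
    show "gen_field (insert f (gen_field (k \<union> S))) = gen_field (k \<union> insert f S)"
      using gen_field_gen_field_Un[of "k \<union> S" "{f}"] by (simp add: Un_commute)
  qed
  define Q where "Q = (\<lambda>n. \<exists>S p. finite S \<and> S \<subseteq> L \<and> coeffs_in (gen_field (k \<union> S)) p \<and> p \<noteq> 0 \<and>
    poly p u = 0 \<and> degree p = n)"
  obtain f where f: "f \<in> L" "f \<notin> gen_field (k \<union> {})" using ex[of "{}"] by auto
  have "\<exists>n. Q n"
    using new_equation_from_rational_function(1)[OF subfield_gen_field step(1)[OF f(1)] f(2)] f(1)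
    unfolding step(2)[OF f(1)] Q_def by blast
  then obtain n where n: "Q n" "\<And>m. m < n \<Longrightarrow> \<not> Q m"
    by (metis exists_least_iff)
  then obtain S p where S: "finite S" "S \<subseteq> L" "coeffs_in (gen_field (k \<union> S)) p" "p \<noteq> 0" "poly p u = 0" "degree p = n"
    unfolding Q_def by blast
  obtain g where g: "g \<in> L" "g \<notin> gen_field (k \<union> S)" using ex[OF S(1,2)] by auto
  obtain q where q: "coeffs_in (gen_field (k \<union> insert g S)) q" "q \<noteq> 0" "poly q u = 0" "degree q < n"
    using new_equation_from_rational_function(2)[OF subfield_gen_field step(1)[OF g(1)] g(2) S(3-5)]
    unfolding step(2)[OF g(1)] S(6) by blast
  hence "Q (degree q)" unfolding Q_def using S g by (metis finite_insert insert_subset)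
  thus False using n(2) q(4) by blast
qed

text \<open>
  Induction on the number of generators, over varying ground fields. With \<open>u\<close> moved into the ground
  field, the induction hypothesis makes \<open>L(u)\<close> finitely generated over \<open>k(u)\<close>, hence equal to \<open>k'(u)\<close>
  for some finitely generated \<open>k' \<subseteq> L\<close>. That leaves the simple extension \<open>k'(u)\<close> of \<open>k'\<close>.
\<close>

theorem intermediate_field_finitely_generated:
  assumes "finite U" "is_subfield L" "k \<subseteq> L" "L \<subseteq> gen_field (k \<union> U)"
  shows "\<exists>S. finite S \<and> S \<subseteq> L \<and> gen_field (k \<union> S) = L"
  using assms
proof (induction U arbitrary: k L rule: finite_induct)
  case empty
  thus ?case using gen_field_least[of L k] by (intro exI[of _ "{}"]) auto
next
  case (insert u U)
  let ?L' = "gen_field (insert u L)"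
  have "insert u k \<subseteq> ?L'" using insert.prems by (auto intro: hull_inc)
  moreover have "?L' \<subseteq> gen_field (insert u k \<union> U)"
    using insert.prems by (intro gen_field_subset) (auto intro: hull_inc)
  ultimately obtain S' where S': "finite S'" "S' \<subseteq> ?L'" "gen_field (insert u k \<union> S') = ?L'"
    using insert.IH[of ?L' "insert u k"] by auto
  have "\<forall>s\<in>S'. \<exists>T. finite T \<and> T \<subseteq> L \<and> s \<in> gen_field (insert u T)"
  proof
    fix s assume "s \<in> S'"
    hence "s \<in> ?L'" using S'(2) by blast
    from gen_field_finite[OF this]
    obtain Y where Y: "finite Y" "Y \<subseteq> insert u L" "s \<in> gen_field Y" by blast
    have "Y \<subseteq> insert u (Y - {u})" by auto
    hence "s \<in> gen_field (insert u (Y - {u}))" using Y hull_mono by blast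
    thus "\<exists>T. finite T \<and> T \<subseteq> L \<and> s \<in> gen_field (insert u T)" using Y by (intro exI[of _ "Y - {u}"]) auto
  qed
  then obtain T where T: "\<And>s. s \<in> S' \<Longrightarrow> finite (T s) \<and> T s \<subseteq> L \<and> s \<in> gen_field (insert u (T s))" by metis
  define k' where "k' = gen_field (k \<union> (\<Union>s\<in>S'. T s))"
  have "s \<in> gen_field (insert u k')" if "s \<in> S'" for s
  proof -
    have "insert u (T s) \<subseteq> insert u k'" using that by (auto simp: k'_def intro: hull_inc)
    thus ?thesis using T[OF that] hull_mono by blast
  qed
  hence "insert u k \<union> S' \<subseteq> gen_field (insert u k')" by (auto simp: k'_def intro: hull_inc)
  hence "L \<subseteq> gen_field (insert u k')"
    using gen_field_subset S'(3) hull_subset[of "insert u L" is_subfield] by blast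
  moreover have "k' \<subseteq> L" unfolding k'_def using insert.prems T by (intro gen_field_least) auto
  ultimately obtain S where S: "finite S" "S \<subseteq> L" "gen_field (k' \<union> S) = L"
    using intermediate_field_of_simple_extension[of k' L u] insert.prems by (auto simp: k'_def)
  have "gen_field (k \<union> ((\<Union>s\<in>S'. T s) \<union> S)) = L"
    using S(3) by (simp add: k'_def gen_field_gen_field_Un Un_assoc)
  moreover have "finite ((\<Union>s\<in>S'. T s) \<union> S)" "(\<Union>s\<in>S'. T s) \<union> S \<subseteq> L" using S S' T by blast+
  ultimately show ?case by blast
qed

section \<open>Derivations and operators that behave like derivations\<close>

definition derivation :: "('l::field \<Rightarrow> 'l) \<Rightarrow> bool" where
  "derivation D \<longleftrightarrow> (\<forall>x y. D (x + y) = D x + D y) \<and> (\<forall>x y. D (x * y) = x * D y + y * D x)"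

lemma derivation_simps:
  assumes "derivation D"
  shows "D (x + y) = D x + D y" "D (x * y) = x * D y + y * D x"
    and "D 0 = 0" "D (- x) = - D x" "D (x - y) = D x - D y"
proof -
  show a: "D (x + y) = D x + D y" "D (x * y) = x * D y + y * D x" for x y
    using assms by (auto simp: derivation_def)
  show z: "D 0 = 0" using a(1)[of 0 0] by (simp only: add_0_right add_cancel_right_right)
  show m: "D (- x) = - D x" for x using a(1)[of x "- x"] z by (simp add: add_eq_0_iff)
  show "D (x - y) = D x - D y" using a(1)[of x "- y"] m by simp
qed

text \<open>
  An additive map that satisfies the Leibniz rule modulo a field \<open>E\<close> takes values in \<open>E\<close> on a field
  that is relatively algebraically closed in \<open>M\<close>: differentiate an equation of least degree.
\<close>

locale derivation_modulo =
  fixes T :: "'l::field \<Rightarrow> 'l" and M E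
  assumes fields: "is_subfield M" "is_subfield E" "M \<subseteq> E"
    and add: "T (x + y) = T x + T y"
    and leibniz: "x \<in> M \<Longrightarrow> y \<in> M \<Longrightarrow> T (x * y) - (x * T y + y * T x) \<in> E"
begin

definition regular where "regular = {x \<in> M. T x \<in> E}"

lemma T_0: "T 0 = 0"
  using add[of 0 0] by (simp only: add_0_right add_cancel_right_right)

lemma T_mult_in:
  assumes "x \<in> M" "y \<in> M"
  shows "T (x * y) \<in> E \<longleftrightarrow> x * T y + y * T x \<in> E"
proof
  assume "T (x * y) \<in> E"
  from subfield_closed(7)[OF fields(2) this leibniz[OF assms]] show "x * T y + y * T x \<in> E" by simp
next
  assume "x * T y + y * T x \<in> E"
  from subfield_closed(3)[OF fields(2) leibniz[OF assms] this] show "T (x * y) \<in> E" by simp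
qed

lemma subfield_regular: "is_subfield regular"
proof -
  note M = subfield_closed[OF fields(1)] and E = subfield_closed[OF fields(2)]
  have T1: "T 1 \<in> E"
  proof -
    have "T (1 * 1) - (1 * T 1 + 1 * T 1) \<in> E" by (rule leibniz[OF M(2) M(2)])
    hence "- T 1 \<in> E" by simp
    from E(5)[OF this] show ?thesis by simp
  qed
  have inv: "T (inverse x) \<in> E" if x: "x \<in> M" "T x \<in> E" "x \<noteq> 0" for x
  proof -
    have xE: "x \<in> E" using x(1) fields(3) by auto
    have "T (x * inverse x) \<in> E" using x T1 by simp
    hence "x * T (inverse x) + inverse x * T x \<in> E" using T_mult_in[OF x(1) M(6)[OF x(1)]] by simp
    from E(7)[OF this E(4)[OF E(6)[OF xE] x(2)]] have "x * T (inverse x) \<in> E" by simp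
    from E(4)[OF E(6)[OF xE] this] have "inverse x * (x * T (inverse x)) \<in> E" .
    thus ?thesis using x(3) by (simp add: mult.assoc[symmetric])
  qed
  show ?thesis
    unfolding is_subfield_def
  proof (intro conjI ballI)
    show "0 \<in> regular" "1 \<in> regular" using M E T_0 T1 by (auto simp: regular_def)
  next
    fix x y assume xy: "x \<in> regular" "y \<in> regular"
    thus "x + y \<in> regular" using M E add by (simp add: regular_def)
    have "x * T y + y * T x \<in> E"
      using xy fields(3) by (auto simp: regular_def intro!: E(3,4))
    thus "x * y \<in> regular" using xy M T_mult_in by (simp add: regular_def)
  next
    fix x assume x: "x \<in> regular"
    have "T (- x) = - T x" using add[of x "- x"] T_0 by (simp add: add_eq_0_iff)
    thus "- x \<in> regular" using x M E by (simp add: regular_def)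
    show "inverse x \<in> regular" using x inv[of x] M by (cases "x = 0") (auto simp: regular_def)
  qed
qed

lemma regular_subset: "regular \<subseteq> M" by (auto simp: regular_def)

lemma T_poly:
  assumes "coeffs_in regular p" "u \<in> M"
  shows "T (poly p u) - poly (pderiv p) u * T u \<in> E"
  using assms(1)
proof (induction p)
  case 0
  thus ?case using T_0 subfield_closed[OF fields(2)] by simp
next
  case (pCons a p)
  note E = subfield_closed[OF fields(2)]
  have ap: "a \<in> regular" "coeffs_in regular p"
    using pCons.prems by (auto simp: coeffs_in_closed[OF subfield_regular])
  have pu: "poly p u \<in> M"
    using poly_in_subfield[OF fields(1) coeffs_in_mono[OF ap(2) regular_subset] assms(2)] .
  have e: "T (poly (pCons a p) u) - poly (pderiv (pCons a p)) u * T u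
      = T a + (T (u * poly p u) - (u * T (poly p u) + poly p u * T u))
        + u * (T (poly p u) - poly (pderiv p) u * T u)"
    by (simp add: add pderiv_pCons algebra_simps)
  have "T a \<in> E" using ap(1) by (simp add: regular_def)
  moreover have "T (u * poly p u) - (u * T (poly p u) + poly p u * T u) \<in> E"
    using leibniz[OF assms(2) pu] .
  moreover have "u * (T (poly p u) - poly (pderiv p) u * T u) \<in> E"
    using E(4)[OF subsetD[OF fields(3) assms(2)] pCons.IH[OF ap(2)]] .
  ultimately show ?case unfolding e by (intro E(3))
qed

lemma algebraic_imp_T_in:
  assumes char0: "\<And>n. (of_nat (Suc n) :: 'l) \<noteq> 0"
    and p: "coeffs_in regular p" "p \<noteq> 0" "poly p u = 0" and u: "u \<in> M"
  shows "T u \<in> E"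
  using p
proof (induction "degree p" arbitrary: p rule: less_induct)
  case less
  note E = subfield_closed[OF fields(2)]
  have deg: "degree p > 0"
  proof (rule ccontr)
    assume "\<not> ?thesis"
    then obtain c where "p = [:c:]" using degree_eq_zeroE by blast
    thus False using less.prems by auto
  qed
  define q where "q = pderiv p"
  have q: "coeffs_in regular q" unfolding q_def by (rule coeffs_in_closed(10)[OF subfield_regular less.prems(1)])
  have "coeff q (degree p - 1) = of_nat (degree p) * coeff p (degree p)"
    using deg by (simp add: q_def coeff_pderiv)
  also have "\<dots> \<noteq> 0" using char0[of "degree p - 1"] deg less.prems(2) by simp
  finally have q0: "q \<noteq> 0" by auto
  have "degree q \<le> degree p - 1"
    unfolding q_def by (rule degree_le) (auto simp: coeff_pderiv intro: coeff_eq_0)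
  hence lt: "degree q < degree p" using deg by linarith
  show ?case
  proof (cases "poly q u = 0")
    case True
    thus ?thesis using less.hyps[OF lt q q0] by blast
  next
    case False
    have "- (poly q u * T u) \<in> E" using T_poly[OF less.prems(1) u] less.prems(3) T_0 by (simp add: q_def)
    from E(5)[OF this] have "poly q u * T u \<in> E" by simp
    moreover have "poly q u \<in> E"
      using subsetD[OF fields(3) poly_in_subfield[OF fields(1) coeffs_in_mono[OF q regular_subset] u]] .
    ultimately have "poly q u * T u / poly q u \<in> E" by (rule E(8))
    thus ?thesis using False by simp
  qed
qed

end

section \<open>Words\<close>

text \<open>
  A derivation in the direction of the matrix unit that maps the basis vector \<open>e\<^sub>a\<close> to \<open>e\<^sub>b\<close> acts on a
  pure tensor of basis vectors by the Leibniz rule: the result is the sum of the words in this list.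
\<close>

fun replace_one :: "'a \<Rightarrow> 'a \<Rightarrow> 'a list \<Rightarrow> 'a list list" where
  "replace_one a b [] = []"
| "replace_one a b (x # w) = (if x = a then [b # w] else []) @ map ((#) x) (replace_one a b w)"

lemma replace_one_mset:
  "v \<in> set (replace_one a b w) \<Longrightarrow> a \<in> set w \<and> add_mset a (mset v) = add_mset b (mset w)"
  by (induction w arbitrary: v) (auto split: if_splits simp: add_mset_commute)

lemma replace_one_nonempty: "a \<in> set w \<Longrightarrow> replace_one a b w \<noteq> []"
  by (induction w) auto

lemma replace_one_length: "v \<in> set (replace_one a b w) \<Longrightarrow> length v = length w"
  using arg_cong[OF conjunct2[OF replace_one_mset], of v a b w size] by simp

lemma replace_one_set: "v \<in> set (replace_one a b w) \<Longrightarrow> set v \<subseteq> insert b (set w)"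
  by (induction w arbitrary: v) (fastforce split: if_splits)+

lemma replace_one_map: "v \<in> set (replace_one a b w) \<Longrightarrow> h a = h b \<Longrightarrow> map h v = map h w"
  by (induction w arbitrary: v) (auto split: if_splits)

definition number_from :: "nat \<Rightarrow> nat list \<Rightarrow> nat" where
  "number_from N w = size (filter_mset (\<lambda>x. N \<le> x) (mset w))"

lemma number_from_conv_filter: "number_from N w = length (filter (\<lambda>x. N \<le> x) w)"
  unfolding number_from_def by (metis mset_filter size_mset)

lemma number_from_replace_one:
  assumes "v \<in> set (replace_one a b w)"
  shows "number_from N v + (if N \<le> a then 1 else 0) = number_from N w + (if N \<le> b then 1 else 0)"
  using arg_cong[OF conjunct2[OF replace_one_mset[OF assms]], of "\<lambda>m. size (filter_mset (\<lambda>x. N \<le> x) m)"]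
  by (auto simp: number_from_def split: if_splits)

lemma number_from_le_length: "number_from N w \<le> length w"
  unfolding number_from_def using size_filter_mset_lesseq[of _ "mset w"] by simp

lemma number_from_antimono: "N \<le> N' \<Longrightarrow> number_from N' w \<le> number_from N w"
  unfolding number_from_def by (intro size_mset_mono multiset_filter_mono) (auto intro: filter_mset_mono_strong)

lemma number_from_eq_length: "number_from N w = length w \<longleftrightarrow> set w \<subseteq> {N..}"
proof -
  have "number_from N w = length w \<longleftrightarrow> (\<forall>x\<in>set w. N \<le> x)"
    unfolding number_from_conv_filter by (metis filter_True length_filter_less less_irrefl)
  thus ?thesis by auto
qed

lemma number_from_eq_0: "set w \<subseteq> {..<N} \<Longrightarrow> number_from N w = 0"
  by (auto simp: number_from_def filter_mset_eq_conv)

text \<open>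
  Two words of the same length have the same pattern iff a strictly monotone renaming of letters takes
  one to the other. Recording the order, and not just the equalities between letters, separates
  different words with the same set of letters (\<open>order_pattern_inject\<close>).
\<close>

definition order_pattern :: "nat list \<Rightarrow> (nat \<times> nat) set" where
  "order_pattern w = {(i, j). i < length w \<and> j < length w \<and> w ! i < w ! j}"

lemma order_pattern_subset: "order_pattern w \<subseteq> {..<length w} \<times> {..<length w}"
  by (auto simp: order_pattern_def)

lemma order_pattern_map:
  assumes "strict_mono_on (set w) h"
  shows "order_pattern (map h w) = order_pattern w"
  using strict_mono_on_less[OF assms] by (auto simp: order_pattern_def)

lemma same_order_pattern:
  assumes "length w = length w'" "order_pattern w = order_pattern w'"
  obtains h where "strict_mono_on (set w) h" "map h w = w'"
proof -
  have lt: "w ! i < w ! j \<longleftrightarrow> w' ! i < w' ! j" if "i < length w" "j < length w" for i j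
    using assms that by (auto simp: order_pattern_def set_eq_iff)
  define h where "h x = w' ! (SOME i. i < length w \<and> w ! i = x)" for x
  have h: "h (w ! i) = w' ! i" if i: "i < length w" for i
  proof -
    define j where "j = (SOME j. j < length w \<and> w ! j = w ! i)"
    have "j < length w \<and> w ! j = w ! i" unfolding j_def by (rule someI[of _ i]) (use i in auto)
    hence "w' ! j = w' ! i" using lt[of i j] lt[of j i] i by auto
    thus ?thesis by (simp add: h_def j_def)
  qed
  have "strict_mono_on (set w) h"
    by (rule strict_mono_onI) (auto simp: in_set_conv_nth h lt)
  moreover have "map h w = w'" using assms(1) h by (intro nth_equalityI) auto
  ultimately show ?thesis using that by blast
qed

lemma strict_mono_on_finite_endo:
  fixes h :: "nat \<Rightarrow> nat"
  assumes "finite A" "strict_mono_on A h" "h ` A = A" "x \<in> A"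
  shows "h x = x"
proof (rule antisym)
  show "x \<le> h x" using assms(4)
  proof (induction x rule: less_induct)
    case (less x)
    show ?case
    proof (rule ccontr)
      assume "\<not> ?thesis"
      hence "h x < x" by simp
      moreover have "h x \<in> A" using less.prems assms(3) by blast
      ultimately show False
        using less.IH[of "h x"] strict_mono_onD[OF assms(2) \<open>h x \<in> A\<close> less.prems] by force
    qed
  qed
next
  show "h x \<le> x"
  proof (rule ccontr)
    assume "\<not> ?thesis"
    let ?B = "{z \<in> A. z < h z}"
    have B: "finite ?B" "x \<in> ?B" using assms \<open>\<not> h x \<le> x\<close> by auto
    define z where "z = Max ?B"
    have z: "z \<in> A" "z < h z" using Max_in[OF B(1)] B(2) unfolding z_def by blast+
    have "h z \<in> A" using z assms(3) by blast
    moreover have "h z < h (h z)" using strict_mono_onD[OF assms(2) z(1) \<open>h z \<in> A\<close> z(2)] .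
    ultimately have "h z \<le> z" unfolding z_def using Max_ge[OF B(1)] by (metis (mono_tags, lifting) mem_Collect_eq z_def)
    thus False using z by simp
  qed
qed

lemma order_pattern_inject:
  assumes "length w = length w'" "order_pattern w = order_pattern w'" "set w = set w'"
  shows "w = w'"
proof -
  obtain h where h: "strict_mono_on (set w) h" "map h w = w'" using same_order_pattern[OF assms(1,2)] .
  have "h ` set w = set w" using h(2) assms(3) by (metis set_map)
  hence "h x = x" if "x \<in> set w" for x using strict_mono_on_finite_endo[OF _ h(1) _ that] by simp
  thus ?thesis using h(2) by (simp add: map_idI)
qed

section \<open>Fields generated by families of tensors\<close>

text \<open>
  The letters are restricted to those from \<open>n\<close> on. This makes room for a shift: once the letters below a
  bound are regarded as constants, a tensor of degree \<open>e\<close> gives rise to tensors of lower degree, by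
  filling some of its places with such letters.
\<close>

definition tensor_family ::
  "(nat \<Rightarrow> nat \<Rightarrow> 'l::field \<Rightarrow> 'l) \<Rightarrow> nat \<Rightarrow> nat \<Rightarrow> (nat list \<Rightarrow> 'l) \<Rightarrow> bool" where
  "tensor_family D n e y \<longleftrightarrow> (\<forall>a b w. n \<le> a \<longrightarrow> n \<le> b \<longrightarrow> a \<noteq> b \<longrightarrow> length w = e \<longrightarrow> set w \<subseteq> {n..} \<longrightarrow>
     D a b (y w) = (\<Sum>v\<leftarrow>replace_one a b w. y v))"

definition tensor_values :: "nat \<Rightarrow> (nat \<times> (nat list \<Rightarrow> 'l)) set \<Rightarrow> 'l set" where
  "tensor_values n Y = {y w | e y w. (e, y) \<in> Y \<and> length w = e \<and> set w \<subseteq> {n..}}"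

lemma subfield_sum_list:
  assumes "is_subfield F" "\<And>v. v \<in> set vs \<Longrightarrow> f v \<in> F"
  shows "(\<Sum>v\<leftarrow>vs. f v) \<in> F"
  using assms(2) by (induction vs) (auto intro: subfield_closed(1,3)[OF assms(1)])

text \<open>
  The elements of \<open>E\<close> that \<open>D\<close> maps into \<open>E\<close> form a field; a derivation is in particular a derivation
  modulo \<open>E\<close>.
\<close>

lemma derivation_gen_field:
  assumes D: "derivation D" and E: "is_subfield E" "gen_field X \<subseteq> E" "\<And>x. x \<in> X \<Longrightarrow> D x \<in> E"
    and x: "x \<in> gen_field X"
  shows "D x \<in> E"
proof -
  interpret derivation_modulo D E E
    using E(1) derivation_simps[OF D] subfield_closed(1)[OF E(1)] by unfold_locales auto
  have "X \<subseteq> regular" using E(2,3) hull_subset[of X is_subfield] by (auto simp: regular_def)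
  thus ?thesis using gen_field_least[OF subfield_regular] x by (auto simp: regular_def)
qed

lemma finite_set_of_values_bounded_words:
  assumes "finite X" "\<And>x. x \<in> X \<Longrightarrow> \<exists>y w. x = y w \<and> P y w \<and> set w \<subseteq> {k :: nat..}"
  shows "\<exists>m. \<forall>x\<in>X. \<exists>y w. x = y w \<and> P y w \<and> set w \<subseteq> {k..<m}"
proof -
  obtain y w where yw: "\<And>x. x \<in> X \<Longrightarrow> x = y x (w x) \<and> P (y x) (w x) \<and> set (w x) \<subseteq> {k..}"
    using assms(2) by metis
  define S where "S = (\<Union>x\<in>X. set (w x))"
  have "finite S" using assms(1) by (simp add: S_def)
  have "set (w x) \<subseteq> {k..<Suc (Max S)}" if x: "x \<in> X" for x
  proof
    fix c assume c: "c \<in> set (w x)"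
    hence "c \<in> S" using x by (auto simp: S_def)
    hence "c \<le> Max S" using \<open>finite S\<close> by simp
    thus "c \<in> {k..<Suc (Max S)}" using yw[OF x] c by auto
  qed
  thus ?thesis using yw by metis
qed

lemma gen_field_first_new_generator:
  assumes "finite U" "f \<in> gen_field (G \<union> U)" "f \<notin> gen_field G"
  shows "\<exists>u V. u \<in> U \<and> V \<subseteq> U \<and> f \<in> gen_field (insert u (G \<union> V)) \<and> f \<notin> gen_field (G \<union> V)"
  using assms
proof (induction U rule: finite_induct)
  case (insert u U)
  show ?case
  proof (cases "f \<in> gen_field (G \<union> U)")
    case True
    thus ?thesis using insert.IH insert.prems by (metis insert_iff subset_insertI2)
  next
    case False
    thus ?thesis using insert.prems by (intro exI[of _ u] exI[of _ U]) auto
  qed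
qed auto

text \<open>
  \<open>D a b\<close> stands for the infinitesimal action of the matrix unit \<open>e\<^sub>a \<mapsto> e\<^sub>b\<close>, and \<open>L\<close> for a field of
  elements that all these derivations kill.
\<close>

locale derivation_family =
  fixes D :: "nat \<Rightarrow> nat \<Rightarrow> 'l::field \<Rightarrow> 'l" and L :: "'l set"
  assumes derivation: "a \<noteq> b \<Longrightarrow> derivation (D a b)"
    and subfield_L: "is_subfield L"
    and D_const: "a \<noteq> b \<Longrightarrow> x \<in> L \<Longrightarrow> D a b x = 0"
    and char0: "(of_nat (Suc m) :: 'l) \<noteq> 0"
begin

definition iterate_D :: "(nat \<times> nat) list \<Rightarrow> 'l \<Rightarrow> 'l" where
  "iterate_D ps = foldr (\<lambda>(a, b). D a b) ps"

lemma iterate_D_simps [simp]: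
  "iterate_D [] x = x" "iterate_D ((a, b) # ps) x = D a b (iterate_D ps x)"
  "iterate_D (ps @ [(a, b)]) x = iterate_D ps (D a b x)"
  by (simp_all add: iterate_D_def)

lemma iterate_D_add:
  "\<forall>(a, b)\<in>set ps. a \<noteq> b \<Longrightarrow> iterate_D ps (x + y) = iterate_D ps x + iterate_D ps y"
  by (induction ps) (auto simp: derivation_simps[OF derivation])

lemma iterate_D_0: "\<forall>(a, b)\<in>set ps. a \<noteq> b \<Longrightarrow> iterate_D ps 0 = 0"
  by (induction ps) (auto simp: derivation_simps[OF derivation])

lemma iterate_D_sum_list:
  assumes "\<forall>(a, b)\<in>set ps. a \<noteq> b"
  shows "iterate_D ps (\<Sum>v\<leftarrow>vs. f v) = (\<Sum>v\<leftarrow>vs. iterate_D ps (f v))"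
  by (induction vs) (simp_all add: iterate_D_0[OF assms] iterate_D_add[OF assms])

lemma iterate_D_constant:
  assumes "\<forall>(a, b)\<in>set ps. a \<noteq> b" "ps \<noteq> []" "x \<in> L"
  shows "iterate_D ps x = 0"
proof -
  obtain a b qs where ps: "ps = qs @ [(a, b)]" using assms(2) by (metis rev_exhaust surj_pair)
  thus ?thesis using assms D_const[of a b x] iterate_D_0[of qs] by auto
qed

end

text \<open>
  The families in \<open>Y\<close> have degree at most \<open>d\<close>. Relative to a bound \<open>N \<ge> n\<close>, the degree of a value \<open>y w\<close>
  is the number of letters of \<open>w\<close> from \<open>N\<close> on.
\<close>

locale tensor_system = derivation_family D L
  for D :: "nat \<Rightarrow> nat \<Rightarrow> 'l::field \<Rightarrow> 'l" and L +
  fixes n d :: nat and Y :: "(nat \<times> (nat list \<Rightarrow> 'l::field)) set"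
  assumes Y: "finite Y" "\<And>e y. (e, y) \<in> Y \<Longrightarrow> e \<le> d" "\<And>e y. (e, y) \<in> Y \<Longrightarrow> tensor_family D n e y"
begin

definition low_values :: "nat \<Rightarrow> nat \<Rightarrow> 'l set" where
  "low_values k N = {y w | e y w. (e, y) \<in> Y \<and> length w = e \<and> set w \<subseteq> {n..} \<and> number_from N w < k}"

definition top_values :: "nat \<Rightarrow> ((nat list \<Rightarrow> 'l) \<times> (nat \<times> nat) set) set \<Rightarrow> 'l set" where
  "top_values N A = {y w | y w. (d, y) \<in> Y \<and> length w = d \<and> set w \<subseteq> {N..} \<and> (y, order_pattern w) \<in> A}"

lemma low_values_mono:
  assumes "k \<le> k'" "N \<le> N'"
  shows "low_values k N \<subseteq> low_values k' N'"
proof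
  fix x assume "x \<in> low_values k N"
  then obtain e y w where *: "x = y w" "(e, y) \<in> Y" "length w = e" "set w \<subseteq> {n..}" "number_from N w < k"
    by (auto simp: low_values_def)
  moreover have "number_from N' w < k'" using number_from_antimono[OF assms(2), of w] *(5) assms(1) by linarith
  ultimately show "x \<in> low_values k' N'" unfolding low_values_def by blast
qed

lemma D_value:
  assumes "(e, y) \<in> Y" "length w = e" "set w \<subseteq> {n..}" "n \<le> a" "n \<le> b" "a \<noteq> b"
  shows "D a b (y w) = (\<Sum>v\<leftarrow>replace_one a b w. y v)"
  using assms Y(3) unfolding tensor_family_def by blast

lemma D_low:
  assumes B: "B \<subseteq> L" and ab: "n \<le> a" "n \<le> b" "a \<noteq> b" and k: "k \<le> k'"
    and step: "\<And>w v. v \<in> set (replace_one a b w) \<Longrightarrow> number_from N w < k \<Longrightarrow> number_from N v < k'"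
    and x: "x \<in> gen_field (B \<union> low_values k N)"
  shows "D a b x \<in> gen_field (B \<union> low_values k' N)"
proof (rule derivation_gen_field[OF derivation[OF ab(3)] subfield_gen_field _ _ x])
  show "gen_field (B \<union> low_values k N) \<subseteq> gen_field (B \<union> low_values k' N)"
    using low_values_mono[OF k order.refl] by (intro hull_mono) auto
  fix z assume "z \<in> B \<union> low_values k N"
  thus "D a b z \<in> gen_field (B \<union> low_values k' N)"
  proof
    assume "z \<in> B"
    hence "D a b z = 0" using B D_const ab by blast
    thus ?thesis by (simp add: subfield_closed)
  next
    assume "z \<in> low_values k N"
    then obtain e y w where z: "z = y w" "(e, y) \<in> Y" "length w = e" "set w \<subseteq> {n..}" "number_from N w < k"
      by (auto simp: low_values_def)
    have "y v \<in> low_values k' N" if v: "v \<in> set (replace_one a b w)" for v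
      using z replace_one_length[OF v] replace_one_set[OF v] ab step[OF v z(5)]
      unfolding low_values_def by blast
    thus ?thesis unfolding z(1) D_value[OF z(2-4) ab]
      by (intro subfield_sum_list subfield_gen_field) (auto intro: hull_inc)
  qed
qed

lemma iterate_D_low_stable:
  assumes "B \<subseteq> L" "n \<le> N" "\<forall>(a, b)\<in>set ps. N \<le> a \<and> N \<le> b \<and> a \<noteq> b" "x \<in> gen_field (B \<union> low_values k N)"
  shows "iterate_D ps x \<in> gen_field (B \<union> low_values k N)"
  using assms(3)
proof (induction ps)
  case (Cons p ps)
  obtain a b where p: "p = (a, b)" by force
  have ab: "N \<le> a" "N \<le> b" "a \<noteq> b" using Cons.prems p by auto
  have "number_from N v = number_from N w" if "v \<in> set (replace_one a b w)" for v w
    using number_from_replace_one[OF that, of N] ab by simp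
  hence "D a b (iterate_D ps x) \<in> gen_field (B \<union> low_values k N)"
    using ab assms(2) Cons by (intro D_low[OF assms(1) _ _ ab(3) order.refl]) auto
  thus ?case by (simp add: p)
qed (use assms in auto)

text \<open>
  Each of the derivations in \<open>ps\<close> turns a letter below \<open>N\<close> into one from \<open>N\<close> on and so raises the degree
  by one. In the Leibniz expansion of a product, all terms but the two extreme ones distribute the
  derivations over both factors and have lower degree. Hence, on elements of degree \<open>0\<close>, \<open>iterate_D ps\<close> is
  a derivation modulo the elements of degree less than \<open>length ps\<close>.
\<close>

lemma iterate_D_low:
  assumes B: "B \<subseteq> L" and ps: "\<forall>(a, b)\<in>set ps. n \<le> a \<and> a < N \<and> N \<le> b" and "n \<le> N"
  shows "x \<in> gen_field (B \<union> low_values 1 N) \<Longrightarrow> iterate_D ps x \<in> gen_field (B \<union> low_values (Suc (length ps)) N)"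
    and "ps \<noteq> [] \<Longrightarrow> x \<in> gen_field (B \<union> low_values 1 N) \<Longrightarrow> y \<in> gen_field (B \<union> low_values 1 N) \<Longrightarrow>
      iterate_D ps (x * y) - (x * iterate_D ps y + y * iterate_D ps x) \<in> gen_field (B \<union> low_values (length ps) N)"
proof -
  have up: "gen_field (B \<union> low_values k N) \<subseteq> gen_field (B \<union> low_values k' N)" if "k \<le> k'" for k k'
    using low_values_mono[OF that order.refl] by (intro hull_mono) auto
  have step: "D a b z \<in> gen_field (B \<union> low_values (Suc k) N)"
    if "n \<le> a" "a < N" "N \<le> b" "z \<in> gen_field (B \<union> low_values k N)" for a b z k
  proof -
    have "number_from N v = Suc (number_from N w)" if "v \<in> set (replace_one a b w)" for v w
      using number_from_replace_one[OF that, of N] \<open>a < N\<close> \<open>N \<le> b\<close> by simp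
    thus ?thesis using that(1-3) assms(3) by (intro D_low[OF B _ _ _ _ _ that(4)]) auto
  qed
  have *: "iterate_D ps x \<in> gen_field (B \<union> low_values (Suc (length ps)) N)"
    if "\<forall>(a, b)\<in>set ps. n \<le> a \<and> a < N \<and> N \<le> b" "x \<in> gen_field (B \<union> low_values 1 N)" for ps x
    using that by (induction ps) (auto intro: step)
  show "x \<in> gen_field (B \<union> low_values 1 N) \<Longrightarrow> iterate_D ps x \<in> gen_field (B \<union> low_values (Suc (length ps)) N)"
    using * ps by blast
  assume "ps \<noteq> []" and xy: "x \<in> gen_field (B \<union> low_values 1 N)" "y \<in> gen_field (B \<union> low_values 1 N)"
  thus "iterate_D ps (x * y) - (x * iterate_D ps y + y * iterate_D ps x) \<in> gen_field (B \<union> low_values (length ps) N)"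
    using ps
  proof (induction ps)
    case (Cons p ps)
    obtain a b where p: "p = (a, b)" by force
    have ab: "n \<le> a" "a < N" "N \<le> b" "a \<noteq> b" using Cons.prems p by auto
    have ps': "\<forall>(a, b)\<in>set ps. n \<le> a \<and> a < N \<and> N \<le> b" using Cons.prems by simp
    note simps = derivation_simps[OF derivation[OF ab(4)]]
    show ?case
    proof (cases "ps = []")
      case True
      thus ?thesis using p simps(2)[of x y] by (simp add: subfield_closed)
    next
      case False
      let ?F = "gen_field (B \<union> low_values (Suc (length ps)) N)"
      let ?I = "iterate_D ps"
      define r where "r = ?I (x * y) - (x * ?I y + y * ?I x)"
      have r: "D a b r \<in> ?F"
        unfolding r_def by (intro step ab Cons.IH False xy ps')
      have z: "D a b z \<in> ?F" "?I z \<in> ?F" if "z \<in> gen_field (B \<union> low_values 1 N)" for z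
        using step[OF ab(1-3) that] up[of "Suc 1" "Suc (length ps)"] False *[OF ps' that]
        by (auto simp: Suc_le_eq)
      have "?I (x * y) = r + (x * ?I y + y * ?I x)" by (simp add: r_def)
      hence "iterate_D (p # ps) (x * y) - (x * iterate_D (p # ps) y + y * iterate_D (p # ps) x)
          = D a b r + (?I y * D a b x + ?I x * D a b y)"
        by (simp add: p simps algebra_simps)
      also have "\<dots> \<in> ?F"
        using r z xy by (intro subfield_closed(3,4)[OF subfield_gen_field])
      finally show ?thesis by simp
    qed
  qed auto
qed

text \<open>
  There are as many replacements as letters below \<open>N\<close> in \<open>w\<close>, so a contribution that survives has none of
  these letters left: whatever the order of the replacements, it is the value at the word \<open>map h w\<close>. The
  number \<open>m\<close> counts the orders, and there are none if the letters replaced are not those of \<open>w\<close>.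
\<close>

lemma iterate_D_value:
  assumes y: "(e, y) \<in> Y" and ps: "\<forall>(a, b)\<in>set ps. n \<le> a \<and> a < N \<and> N \<le> b \<and> h a = b"
    and h: "\<And>x. N \<le> x \<Longrightarrow> h x = x" and w: "length w = e" "set w \<subseteq> {n..}" "number_from N w + length ps = e"
  shows "\<exists>m. iterate_D ps (y w) = of_nat m * y (map h w) \<and>
    (m \<noteq> 0 \<longleftrightarrow> filter_mset (\<lambda>x. x < N) (mset w) = mset (map fst ps))"
  using ps w
proof (induction ps arbitrary: w rule: rev_induct)
  case Nil
  hence "set w \<subseteq> {N..}" using number_from_eq_length[of N w] by simp
  hence "filter_mset (\<lambda>x. x < N) (mset w) = {#}" by (auto simp: filter_mset_eq_conv)
  moreover have "map h w = w" using \<open>set w \<subseteq> {N..}\<close> h by (intro map_idI) auto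
  ultimately show ?case by (intro exI[of _ 1]) simp
next
  case (snoc p ps)
  obtain a b where p: "p = (a, b)" by force
  have ab: "n \<le> a" "a < N" "N \<le> b" "h a = b" "h b = b" "n \<le> b" "a \<noteq> b" using snoc.prems(1) h p by auto
  have ps: "\<forall>(a, b)\<in>set ps. n \<le> a \<and> a < N \<and> N \<le> b \<and> h a = b" using snoc.prems(1) by simp
  hence ps_ne: "\<forall>(a, b)\<in>set ps. a \<noteq> b" by auto
  let ?small = "\<lambda>w. filter_mset (\<lambda>x. x < N) (mset w)"
  let ?R = "replace_one a b w"
  have v: "\<exists>m. iterate_D ps (y v) = of_nat m * y (map h w) \<and>
      (m \<noteq> 0 \<longleftrightarrow> ?small w = mset (map fst (ps @ [p])))" if v: "v \<in> set ?R" for v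
  proof -
    have "number_from N v + length ps = e"
      using number_from_replace_one[OF v, of N] ab snoc.prems(4) by simp
    moreover have "set v \<subseteq> {n..}" using replace_one_set[OF v] snoc.prems(3) ab by auto
    ultimately obtain m where m: "iterate_D ps (y v) = of_nat m * y (map h v)"
        "m \<noteq> 0 \<longleftrightarrow> ?small v = mset (map fst ps)"
      using snoc.IH[OF ps, of v] replace_one_length[OF v] snoc.prems(2) by auto
    have "add_mset a (?small v) = ?small w"
      using arg_cong[OF conjunct2[OF replace_one_mset[OF v]], of "filter_mset (\<lambda>x. x < N)"] ab by simp
    hence "?small v = mset (map fst ps) \<longleftrightarrow> ?small w = mset (map fst (ps @ [p]))"
      using p by (auto simp flip: add_mset_add_single)
    moreover have "map h v = map h w" using replace_one_map[OF v, of h] ab by simp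
    ultimately show ?thesis using m by metis
  qed
  then obtain m where m: "\<And>v. v \<in> set ?R \<Longrightarrow> iterate_D ps (y v) = of_nat (m v) * y (map h w)"
      "\<And>v. v \<in> set ?R \<Longrightarrow> m v \<noteq> 0 \<longleftrightarrow> ?small w = mset (map fst (ps @ [p]))" by metis
  have collect: "(\<Sum>v\<leftarrow>vs. of_nat (m v) * c) = of_nat (\<Sum>v\<leftarrow>vs. m v) * c" for vs and c :: 'l
    by (induction vs) (auto simp: algebra_simps)
  have "iterate_D (ps @ [p]) (y w) = (\<Sum>v\<leftarrow>?R. iterate_D ps (y v))"
    unfolding p using D_value[OF y snoc.prems(2,3) ab(1,6,7)] iterate_D_sum_list[OF ps_ne] by simp
  also have "\<dots> = (\<Sum>v\<leftarrow>?R. of_nat (m v) * y (map h w))"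
    using m(1) by (intro arg_cong[of _ _ sum_list] map_cong) auto
  also have "\<dots> = of_nat (\<Sum>v\<leftarrow>?R. m v) * y (map h w)"
    by (rule collect)
  finally have "iterate_D (ps @ [p]) (y w) = of_nat (\<Sum>v\<leftarrow>?R. m v) * y (map h w)" .
  moreover have "(\<Sum>v\<leftarrow>?R. m v) \<noteq> 0 \<longleftrightarrow> ?small w = mset (map fst (ps @ [p]))"
  proof (cases "a \<in> set w")
    case True
    thus ?thesis using m(2) replace_one_nonempty[OF True, of b] by (cases ?R) auto
  next
    case False
    hence "?R = []" using replace_one_mset[of _ a b w] by (metis list.set_intros(1) list.exhaust)
    moreover have "a \<in># mset (map fst (ps @ [p]))" "a \<notin># ?small w" using p False by simp_all
    hence "?small w \<noteq> mset (map fst (ps @ [p]))" by metis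
    ultimately show ?thesis by simp
  qed
  ultimately show ?case by blast
qed

lemma low_valuesI: "(e, y) \<in> Y \<Longrightarrow> length w = e \<Longrightarrow> set w \<subseteq> {n..} \<Longrightarrow> number_from N w < k \<Longrightarrow> y w \<in> low_values k N"
  unfolding low_values_def by blast

lemma top_valuesI: "(d, y) \<in> Y \<Longrightarrow> length w = d \<Longrightarrow> set w \<subseteq> {N..} \<Longrightarrow> (y, order_pattern w) \<in> A \<Longrightarrow> y w \<in> top_values N A"
  unfolding top_values_def by blast

text \<open>
  The core of the proof. Adjoining \<open>f\<close> makes one of the top values, \<open>u = y0 w0\<close>, algebraic over the
  others. Choose \<open>N'\<close> beyond all letters that occur in this relation, and let \<open>w'\<close> be a word with letters
  from \<open>N'\<close> on and with the same order pattern as \<open>w0\<close>. The product of the derivations that replace the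
  letters of \<open>w0\<close> by those of \<open>w'\<close> is a derivation modulo elements of degree less than \<open>d\<close>. It kills \<open>f\<close>,
  sends elements of lower degree to elements of lower degree, and sends the value \<open>y w\<close> to a multiple of
  \<open>y\<close> at the renamed word, which has the pattern of \<open>w\<close>. Differentiating the algebraic relation
  therefore expresses \<open>y0 w'\<close> by elements of lower degree and top values other than those of \<open>y0\<close> at the
  pattern of \<open>w0\<close>. So this pair of a family and a pattern can be removed from \<open>A\<close>.
\<close>

lemma eliminate_one_top_tensor:
  assumes nN: "n \<le> N" and d: "d > 0" and B: "B \<subseteq> L" and f: "f \<in> L"
    and f_in: "f \<in> gen_field (B \<union> low_values d N \<union> top_values N A)" and f_notin: "f \<notin> gen_field (B \<union> low_values d N)"
  shows "\<exists>N'\<ge>N. \<exists>t\<in>A. gen_field (B \<union> low_values d N \<union> top_values N A) \<subseteq>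
    gen_field (insert f B \<union> low_values d N' \<union> top_values N' (A - {t}))"
proof -
  obtain X where X: "finite X" "X \<subseteq> B \<union> low_values d N \<union> top_values N A" "f \<in> gen_field X"
    using gen_field_finite[OF f_in] by blast
  define G where "G = X \<inter> (B \<union> low_values d N)"
  define U where "U = X - (B \<union> low_values d N)"
  have GU: "finite G" "finite U" "G \<subseteq> B \<union> low_values d N" "U \<subseteq> top_values N A" "G \<union> U = X"
    using X by (auto simp: G_def U_def)
  have "f \<notin> gen_field G" using f_notin hull_mono[OF GU(3)] by blast
  then obtain u V where u: "u \<in> U" "V \<subseteq> U" "f \<in> gen_field (insert u (G \<union> V))" "f \<notin> gen_field (G \<union> V)"
    using gen_field_first_new_generator[OF GU(2)] X(3) GU(5) by metis
  have u_notin: "u \<notin> V" using u(3,4) by (auto simp: insert_absorb)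

  \<comment> \<open>From \<open>N'\<close> on, no letter occurs in the finitely many elements involved.\<close>
  have "\<exists>y w. x = y w \<and> ((length w, y) \<in> Y \<and> number_from N w < d) \<and> set w \<subseteq> {n..}" if "x \<in> G - B" for x
    using that GU(3) unfolding low_values_def by force
  from finite_set_of_values_bounded_words[OF finite_Diff[OF GU(1)] this] obtain m1
    where m1: "\<forall>x\<in>G - B. \<exists>y w. x = y w \<and> ((length w, y) \<in> Y \<and> number_from N w < d) \<and> set w \<subseteq> {n..<m1}"
    by blast
  have "\<exists>y w. x = y w \<and> ((d, y) \<in> Y \<and> length w = d \<and> (y, order_pattern w) \<in> A) \<and> set w \<subseteq> {N..}"
    if "x \<in> U" for x
    using that GU(4) unfolding top_values_def by force
  from finite_set_of_values_bounded_words[OF GU(2) this] obtain m2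
    where m2: "\<forall>x\<in>U. \<exists>y w. x = y w \<and> ((d, y) \<in> Y \<and> length w = d \<and> (y, order_pattern w) \<in> A) \<and>
      set w \<subseteq> {N..<m2}" by blast
  define N' where "N' = max N (max m1 m2)"
  have N': "N \<le> N'" by (simp add: N'_def)
  have G_word: "\<exists>y w. x = y w \<and> (length w, y) \<in> Y \<and> number_from N w < d \<and> set w \<subseteq> {n..<N'}"
    if x: "x \<in> G" "x \<notin> B" for x
  proof -
    obtain y w where yw: "x = y w" "(length w, y) \<in> Y" "number_from N w < d" "set w \<subseteq> {n..<m1}"
      using m1 x by blast
    have "set w \<subseteq> {n..<N'}" by (rule order.trans[OF yw(4)]) (auto simp: N'_def)
    thus ?thesis using yw by blast
  qed
  have U_word: "\<exists>y w. x = y w \<and> (d, y) \<in> Y \<and> length w = d \<and> set w \<subseteq> {N..<N'} \<and> (y, order_pattern w) \<in> A"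
    if x: "x \<in> U" for x
  proof -
    obtain y w where yw: "x = y w" "(d, y) \<in> Y" "length w = d" "(y, order_pattern w) \<in> A" "set w \<subseteq> {N..<m2}"
      using m2 x by blast
    have "set w \<subseteq> {N..<N'}" by (rule order.trans[OF yw(5)]) (auto simp: N'_def)
    thus ?thesis using yw by blast
  qed
  obtain y0 w0 where uw: "u = y0 w0" "(d, y0) \<in> Y" "length w0 = d" "set w0 \<subseteq> {N..<N'}" "(y0, order_pattern w0) \<in> A"
    using U_word[OF u(1)] by blast
  have nN': "{N..<N'} \<subseteq> {n..<N'}" using nN by auto
  define A' where "A' = A - {(y0, order_pattern w0)}"
  define B' where "B' = insert f B"
  define M where "M = gen_field (B' \<union> low_values 1 N')"
  define E where "E = gen_field (B' \<union> low_values d N' \<union> top_values N' A')"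
  have B'L: "B' \<subseteq> L" using B f by (simp add: B'_def)
  have B'M: "B' \<subseteq> M" by (auto simp: M_def intro: hull_inc)
  have fields: "is_subfield M" "is_subfield E" by (simp_all add: M_def E_def)
  have lowE: "gen_field (B' \<union> low_values d N') \<subseteq> E" unfolding E_def by (intro hull_mono) auto
  have "low_values 1 N' \<subseteq> low_values d N'" using d by (intro low_values_mono) auto
  hence "M \<subseteq> gen_field (B' \<union> low_values d N')" unfolding M_def by (intro hull_mono) auto
  hence ME: "M \<subseteq> E" using lowE by blast
  have valM: "y w \<in> M" if "(e, y) \<in> Y" "length w = e" "set w \<subseteq> {n..<N'}" for e y w
  proof -
    have "number_from N' w = 0" using that by (intro number_from_eq_0) auto
    moreover have "set w \<subseteq> {n..}" using that by (auto simp: subset_iff)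
    ultimately have "y w \<in> low_values 1 N'" using that by (intro low_valuesI) auto
    thus ?thesis by (auto simp: M_def intro: hull_inc)
  qed

  have key: "y0 w' \<in> E" if w': "length w' = d" "set w' \<subseteq> {N'..}" "order_pattern w' = order_pattern w0" for w'
  proof -
    obtain h where h: "strict_mono_on (set w0) h" "map h w0 = w'"
      using same_order_pattern[of w0 w'] uw(3) w' by metis
    define h' where "h' x = (if x < N' then h x else x)" for x
    have h': "strict_mono_on (set w0) h'" "map h' w0 = w'" "\<And>x. N' \<le> x \<Longrightarrow> h' x = x"
    proof -
      have eq: "h' x = h x" if "x \<in> set w0" for x
        using subsetD[OF uw(4) that] by (simp add: h'_def)
      show "strict_mono_on (set w0) h'"
        using strict_mono_onD[OF h(1)] eq by (intro strict_mono_onI) simp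
      show "map h' w0 = w'" using h(2) eq by (metis map_eq_conv)
      show "h' x = x" if "N' \<le> x" for x using that by (simp add: h'_def)
    qed
    define ps where "ps = zip w0 w'"
    have lps: "length ps = d" "map fst ps = w0" using uw(3) w'(1) by (auto simp: ps_def)
    have ps: "N \<le> a \<and> a < N' \<and> N' \<le> b \<and> h' a = b" if "(a, b) \<in> set ps" for a b
    proof -
      have "a \<in> set w0" "b \<in> set w'" using that by (auto simp: ps_def dest: set_zip_leftD set_zip_rightD)
      moreover have "h' a = b" using that h'(2) unfolding ps_def by (auto simp: set_zip)
      ultimately show ?thesis using uw(4) w'(2) by auto
    qed
    have ps_n: "\<forall>(a, b)\<in>set ps. n \<le> a \<and> a < N' \<and> N' \<le> b \<and> h' a = b"
      using ps nN by (auto intro: order.trans)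
    have ps_n': "\<forall>(a, b)\<in>set ps. n \<le> a \<and> a < N' \<and> N' \<le> b" using ps_n by auto
    have ps_N: "\<forall>(a, b)\<in>set ps. N \<le> a \<and> N \<le> b \<and> a \<noteq> b" using ps N' by fastforce
    have ps_ne: "\<forall>(a, b)\<in>set ps. a \<noteq> b" using ps_N by auto
    have ps_nonempty: "ps \<noteq> []" using lps(1) d by auto
    interpret derivation_modulo "iterate_D ps" M E
    proof
      fix x y assume "x \<in> M" "y \<in> M"
      hence "iterate_D ps (x * y) - (x * iterate_D ps y + y * iterate_D ps x) \<in> gen_field (B' \<union> low_values (length ps) N')"
        using nN N' unfolding M_def by (intro iterate_D_low(2)[OF B'L ps_n' _ ps_nonempty]) auto
      thus "iterate_D ps (x * y) - (x * iterate_D ps y + y * iterate_D ps x) \<in> E"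
        using lowE lps(1) by auto
    qed (use fields ME iterate_D_add[OF ps_ne] in auto)

    have "B' \<subseteq> regular"
      using B'L B'M iterate_D_constant[OF ps_ne ps_nonempty] subfield_closed(1)[OF fields(2)]
      by (auto simp: regular_def)
    moreover have "G \<subseteq> B' \<union> regular"
    proof
      fix x assume xG: "x \<in> G"
      show "x \<in> B' \<union> regular"
      proof (cases "x \<in> B")
        case False
        then obtain y w where xw: "x = y w" "(length w, y) \<in> Y" "number_from N w < d" "set w \<subseteq> {n..<N'}"
          using G_word[OF xG] by blast
        have "set w \<subseteq> {n..}" using xw(4) by (auto simp: subset_iff)
        hence "x \<in> low_values d N" unfolding xw(1) by (rule low_valuesI[OF xw(2) refl _ xw(3)])
        hence "x \<in> gen_field (B' \<union> low_values d N)" by (auto intro: hull_inc)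
        hence "iterate_D ps x \<in> gen_field (B' \<union> low_values d N)"
          by (rule iterate_D_low_stable[OF B'L nN ps_N])
        moreover have "gen_field (B' \<union> low_values d N) \<subseteq> gen_field (B' \<union> low_values d N')"
          using low_values_mono[OF order.refl N'] by (intro hull_mono) auto
        ultimately have "iterate_D ps x \<in> E" using lowE by blast
        thus ?thesis using valM[OF xw(2) refl xw(4)] xw(1) by (simp add: regular_def)
      qed (simp add: B'_def)
    qed
    moreover have top_value: "\<exists>m. iterate_D ps (y w) = of_nat m * y (map h' w) \<and> (m \<noteq> 0 \<longleftrightarrow> mset w = mset w0)"
      if yw: "(d, y) \<in> Y" "length w = d" "set w \<subseteq> {N..<N'}" for y w
    proof -
      have "number_from N' w = 0" using yw by (intro number_from_eq_0) auto
      moreover have "filter_mset (\<lambda>x. x < N') (mset w) = mset w" using yw by (auto simp: filter_mset_eq_conv)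
      moreover have "set w \<subseteq> {n..}" using yw(3) nN by (auto simp: subset_iff)
      ultimately show ?thesis
        using iterate_D_value[OF yw(1) ps_n h'(3) yw(2)] lps by simp
    qed
    moreover have "V \<subseteq> regular"
    proof
      fix x assume xV: "x \<in> V"
      then obtain y w where xw: "x = y w" "(d, y) \<in> Y" "length w = d" "set w \<subseteq> {N..<N'}" "(y, order_pattern w) \<in> A"
        using u(2) U_word by blast
      obtain m where m: "iterate_D ps (y w) = of_nat m * y (map h' w)" "m \<noteq> 0 \<longleftrightarrow> mset w = mset w0"
        using top_value[OF xw(2-4)] by blast
      have "iterate_D ps x \<in> E"
      proof (cases "mset w = mset w0")
        case False
        thus ?thesis using m xw(1) subfield_closed(1)[OF fields(2)] by simp
      next
        case True
        hence sets: "set w = set w0" by (metis set_mset_mset)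
        have pat: "order_pattern (map h' w) = order_pattern w"
          using h'(1) sets by (intro order_pattern_map) simp
        have "(y, order_pattern w) \<noteq> (y0, order_pattern w0)"
        proof
          assume "(y, order_pattern w) = (y0, order_pattern w0)"
          hence "x = u" using order_pattern_inject[of w w0] sets uw xw by simp
          thus False using xV u_notin by blast
        qed
        moreover have "set (map h' w) \<subseteq> {N'..}" using sets w'(2) h'(2) by (metis set_map)
        ultimately have "y (map h' w) \<in> top_values N' A'"
          using xw pat by (intro top_valuesI) (auto simp: A'_def)
        hence "y (map h' w) \<in> E" by (auto simp: E_def intro: hull_inc)
        thus ?thesis using m(1) xw(1) subfield_closed(4)[OF fields(2)] subfield_of_nat[OF fields(2)] by simp
      qed
      moreover have "x \<in> M" unfolding xw(1) by (rule valM[OF xw(2,3) order.trans[OF xw(4) nN']])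
      ultimately show "x \<in> regular" by (simp add: regular_def)
    qed
    ultimately have sub: "insert f (G \<union> V) \<subseteq> regular" by (auto simp: B'_def)

    \<comment> \<open>\<open>u\<close> is algebraic over \<open>f\<close> and the other elements, hence its image lies in \<open>E\<close>, too.\<close>
    let ?k = "gen_field (G \<union> V)"
    have "f \<in> gen_field (insert u ?k)"
      using u(3) hull_mono[of "insert u (G \<union> V)" "insert u ?k" is_subfield] by (auto intro: hull_inc)
    from new_equation_from_rational_function(1)[OF subfield_gen_field this u(4)]
    obtain p where p: "coeffs_in (gen_field (insert f ?k)) p" "p \<noteq> 0" "poly p u = 0" by blast
    have "?k \<subseteq> regular" using sub by (intro gen_field_least[OF subfield_regular]) auto
    hence "gen_field (insert f ?k) \<subseteq> regular" using sub by (intro gen_field_least[OF subfield_regular]) auto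
    hence "coeffs_in regular p" using coeffs_in_mono[OF p(1)] by blast
    moreover have uM: "u \<in> M" using valM[OF uw(2,3) order.trans[OF uw(4) nN']] uw(1) by simp
    ultimately have "iterate_D ps u \<in> E" using algebraic_imp_T_in[OF char0] p(2,3) by blast
    moreover obtain m where m: "iterate_D ps u = of_nat m * y0 w'" "m \<noteq> 0"
      using top_value[OF uw(2-4)] uw(1) h'(2) by auto
    ultimately have "of_nat m * y0 w' / of_nat m \<in> E"
      using subfield_closed(8)[OF fields(2)] subfield_of_nat[OF fields(2)] by metis
    moreover have "(of_nat m :: 'l) \<noteq> 0" using m(2) char0[of "m - 1"] by simp
    ultimately show ?thesis by simp
  qed

  have "x \<in> E" if "x \<in> top_values N A" for x
  proof -
    obtain y w where xw: "x = y w" "(d, y) \<in> Y" "length w = d" "set w \<subseteq> {N..}" "(y, order_pattern w) \<in> A"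
      using \<open>x \<in> top_values N A\<close> by (auto simp: top_values_def)
    show ?thesis
    proof (cases "set w \<subseteq> {N'..}")
      case True
      show ?thesis
      proof (cases "(y, order_pattern w) = (y0, order_pattern w0)")
        case True
        thus ?thesis using key[of w] xw \<open>set w \<subseteq> {N'..}\<close> by simp
      next
        case False
        hence "x \<in> top_values N' A'" unfolding xw(1) using xw True by (intro top_valuesI) (auto simp: A'_def)
        thus ?thesis by (auto simp: E_def intro: hull_inc)
      qed
    next
      case False
      hence "number_from N' w < d"
        using number_from_eq_length[of N' w] number_from_le_length[of N' w] xw(3) by linarith
      moreover have "set w \<subseteq> {n..}" using xw(4) nN by (auto simp: subset_iff)
      ultimately have "x \<in> low_values d N'" unfolding xw(1) using low_valuesI xw(2,3) by blast
      thus ?thesis by (auto simp: E_def intro: hull_inc)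
    qed
  qed
  moreover have "B \<union> low_values d N \<subseteq> E"
    using low_values_mono[OF order.refl N', of d] by (auto simp: E_def B'_def intro: hull_inc)
  ultimately have "gen_field (B \<union> low_values d N \<union> top_values N A) \<subseteq> E"
    by (intro gen_field_least fields) auto
  thus ?thesis using N' uw(5) unfolding E_def A'_def B'_def by blast
qed

text \<open>
  Each \<open>f \<in> L\<close> that is not yet in the field generated by \<open>B\<close> and the low values costs one element of the
  finite set \<open>A\<close>, so only finitely many such elements have to be adjoined.
\<close>

lemma eliminate_top_tensors:
  assumes "finite A" "n \<le> N" "d > 0" "B \<subseteq> L" "L \<subseteq> gen_field (B \<union> low_values d N \<union> top_values N A)"
  shows "\<exists>N'\<ge>N. \<exists>F. finite F \<and> F \<subseteq> L \<and> L \<subseteq> gen_field (B \<union> F \<union> low_values d N')"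
  using assms
proof (induction "card A" arbitrary: A N B rule: less_induct)
  case less
  show ?case
  proof (cases "L \<subseteq> gen_field (B \<union> low_values d N)")
    case True
    thus ?thesis by (intro exI[of _ N] conjI exI[of _ "{}"]) auto
  next
    case False
    then obtain f where f: "f \<in> L" "f \<notin> gen_field (B \<union> low_values d N)" by blast
    obtain N' t where t: "N \<le> N'" "t \<in> A"
      "gen_field (B \<union> low_values d N \<union> top_values N A) \<subseteq> gen_field (insert f B \<union> low_values d N' \<union> top_values N' (A - {t}))"
      using eliminate_one_top_tensor[OF less.prems(2-4) f(1) _ f(2)] less.prems(5) f(1) by blast
    have "card (A - {t}) < card A" using t(2) less.prems(1) by (rule card_Diff1_less[rotated])
    moreover have "L \<subseteq> gen_field (insert f B \<union> low_values d N' \<union> top_values N' (A - {t}))"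
      using less.prems(5) t(3) by blast
    ultimately obtain N'' F where "N' \<le> N''" "finite F" "F \<subseteq> L" "L \<subseteq> gen_field (insert f B \<union> F \<union> low_values d N'')"
      using less.hyps[of "A - {t}" N' "insert f B"] less.prems t(1) f(1) by auto
    thus ?thesis using t(1) f(1)
      by (intro exI[of _ N''] conjI exI[of _ "insert f F"]) auto
  qed
qed

lemma eliminate_degree:
  assumes "d > 0" "B \<subseteq> L" "L \<subseteq> gen_field (B \<union> tensor_values n Y)"
  shows "\<exists>N\<ge>n. \<exists>F. finite F \<and> F \<subseteq> L \<and> L \<subseteq> gen_field (B \<union> F \<union> low_values d N)"
proof (rule eliminate_top_tensors[OF _ order.refl assms(1,2)])
  let ?A = "(snd ` Y) \<times> Pow ({..<d} \<times> {..<d})"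
  show "finite ?A" using Y(1) by auto
  have "tensor_values n Y \<subseteq> low_values d n \<union> top_values n ?A"
  proof
    fix x assume "x \<in> tensor_values n Y"
    then obtain e y w where x: "x = y w" "(e, y) \<in> Y" "length w = e" "set w \<subseteq> {n..}"
      by (auto simp: tensor_values_def)
    show "x \<in> low_values d n \<union> top_values n ?A"
    proof (cases "e < d")
      case True
      hence "x \<in> low_values d n" unfolding x(1) using x(2-4) number_from_le_length[of n w] by (intro low_valuesI) auto
      thus ?thesis by blast
    next
      case False
      hence "e = d" using Y(2)[OF x(2)] by simp
      have "snd (e, y) \<in> snd ` Y" using x(2) by (rule imageI)
      hence "x \<in> top_values n ?A" unfolding x(1) using x(2-4) \<open>e = d\<close> order_pattern_subset[of w]
        by (intro top_valuesI) auto
      thus ?thesis by blast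
    qed
  qed
  hence "gen_field (B \<union> tensor_values n Y) \<subseteq> gen_field (B \<union> low_values d n \<union> top_values n ?A)"
    by (intro hull_mono) auto
  thus "L \<subseteq> gen_field (B \<union> low_values d n \<union> top_values n ?A)" using assms(3) by blast
qed

end

text \<open>
  A template is a word in which some letters, the holes, are left open; \<open>fill\<close> puts the letters of a
  second word into the holes. When the letters below \<open>N\<close> become constants, the families of lower degree
  are obtained from those of \<open>Y\<close> by filling templates over these letters.
\<close>

fun fill :: "'a option list \<Rightarrow> 'a list \<Rightarrow> 'a list" where
  "fill (None # t) (x # w) = x # fill t w"
| "fill (Some c # t) w = c # fill t w"
| "fill _ _ = []"

definition holes :: "'a option list \<Rightarrow> nat" where
  "holes t = length (filter (\<lambda>x. x = None) t)"

lemma length_fill: "length w = holes t \<Longrightarrow> length (fill t w) = length t"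
  by (induction t w rule: fill.induct) (auto simp: holes_def)

lemma set_fill: "set (fill t w) \<subseteq> set w \<union> {c. Some c \<in> set t}"
  by (induction t w rule: fill.induct) auto

lemma replace_one_fill:
  "length w = holes t \<Longrightarrow> Some a \<notin> set t \<Longrightarrow> replace_one a b (fill t w) = map (fill t) (replace_one a b w)"
  by (induction t w rule: fill.induct) (auto simp: holes_def comp_def)

lemma fill_filter: "fill (map (\<lambda>x. if P x then None else Some x) w) (filter P w) = w"
  by (induction w) auto

lemma holes_map: "holes (map (\<lambda>x. if P x then None else Some x) w) = length (filter P w)"
  by (induction w) (auto simp: holes_def)

context tensor_system
begin

definition templates :: "nat \<Rightarrow> (nat \<times> (nat list \<Rightarrow> 'l)) set" where
  "templates N = {(holes t, \<lambda>w. y (fill t w)) | e y t.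
     (e, y) \<in> Y \<and> length t = e \<and> set t \<subseteq> insert None (Some ` {n..<N}) \<and> holes t < d}"

lemma finite_templates: "finite (templates N)"
proof -
  let ?T = "{t. set t \<subseteq> insert None (Some ` {n..<N}) \<and> length t \<le> d}"
  have "finite ?T" by (intro finite_lists_length_le) auto
  hence "finite ((\<lambda>(y, t). (holes t, \<lambda>w. y (fill t w))) ` ((snd ` Y) \<times> ?T))" using Y(1) by auto
  moreover have "templates N \<subseteq> (\<lambda>(y, t). (holes t, \<lambda>w. y (fill t w))) ` ((snd ` Y) \<times> ?T)"
  proof
    fix z assume "z \<in> templates N"
    then obtain e y t where z: "z = (holes t, \<lambda>w. y (fill t w))" "(e, y) \<in> Y" "length t = e"
      "set t \<subseteq> insert None (Some ` {n..<N})" unfolding templates_def by blast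
    thus "z \<in> (\<lambda>(y, t). (holes t, \<lambda>w. y (fill t w))) ` ((snd ` Y) \<times> ?T)"
      using Y(2)[OF z(2)] by (intro image_eqI[of _ _ "(y, t)"]) force+
  qed
  ultimately show ?thesis by (rule rev_finite_subset)
qed

lemma tensor_family_templates:
  assumes "(e', z) \<in> templates N" "n \<le> N"
  shows "tensor_family D N e' z"
proof -
  obtain e y t where z: "e' = holes t" "z = (\<lambda>w. y (fill t w))" "(e, y) \<in> Y" "length t = e"
      "set t \<subseteq> insert None (Some ` {n..<N})"
    using assms(1) unfolding templates_def by blast
  show ?thesis
    unfolding tensor_family_def
  proof (intro allI impI)
    fix a b w assume *: "N \<le> a" "N \<le> b" "a \<noteq> b" "length w = e'" "set w \<subseteq> {N..}"
    have lw: "length w = holes t" using * z by simp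
    have "set (fill t w) \<subseteq> {n..}" using set_fill[of t w] z(5) * assms(2) by force
    moreover have "Some a \<notin> set t" using z(5) * by auto
    ultimately show "D a b (z w) = (\<Sum>v\<leftarrow>replace_one a b w. z v)"
      using D_value[OF z(3), of "fill t w" a b] length_fill[OF lw] z(4) * assms(2) replace_one_fill[OF lw]
      by (simp add: z(2) comp_def)
  qed
qed

lemma low_subset_templates: "low_values d N \<subseteq> tensor_values N (templates N)"
proof
  fix x assume "x \<in> low_values d N"
  then obtain e y w where x: "x = y w" "(e, y) \<in> Y" "length w = e" "set w \<subseteq> {n..}" "number_from N w < d"
    by (auto simp: low_values_def)
  define t where "t = map (\<lambda>x. if N \<le> x then None else Some x) w"
  have "(holes t, \<lambda>w. y (fill t w)) \<in> templates N"
    unfolding templates_def using x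
    by (intro CollectI exI[of _ e] exI[of _ y] exI[of _ t])
      (auto simp: t_def holes_map number_from_conv_filter)
  moreover have "x = y (fill t (filter (\<lambda>x. N \<le> x) w))" by (simp add: x(1) t_def fill_filter)
  moreover have "length (filter (\<lambda>x. N \<le> x) w) = holes t" by (simp add: t_def holes_map)
  ultimately show "x \<in> tensor_values N (templates N)"
    unfolding tensor_values_def
    by (intro CollectI exI[of _ "holes t"] exI[of _ "\<lambda>w. y (fill t w)"] exI[of _ "filter (\<lambda>x. N \<le> x) w"]) auto
qed

end

text \<open>
  Induction on the degree: after the top degree has been eliminated, the values of lower degree are
  the values of finitely many families of tensors of degree less than \<open>d\<close>, with letters from some \<open>N\<close> on.
  In degree \<open>0\<close> every family has just one value.
\<close>

theorem (in derivation_family) constants_in_finitely_generated_field: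
  assumes "finite Y" "\<And>e y. (e, y) \<in> Y \<Longrightarrow> e \<le> d \<and> tensor_family D n e y"
    and "B \<subseteq> L" "L \<subseteq> gen_field (B \<union> tensor_values n Y)"
  shows "\<exists>F. finite F \<and> L \<subseteq> gen_field (B \<union> F)"
  using assms
proof (induction d arbitrary: n Y B)
  case 0
  have "tensor_values n Y \<subseteq> (\<lambda>(e, y). y []) ` Y"
    using 0(2) unfolding tensor_values_def by force
  thus ?case using 0 by (metis finite_imageI finite_subset)
next
  case (Suc d)
  interpret tensor_system D L n "Suc d" Y
    using Suc.prems by unfold_locales auto
  obtain N F where N: "n \<le> N" "finite F" "F \<subseteq> L" "L \<subseteq> gen_field (B \<union> F \<union> low_values (Suc d) N)"
    using eliminate_degree[OF _ Suc.prems(3,4)] by auto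
  have "B \<union> F \<union> low_values (Suc d) N \<subseteq> (B \<union> F) \<union> tensor_values N (templates N)"
    using low_subset_templates[of N] by auto
  hence "L \<subseteq> gen_field ((B \<union> F) \<union> tensor_values N (templates N))"
    using N(4) hull_mono by blast
  moreover have "e \<le> d \<and> tensor_family D N e y" if "(e, y) \<in> templates N" for e y
    using tensor_family_templates[OF that N(1)] that by (auto simp: templates_def)
  ultimately obtain F' where "finite F'" "L \<subseteq> gen_field (B \<union> F \<union> F')"
    using Suc.IH[OF finite_templates, of N N "B \<union> F"] N(3) Suc.prems(3) by (metis Un_least)
  thus ?case using N(2) by (intro exI[of _ "F \<union> F'"]) (auto simp: Un_assoc)
qed

corollary (in derivation_family) constants_finitely_generated:
  assumes "finite Y" "\<And>e y. (e, y) \<in> Y \<Longrightarrow> tensor_family D n e y"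
    and "B \<subseteq> L" "gen_field (B \<union> tensor_values n Y) = UNIV"
  shows "\<exists>S. finite S \<and> S \<subseteq> L \<and> gen_field (B \<union> S) = L"
proof -
  obtain d where d: "\<And>e y. (e, y) \<in> Y \<Longrightarrow> e \<le> d"
    using Max_ge[of "fst ` Y"] assms(1) by (metis finite_imageI fst_conv image_eqI)
  obtain F where F: "finite F" "L \<subseteq> gen_field (B \<union> F)"
    using constants_in_finitely_generated_field[OF assms(1) _ assms(3), of d n] assms(2,4) d by blast
  show ?thesis using intermediate_field_finitely_generated[OF F(1) subfield_L assms(3) F(2)] .
qed

section \<open>Transvections acting on tensors\<close>

lemma sum_fun_apply: "(\<Sum>x\<in>A. F x) y = (\<Sum>x\<in>A. F x y)"
  by (induction A rule: infinite_finite_induct) auto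

lemma sum_list_fun_apply: "(\<Sum>x\<leftarrow>xs. F x) y = (\<Sum>x\<leftarrow>xs. F x y)"
  by (induction xs) auto

text \<open>
  A curve that is polynomial in \<open>t\<close> and stays in a subspace has its coefficients there:
  \<open>P(2t) - 2\<^sup>e P(t)\<close> has lower degree.
\<close>

lemma polynomial_coefficients_in_subspace:
  fixes scale :: "'k::field_char_0 \<Rightarrow> 'v::ab_group_add \<Rightarrow> 'v"
  assumes "vector_space scale" "module.subspace scale M" "\<And>t. (\<Sum>p\<le>e. scale (t ^ p) (m p)) \<in> M" "p \<le> e"
  shows "m p \<in> M"
  using assms(3,4)
proof (induction e arbitrary: m p)
  interpret vector_space scale by fact
  case 0
  thus ?case using "0.prems"(1)[of 1] by simp
next
  interpret vector_space scale by fact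
  case (Suc e)
  let ?P = "\<lambda>t. \<Sum>p\<le>Suc e. scale (t ^ p) (m p)"
  define c :: "nat \<Rightarrow> 'k" where "c p = 2 ^ p - 2 ^ Suc e" for p
  have "?P (2 * t) - scale (2 ^ Suc e) (?P t) = (\<Sum>p\<le>e. scale (t ^ p) (scale (c p) (m p)))" for t
  proof -
    have "?P (2 * t) - scale (2 ^ Suc e) (?P t) = (\<Sum>p\<le>Suc e. scale (t ^ p) (scale (c p) (m p)))"
      by (simp add: scale_sum_right sum_subtractf[symmetric] c_def power_mult_distrib
          scale_left_diff_distrib algebra_simps del: sum.atMost_Suc)
    thus ?thesis by (simp add: c_def)
  qed
  hence "(\<Sum>p\<le>e. scale (t ^ p) (scale (c p) (m p))) \<in> M" for t
    using subspace_diff[OF assms(2)] subspace_scale[OF assms(2)] Suc.prems(1) by metis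
  hence cm: "scale (c p) (m p) \<in> M" if "p \<le> e" for p using Suc.IH[of "\<lambda>p. scale (c p) (m p)"] that by blast
  have m: "m p \<in> M" if "p \<le> e" for p
  proof -
    have "(2 :: 'k) ^ p \<noteq> 2 ^ Suc e"
      using that by (metis Suc_n_not_le_n of_nat_eq_iff of_nat_numeral of_nat_power power_inject_exp one_less_numeral_iff semiring_norm(76))
    hence "c p \<noteq> 0" by (simp add: c_def)
    moreover have "scale (inverse (c p)) (scale (c p) (m p)) \<in> M" using subspace_scale[OF assms(2) cm[OF that]] .
    ultimately show ?thesis by simp
  qed
  show ?case
  proof (cases "p = Suc e")
    case True
    have "?P 1 - (\<Sum>p\<le>e. m p) \<in> M"
      using m by (intro subspace_diff[OF assms(2)] Suc.prems subspace_sum[OF assms(2)]) auto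
    thus ?thesis using True by simp
  next
    case False
    thus ?thesis using m Suc.prems(2) by simp
  qed
qed

text \<open>
  The elementary matrix \<open>e\<^sub>a \<mapsto> e\<^sub>a + t e\<^sub>b\<close>.
\<close>

definition transvection :: "nat \<Rightarrow> nat \<Rightarrow> 'k::field \<Rightarrow> nat \<Rightarrow> nat \<Rightarrow> 'k" where
  "transvection a b t = (\<lambda>i j. if i = j then 1 else if i = b \<and> j = a then t else 0)"

lemma transvection_in_GL:
  fixes t :: "'k::field"
  assumes "a \<noteq> b"
  shows "transvection a b t \<in> carrier GL"
proof -
  define n where "n = Suc (max a b)"
  define A where "A t = mat n n (\<lambda>(i, j). transvection a b t i j)" for t :: 'k
  have A: "A t \<in> carrier_mat n n" for t :: 'k by (simp add: A_def)
  have inv: "A t * A (- t) = 1\<^sub>m n" for t :: 'k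
  proof (rule eq_matI)
    fix i j assume "i < dim_row (1\<^sub>m n)" "j < dim_col (1\<^sub>m n)"
    hence ij: "i < n" "j < n" by auto
    have n: "a < n" "b < n" by (auto simp: n_def)
    have "(A t * A (- t)) $$ (i, j) = (\<Sum>k<n. transvection a b t i k * transvection a b (- t) k j)"
      using ij by (simp add: A_def scalar_prod_def lessThan_atLeast0)
    also have "\<dots> = (\<Sum>k<n. (if k = i then transvection a b (- t) k j else 0)
        + (if k = a then (if i = b then t * transvection a b (- t) k j else 0) else 0))"
      using assms by (intro sum.cong) (auto simp: transvection_def)
    also have "\<dots> = transvection a b (- t) i j + (if i = b then t * transvection a b (- t) a j else 0)"
      using ij n by (simp add: sum.distrib)
    also have "\<dots> = (if i = j then 1 else 0)" using assms by (auto simp: transvection_def)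
    finally show "(A t * A (- t)) $$ (i, j) = 1\<^sub>m n $$ (i, j)" using ij by simp
  qed (auto simp: A_def)
  have "A (- t) * A t = 1\<^sub>m n" using inv[of "- t"] by simp
  hence "invertible_mat (A t)" using invertible_mat_iff[OF A] A inv by blast
  moreover have "stabilise (A t) = transvection a b t"
    by (auto simp: stabilise_def A_def transvection_def n_def intro!: ext)
  ultimately show ?thesis using stabilise_in_GL[of n "A t"] A by (simp add: n_def)
qed

text \<open>The matrix entry of a transvection on tensor powers, as a polynomial in its parameter.\<close>

fun transvection_poly :: "nat \<Rightarrow> nat \<Rightarrow> nat list \<Rightarrow> nat list \<Rightarrow> 'k::field poly" where
  "transvection_poly a b (x # v) (y # w) =
     [:if x = y then 1 else 0, if x = b \<and> y = a then 1 else 0:] * transvection_poly a b v w"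
| "transvection_poly a b [] [] = 1"
| "transvection_poly a b _ _ = 0"

lemma poly_transvection_poly:
  assumes "a \<noteq> b" "length v = length w"
  shows "poly (transvection_poly a b v w) t = (\<Prod>k<length v. transvection a b t (v ! k) (w ! k))"
  using assms(2)
proof (induction v w rule: list_induct2)
  case (Cons x v y w)
  have "poly [:if x = y then 1 else 0, if x = b \<and> y = a then 1 else 0:] t = transvection a b t x y"
    using assms(1) by (auto simp: transvection_def)
  hence "poly (transvection_poly a b (x # v) (y # w)) t = transvection a b t x y * poly (transvection_poly a b v w) t"
    by (simp only: transvection_poly.simps poly_mult)
  thus ?case using Cons
    by (simp add: prod.lessThan_Suc_shift del: prod.lessThan_Suc transvection_poly.simps)
qed simp

lemma degree_transvection_poly: "degree (transvection_poly a b v w) \<le> length w"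
proof (induction a b v w rule: transvection_poly.induct)
  case (1 a b x v y w)
  define l :: "'a poly" where "l = [:if x = y then 1 else 0, if x = b \<and> y = a then 1 else 0:]"
  have "degree l \<le> 1"
    unfolding l_def by (rule order.trans[OF degree_pCons_le]) simp
  thus ?case using 1 degree_mult_le[of l "transvection_poly a b v w"]
    unfolding transvection_poly.simps l_def[symmetric] by simp
qed auto

lemma count_list_map_Cons: "count_list (map ((#) x) L) (y # w) = (if x = y then count_list L w else 0)"
  by (induction L) auto

lemma count_list_map_Cons_Nil: "count_list (map ((#) x) L) [] = 0"
  by (induction L) auto

lemma coeff_0_transvection_poly: "coeff (transvection_poly a b v w) 0 = (if v = w then 1 else 0)"
  by (induction a b v w rule: transvection_poly.induct) (auto simp: coeff_mult)

lemma coeff_1_transvection_poly: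
  "coeff (transvection_poly a b v w) 1 = of_nat (count_list (replace_one b a v) w)"
proof (induction a b v w rule: transvection_poly.induct)
  case (1 a b x v y w)
  have "coeff ([:c, c':] * p) 1 = c * coeff p 1 + c' * coeff p 0" for c c' :: 'a and p
    by (simp add: mult_pCons_left coeff_pCons)
  thus ?case using 1
    by (auto simp: coeff_0_transvection_poly count_list_map_Cons)
qed (auto simp: count_list_map_Cons_Nil count_list_0_iff)

text \<open>
  The matrix that describes the replacement of \<open>a\<close> by \<open>b\<close> on words is the transpose of the one for the
  replacement of \<open>b\<close> by \<open>a\<close>.
\<close>

lemma count_replace_one_sym: "count_list (replace_one b a v) w = count_list (replace_one a b w) v"
proof (induction v arbitrary: w)
  case Nil
  show ?case by (cases w) (auto simp: count_list_map_Cons_Nil)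
next
  case (Cons x v)
  show ?case
    by (cases w) (auto simp: Cons count_list_map_Cons count_list_map_Cons_Nil)
qed

text \<open>
  The infinitesimal transvection, which replaces the occurrences of \<open>a\<close>, one at a time, by \<open>b\<close>
  (\<open>letter_deriv_basis\<close>). In coordinates this is the transposed replacement; the sum is finite for every
  function on words, so linearity holds without conditions on supports.
\<close>

definition letter_deriv :: "nat \<Rightarrow> nat \<Rightarrow> ('i \<times> nat list \<Rightarrow> 'k::field) \<Rightarrow> ('i \<times> nat list \<Rightarrow> 'k)" where
  "letter_deriv a b t = (\<lambda>(i, v). \<Sum>w\<leftarrow>replace_one b a v. t (i, w))"

lemma sum_mult_count_list:
  fixes f :: "'a \<Rightarrow> 'k::field"
  assumes "finite S" "\<And>w. f w \<noteq> 0 \<Longrightarrow> w \<in> S"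
  shows "(\<Sum>w\<in>S. f w * of_nat (count_list L w)) = (\<Sum>w\<leftarrow>L. f w)"
proof (induction L)
  case (Cons x L)
  have "(\<Sum>w\<in>S. f w * of_nat (count_list (x # L) w)) =
      (\<Sum>w\<in>S. f w * of_nat (count_list L w) + (if w = x then f w else 0))"
    by (intro sum.cong) (auto simp: algebra_simps)
  also have "\<dots> = (\<Sum>w\<leftarrow>x # L. f w)" using Cons assms by (auto simp: sum.distrib)
  finally show ?case .
qed simp

lemma finite_support_slice:
  assumes "finite {x. t x \<noteq> 0}"
  shows "finite {w. t (i, w) \<noteq> 0}"
proof -
  have "{w. t (i, w) \<noteq> 0} = snd ` ({x. t x \<noteq> 0} \<inter> {i} \<times> UNIV)" by force
  thus ?thesis using assms by simp
qed

lemma tensor_act_finite_support: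
  assumes "finite {x. t x \<noteq> 0}"
  shows "tensor_act g t (i, v) =
    (\<Sum>w | t (i, w) \<noteq> 0. if length w = length v then (\<Prod>k<length v. g (v ! k) (w ! k)) * t (i, w) else 0)"
  unfolding tensor_act_def prod.case
  using finite_support_slice[OF assms, of i] by (intro Sum_any.expand_superset) (auto split: if_splits)

lemma tensor_act_transvection:
  fixes m :: "'i \<times> nat list \<Rightarrow> 'k::field"
  assumes m: "finite {x. m x \<noteq> 0}" and e: "\<And>i w. m (i, w) \<noteq> 0 \<Longrightarrow> length w \<le> e" and ab: "a \<noteq> b"
  shows "\<exists>c. (\<forall>t. tensor_act (transvection a b t) m = (\<Sum>p\<le>e. tensor_scale (t ^ p) (c p))) \<and>
    (e \<ge> 1 \<longrightarrow> c 1 = letter_deriv a b m)"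
proof -
  define q where "q i v = (\<Sum>w | m (i, w) \<noteq> 0. smult (m (i, w)) (transvection_poly a b v w))" for i v
  define c where "c p = (\<lambda>(i, v). coeff (q i v) p)" for p
  have "tensor_act (transvection a b t) m (i, v) = (\<Sum>p\<le>e. tensor_scale (t ^ p) (c p)) (i, v)" for t i v
  proof -
    have "tensor_act (transvection a b t) m (i, v)
        = (\<Sum>w | m (i, w) \<noteq> 0. if length w = length v
            then (\<Prod>k<length v. transvection a b t (v ! k) (w ! k)) * m (i, w) else 0)"
      by (rule tensor_act_finite_support[OF m])
    also have "\<dots> = (\<Sum>w | m (i, w) \<noteq> 0. m (i, w) * poly (transvection_poly a b v w) t)"
    proof (intro sum.cong refl)
      have ne: "transvection_poly a b v w = (0 :: 'k poly)" if "length w \<noteq> length v" for v w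
        using that by (induction a b v w rule: transvection_poly.induct) auto
      show "(if length w = length v then (\<Prod>k<length v. transvection a b t (v ! k) (w ! k)) * m (i, w) else 0)
          = m (i, w) * poly (transvection_poly a b v w) t" for w
        using poly_transvection_poly[OF ab, of v w t] ne[of w v] by auto
    qed
    also have "\<dots> = poly (q i v) t" by (simp add: q_def poly_sum)
    also have "\<dots> = (\<Sum>p\<le>degree (q i v). coeff (q i v) p * t ^ p)" by (rule poly_altdef)
    also have "\<dots> = (\<Sum>p\<le>e. coeff (q i v) p * t ^ p)"
    proof (rule sum.mono_neutral_left)
      have "degree (q i v) \<le> e" unfolding q_def
      proof (rule degree_sum_le)
        show "degree (smult (m (i, w)) (transvection_poly a b v w)) \<le> e" if "w \<in> {w. m (i, w) \<noteq> 0}" for w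
          using degree_smult_le[of "m (i, w)" "transvection_poly a b v w"]
            degree_transvection_poly[of a b v w] e[of i w] that
          by (metis (mono_tags, lifting) mem_Collect_eq order.trans)
      qed (rule finite_support_slice[OF m])
      thus "{..degree (q i v)} \<subseteq> {..e}" by simp
    qed (auto simp: coeff_eq_0)
    also have "\<dots> = (\<Sum>p\<le>e. tensor_scale (t ^ p) (c p)) (i, v)"
      by (simp add: sum_fun_apply tensor_scale_def c_def mult.commute)
    finally show ?thesis .
  qed
  moreover have "c 1 = letter_deriv a b m"
  proof (rule ext, clarify)
    fix i v
    have "c 1 (i, v) = (\<Sum>w | m (i, w) \<noteq> 0. m (i, w) * of_nat (count_list (replace_one b a v) w))"
      unfolding c_def q_def by (simp add: coeff_sum coeff_1_transvection_poly[unfolded One_nat_def])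
    also have "\<dots> = letter_deriv a b m (i, v)"
      using sum_mult_count_list[OF finite_support_slice[OF m, of i], of "\<lambda>w. m (i, w)"]
      by (simp add: letter_deriv_def)
    finally show "c 1 (i, v) = letter_deriv a b m (i, v)" .
  qed
  ultimately show ?thesis by (intro exI[of _ c]) (auto simp: fun_eq_iff)
qed

interpretation tensor: vector_space tensor_scale
  by (rule vector_space_tensor_scale)

lemma transvection_expansion:
  fixes M :: "('i \<times> nat list \<Rightarrow> 'k::field_char_0) set"
  assumes M: "tensor_subrep d M" and m: "m \<in> M" and ab: "a \<noteq> b"
  shows "\<exists>e c. (\<forall>t. tensor_act (transvection a b t) m = (\<Sum>p\<le>e. tensor_scale (t ^ p) (c p))) \<and>
    (\<forall>p\<le>e. c p \<in> M) \<and> 1 \<le> e \<and> c 1 = letter_deriv a b m"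
proof -
  have fin: "finite {x. m x \<noteq> 0}" using M m by (auto simp: tensor_subrep_def tensor_sum_def)
  define e where "e = Suc (Max ((length \<circ> snd) ` {x. m x \<noteq> 0}))"
  have e1: "e \<ge> 1" by (simp add: e_def)
  have le: "length w \<le> e" if "m (i, w) \<noteq> 0" for i w
  proof -
    have "length w \<in> (length \<circ> snd) ` {x. m x \<noteq> 0}" using that by (force simp: image_iff)
    thus ?thesis using fin by (simp add: e_def le_SucI)
  qed
  have "\<exists>c. (\<forall>t. tensor_act (transvection a b t) m = (\<Sum>p\<le>e. tensor_scale (t ^ p) (c p))) \<and>
      (e \<ge> 1 \<longrightarrow> c 1 = letter_deriv a b m)"
    by (rule tensor_act_transvection[OF fin _ ab]) (rule le)
  then obtain c where
    c: "\<And>t. tensor_act (transvection a b t) m = (\<Sum>p\<le>e. tensor_scale (t ^ p) (c p))" "c 1 = letter_deriv a b m"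
    using e1 by blast
  have sub: "tensor.subspace M" using M by (simp add: tensor_subrep_def)
  have "(\<Sum>p\<le>e. tensor_scale (t ^ p) (c p)) \<in> M" for t
    using M m transvection_in_GL[OF ab] unfolding c(1)[symmetric] by (auto simp: tensor_subrep_def)
  hence "c p \<in> M" if "p \<le> e" for p
    by (rule polynomial_coefficients_in_subspace[OF vector_space_tensor_scale sub _ that])
  thus ?thesis using c e1 by blast
qed

lemma letter_deriv_in_subrep:
  "tensor_subrep d (M :: ('i \<times> nat list \<Rightarrow> 'k::field_char_0) set) \<Longrightarrow> m \<in> M \<Longrightarrow> a \<noteq> b \<Longrightarrow> letter_deriv a b m \<in> M"
  using transvection_expansion by metis

lemma letter_deriv_linear:
  "letter_deriv a b (s + t) = letter_deriv a b s + letter_deriv a b t"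
  "letter_deriv a b (tensor_scale c t) = tensor_scale c (letter_deriv a b t)"
  "letter_deriv a b 0 = 0"
  by (auto simp: letter_deriv_def tensor_scale_def sum_list_addf sum_list_const_mult fun_eq_iff)

definition basis_tensor :: "'i \<Rightarrow> nat list \<Rightarrow> 'i \<times> nat list \<Rightarrow> 'k::field" where
  "basis_tensor i w = (\<lambda>x. if x = (i, w) then 1 else 0)"

lemma tensor_eq_sum_basis:
  assumes "finite {x. t x \<noteq> 0}"
  shows "t = (\<Sum>x | t x \<noteq> 0. tensor_scale (t x) (basis_tensor (fst x) (snd x)))"
proof (rule ext)
  fix z
  have "(\<Sum>x | t x \<noteq> 0. tensor_scale (t x) (basis_tensor (fst x) (snd x))) z
      = (\<Sum>x | t x \<noteq> 0. if x = z then t x else 0)"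
    by (auto simp: sum_fun_apply tensor_scale_def basis_tensor_def intro!: sum.cong)
  also have "\<dots> = t z" using assms by simp
  finally show "t z = (\<Sum>x | t x \<noteq> 0. tensor_scale (t x) (basis_tensor (fst x) (snd x))) z" by simp
qed

lemma letter_deriv_basis:
  "letter_deriv a b (basis_tensor i w) = (\<Sum>v\<leftarrow>replace_one a b w. (basis_tensor i v :: _ \<Rightarrow> 'k::field))"
proof (rule ext, clarify)
  fix j and u :: "nat list"
  have "(\<Sum>v\<leftarrow>L. if (j, v) = (i, w) then 1 else 0) = (if j = i then of_nat (count_list L w) else 0 :: 'k)" for L
    by (induction L) auto
  moreover have "(\<Sum>v\<leftarrow>L. if (j, u) = (i, v) then 1 else 0) = (if j = i then of_nat (count_list L u) else 0 :: 'k)" for L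
    by (induction L) auto
  ultimately show "letter_deriv a b (basis_tensor i w) (j, u)
      = (\<Sum>v\<leftarrow>replace_one a b w. (basis_tensor i v :: _ \<Rightarrow> 'k)) (j, u)"
    by (simp only: letter_deriv_def basis_tensor_def sum_list_fun_apply prod.case count_replace_one_sym)
qed

lemma sum_list_replace_one:
  "(\<Sum>v\<leftarrow>replace_one a b w. F v) = (\<Sum>k | k < length w \<and> w ! k = a. F (w[k := b]))"
proof (induction w arbitrary: F)
  case (Cons x w)
  have "{k. k < length (x # w) \<and> (x # w) ! k = a}
      = (if x = a then {0} else {}) \<union> Suc ` {k. k < length w \<and> w ! k = a}"
    by (auto simp: less_Suc_eq_0_disj image_iff)
  hence "(\<Sum>k | k < length (x # w) \<and> (x # w) ! k = a. F ((x # w)[k := b]))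
      = (\<Sum>k\<in>(if x = a then {0} else {}). F ((x # w)[k := b])) + (\<Sum>k | k < length w \<and> w ! k = a. F (x # w[k := b]))"
    by (auto simp: sum.union_disjoint sum.reindex)
  thus ?case using Cons.IH[of "\<lambda>v. F (x # v)"] by (auto simp: comp_def)
qed simp

text \<open>
  \<open>overwrite w \<kappa> v\<close> has the letters of \<open>v\<close> at the positions listed in \<open>\<kappa>\<close>.
\<close>

fun overwrite :: "'a list \<Rightarrow> nat list \<Rightarrow> 'a list \<Rightarrow> 'a list" where
  "overwrite w (k # ks) (x # xs) = overwrite (w[k := x]) ks xs"
| "overwrite w _ _ = w"

lemma length_overwrite [simp]: "length (overwrite w ks xs) = length w"
  by (induction w ks xs rule: overwrite.induct) auto

lemma nth_overwrite_notin: "k \<notin> set ks \<Longrightarrow> overwrite w ks xs ! k = w ! k"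
  by (induction w ks xs rule: overwrite.induct) auto

lemma map_nth_overwrite:
  "distinct ks \<Longrightarrow> set ks \<subseteq> {..<length w} \<Longrightarrow> length ks = length xs \<Longrightarrow> map ((!) (overwrite w ks xs)) ks = xs"
proof (induction w ks xs rule: overwrite.induct)
  case (1 w k ks x xs)
  thus ?case using nth_overwrite_notin[of k ks "w[k := x]" xs] by auto
qed auto

definition positions :: "nat \<Rightarrow> nat list set" where
  "positions e = {\<kappa>. length \<kappa> = e \<and> distinct \<kappa> \<and> set \<kappa> = {..<e}}"

lemma overwrite_eq_iff:
  assumes "\<kappa> \<in> positions (length w)" "length v = length w"
  shows "overwrite w \<kappa> v = z \<longleftrightarrow> length z = length w \<and> map ((!) z) \<kappa> = v"
proof -
  have \<kappa>: "length \<kappa> = length v" "distinct \<kappa>" "set \<kappa> = {..<length w}"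
    using assms by (auto simp: positions_def)
  have nth: "map ((!) (overwrite w \<kappa> v)) \<kappa> = v"
    by (rule map_nth_overwrite) (use \<kappa> in simp_all)
  show ?thesis
  proof
    assume "overwrite w \<kappa> v = z"
    thus "length z = length w \<and> map ((!) z) \<kappa> = v" using nth by (metis length_overwrite)
  next
    assume z: "length z = length w \<and> map ((!) z) \<kappa> = v"
    hence "map ((!) (overwrite w \<kappa> v)) \<kappa> = map ((!) z) \<kappa>" using nth by (simp only:)
    hence "\<forall>k\<in>set \<kappa>. overwrite w \<kappa> v ! k = z ! k" by (simp only: map_eq_conv)
    hence "overwrite w \<kappa> v ! k = z ! k" if "k < length w" for k
      using that \<kappa>(3) by simp
    thus "overwrite w \<kappa> v = z" using z by (intro nth_equalityI) (simp_all only: length_overwrite)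
  qed
qed

fun letter_derivs :: "nat list \<Rightarrow> nat list \<Rightarrow> ('i \<times> nat list \<Rightarrow> 'k::field) \<Rightarrow> ('i \<times> nat list \<Rightarrow> 'k)" where
  "letter_derivs (a # as) (b # bs) t = letter_derivs as bs (letter_deriv a b t)"
| "letter_derivs _ _ t = t"

lemma letter_derivs_linear:
  "letter_derivs as bs (s + t) = letter_derivs as bs s + letter_derivs as bs t"
  "letter_derivs as bs (tensor_scale c t) = tensor_scale c (letter_derivs as bs t)"
  "letter_derivs as bs 0 = 0"
  by (induction as bs s arbitrary: t rule: letter_derivs.induct) (simp_all add: letter_deriv_linear)

lemma letter_derivs_sum: "letter_derivs as bs (\<Sum>x\<in>A. F x) = (\<Sum>x\<in>A. letter_derivs as bs (F x))"
  by (induction A rule: infinite_finite_induct)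
    (simp_all only: sum.infinite sum.empty sum.insert letter_derivs_linear not_False_eq_True)

lemma letter_derivs_in_subrep:
  assumes "tensor_subrep d (M :: ('i \<times> nat list \<Rightarrow> 'k::field_char_0) set)" "m \<in> M" "set as \<inter> set bs = {}"
  shows "letter_derivs as bs m \<in> M"
  using assms(2,3)
proof (induction as bs m rule: letter_derivs.induct)
  case (1 a as b bs t)
  have "a \<noteq> b" "set as \<inter> set bs = {}" using "1.prems" by auto
  thus ?case using 1 letter_deriv_in_subrep[OF assms(1)] by simp
qed auto

definition occurrences :: "nat list \<Rightarrow> nat list \<Rightarrow> nat list set" where
  "occurrences w as = {\<kappa>. length \<kappa> = length as \<and> distinct \<kappa> \<and> set \<kappa> \<subseteq> {..<length w} \<and> map ((!) w) \<kappa> = as}"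

lemma finite_occurrences: "finite (occurrences w as)"
  by (rule finite_subset[OF _ finite_lists_length_eq[of "{..<length w}" "length as"]])
    (auto simp: occurrences_def)

lemma occurrences_positions: "\<kappa> \<in> occurrences w as \<Longrightarrow> length as = length w \<Longrightarrow> \<kappa> \<in> positions (length w)"
  unfolding occurrences_def positions_def
  using card_subset_eq[of "{..<length w}" "set \<kappa>"] distinct_card[of \<kappa>] by auto

text \<open>
  The letters in \<open>bs\<close> differ from those in \<open>as\<close>, so a position that has been overwritten is never chosen
  again. The ways to perform the replacements thus correspond to the lists of distinct positions at
  which \<open>w\<close> reads \<open>as\<close>.
\<close>

lemma letter_derivs_basis:
  fixes i :: 'i
  defines "B \<equiv> (basis_tensor i :: _ \<Rightarrow> _ \<Rightarrow> 'k::field)"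
  assumes "length as = length bs" "set as \<inter> set bs = {}"
  shows "letter_derivs as bs (B w) = (\<Sum>\<kappa>\<in>occurrences w as. B (overwrite w \<kappa> bs))"
  using assms(2,3)
proof (induction as bs arbitrary: w rule: list_induct2)
  case Nil
  have "occurrences w [] = {[]}" by (auto simp: occurrences_def)
  thus ?case by simp
next
  case (Cons a as b bs)
  let ?K = "{k. k < length w \<and> w ! k = a}"
  have b: "b \<notin> set as" using Cons.prems by auto
  have nth: "map ((!) (w[k := b])) \<kappa> = as \<longleftrightarrow> k \<notin> set \<kappa> \<and> map ((!) w) \<kappa> = as"
    if "k < length w" "set \<kappa> \<subseteq> {..<length w}" for k \<kappa>
  proof
    assume l: "map ((!) (w[k := b])) \<kappa> = as"
    have k: "k \<notin> set \<kappa>"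
    proof
      assume "k \<in> set \<kappa>"
      hence "w[k := b] ! k \<in> set as" using l by (metis image_eqI list.set_map)
      thus False using b that(1) by simp
    qed
    hence "map ((!) (w[k := b])) \<kappa> = map ((!) w) \<kappa>" 
      by (intro map_cong refl nth_list_update_neq) auto
    thus "k \<notin> set \<kappa> \<and> map ((!) w) \<kappa> = as" using l k by simp
  next
    assume r: "k \<notin> set \<kappa> \<and> map ((!) w) \<kappa> = as"
    hence "map ((!) (w[k := b])) \<kappa> = map ((!) w) \<kappa>" 
      by (intro map_cong refl nth_list_update_neq) auto
    thus "map ((!) (w[k := b])) \<kappa> = as" using r by simp
  qed
  have occ: "occurrences w (a # as) = (\<lambda>(k, \<kappa>). k # \<kappa>) ` (SIGMA k:?K. occurrences (w[k := b]) as)"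
  proof (intro subset_antisym subsetI)
    fix \<kappa> assume "\<kappa> \<in> occurrences w (a # as)"
    then obtain k \<kappa>' where \<kappa>: "\<kappa> = k # \<kappa>'" "length \<kappa>' = length as" "k \<notin> set \<kappa>'" "distinct \<kappa>'" "k < length w"
        "set \<kappa>' \<subseteq> {..<length w}" "w ! k = a" "map ((!) w) \<kappa>' = as"
      by (cases \<kappa>) (auto simp: occurrences_def)
    hence "\<kappa>' \<in> occurrences (w[k := b]) as" using nth[of k \<kappa>'] by (simp add: occurrences_def)
    thus "\<kappa> \<in> (\<lambda>(k, \<kappa>). k # \<kappa>) ` (SIGMA k:?K. occurrences (w[k := b]) as)" using \<kappa> by force
  next
    fix \<kappa> assume "\<kappa> \<in> (\<lambda>(k, \<kappa>). k # \<kappa>) ` (SIGMA k:?K. occurrences (w[k := b]) as)"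
    then obtain k \<kappa>' where \<kappa>: "\<kappa> = k # \<kappa>'" "k < length w" "w ! k = a" "\<kappa>' \<in> occurrences (w[k := b]) as" by auto
    thus "\<kappa> \<in> occurrences w (a # as)" using nth[of k \<kappa>'] by (auto simp: occurrences_def)
  qed
  have "letter_derivs (a # as) (b # bs) (B w)
      = letter_derivs as bs (\<Sum>k\<in>?K. B (w[k := b]))"
    by (simp add: B_def letter_deriv_basis sum_list_replace_one)
  also have "\<dots> = (\<Sum>k\<in>?K. \<Sum>\<kappa>\<in>occurrences (w[k := b]) as. B (overwrite (w[k := b]) \<kappa> bs))"
    using Cons by (simp add: letter_derivs_sum)
  also have "\<dots> = (\<Sum>(k, \<kappa>)\<in>(SIGMA k:?K. occurrences (w[k := b]) as). B (overwrite w (k # \<kappa>) (b # bs)))"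
    by (subst sum.Sigma) (auto simp: finite_occurrences)
  also have "\<dots> = (\<Sum>\<kappa>\<in>occurrences w (a # as). B (overwrite w \<kappa> (b # bs)))"
    unfolding occ by (subst sum.reindex) (auto simp: inj_on_def case_prod_beta)
  finally show ?case .
qed

lemma bij_betw_nth_positions:
  assumes "\<kappa> \<in> positions e"
  shows "bij_betw ((!) \<kappa>) {..<e} {..<e}"
proof (rule bij_betw_nth)
  show "distinct \<kappa>" "{..<e} = {..<length \<kappa>}" "{..<e} = set \<kappa>"
    using assms unfolding positions_def by blast+
qed

lemma nth_overwrite_positions:
  assumes "\<kappa> \<in> positions (length w)" "length v = length w" "j < length w"
  shows "overwrite w \<kappa> v ! (\<kappa> ! j) = v ! j"
proof -
  have "map ((!) (overwrite w \<kappa> v)) \<kappa> = v" using overwrite_eq_iff[OF assms(1,2)] by blast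
  moreover have "j < length \<kappa>" using assms by (simp add: positions_def)
  ultimately show ?thesis by (metis nth_map)
qed

lemma letter_derivs_overwrite:
  fixes i :: 'i
  defines "B \<equiv> (basis_tensor i :: _ \<Rightarrow> _ \<Rightarrow> 'k::field)"
  assumes \<kappa>: "\<kappa> \<in> positions (length w)" and bs: "length bs = length w" "distinct bs" and cs: "length cs = length w"
    and disj: "set bs \<inter> set cs = {}"
  shows "letter_derivs bs cs (B (overwrite w \<kappa> bs)) = B (overwrite w \<kappa> cs)"
proof -
  let ?z = "overwrite w \<kappa> bs"
  have z: "map ((!) ?z) \<kappa> = bs" using overwrite_eq_iff[OF \<kappa> bs(1)] by blast
  have "occurrences ?z bs = {\<kappa>}"
  proof (intro subset_antisym subsetI)
    fix \<kappa>' assume k': "\<kappa>' \<in> occurrences ?z bs"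
    have inj: "inj_on ((!) ?z) (set \<kappa>)" using bs(2) z by (metis distinct_map)
    have "set \<kappa>' \<subseteq> set \<kappa>" using k' \<kappa> by (auto simp: occurrences_def positions_def)
    moreover have "map ((!) ?z) \<kappa>' = map ((!) ?z) \<kappa>" using k' z by (simp add: occurrences_def)
    ultimately have "\<kappa>' = \<kappa>" using inj by (metis inj_on_map_eq_map sup.absorb2)
    thus "\<kappa>' \<in> {\<kappa>}" by simp
  next
    fix \<kappa>' assume "\<kappa>' \<in> {\<kappa>}"
    thus "\<kappa>' \<in> occurrences ?z bs" using z \<kappa> bs by (auto simp: occurrences_def positions_def)
  qed
  moreover have "overwrite ?z \<kappa> cs = overwrite w \<kappa> cs"
    using overwrite_eq_iff[of \<kappa> ?z cs] overwrite_eq_iff[OF \<kappa> cs] \<kappa> cs by (metis length_overwrite)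
  ultimately show ?thesis using letter_derivs_basis[of bs cs i ?z] bs cs disj by (simp add: B_def)
qed

lemma letter_deriv_overwrite:
  fixes i :: 'i
  defines "B \<equiv> (basis_tensor i :: _ \<Rightarrow> _ \<Rightarrow> 'k::field)"
  assumes \<kappa>: "\<kappa> \<in> positions (length w)" and v: "length v = length w"
  shows "letter_deriv a b (B (overwrite w \<kappa> v)) = (\<Sum>u\<leftarrow>replace_one a b v. B (overwrite w \<kappa> u))"
proof -
  let ?z = "overwrite w \<kappa> v"
  have k: "length \<kappa> = length w" "distinct \<kappa>" "set \<kappa> = {..<length w}" using \<kappa> by (auto simp: positions_def)
  have z: "?z ! (\<kappa> ! j) = v ! j" if "j < length w" for j
    by (rule nth_overwrite_positions[OF \<kappa> v that])
  from bij_betw_nth_positions[OF \<kappa>] have "bij_betw ((!) \<kappa>) {j \<in> {..<length w}. v ! j = a} {l \<in> {..<length w}. ?z ! l = a}"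
    by (rule bij_betw_Collect) (simp add: z)
  moreover have "{j \<in> {..<length w}. v ! j = a} = {j. j < length v \<and> v ! j = a}"
    "{l \<in> {..<length w}. ?z ! l = a} = {l. l < length ?z \<and> ?z ! l = a}" using v by auto
  ultimately have bij: "bij_betw ((!) \<kappa>) {j. j < length v \<and> v ! j = a} {l. l < length ?z \<and> ?z ! l = a}" by simp
  have upd: "overwrite w \<kappa> (v[j := b]) = ?z[\<kappa> ! j := b]" if j: "j < length v" for j
  proof -
    have "map ((!) (?z[\<kappa> ! j := b])) \<kappa> = v[j := b]"
    proof (rule nth_equalityI)
      fix l assume "l < length (map ((!) (?z[\<kappa> ! j := b])) \<kappa>)"
      hence l: "l < length w" using k by simp
      have "\<kappa> ! j < length w" using k j v by (metis lessThan_iff nth_mem)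
      thus "map ((!) (?z[\<kappa> ! j := b])) \<kappa> ! l = v[j := b] ! l"
        using l k z[OF l] j v by (auto simp: nth_list_update nth_eq_iff_index_eq)
    qed (use k v in simp)
    thus ?thesis using overwrite_eq_iff[OF \<kappa>, of "v[j := b]"] v by simp
  qed
  have "letter_deriv a b (B ?z) = (\<Sum>l | l < length ?z \<and> ?z ! l = a. B (?z[l := b]))"
    by (simp only: B_def letter_deriv_basis sum_list_replace_one)
  also have "\<dots> = (\<Sum>j | j < length v \<and> v ! j = a. B (?z[\<kappa> ! j := b]))"
    by (rule sum.reindex_bij_betw[OF bij, symmetric])
  also have "\<dots> = (\<Sum>j | j < length v \<and> v ! j = a. B (overwrite w \<kappa> (v[j := b])))"
    using upd by (intro sum.cong) auto
  also have "\<dots> = (\<Sum>u\<leftarrow>replace_one a b v. B (overwrite w \<kappa> u))"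
    by (simp only: sum_list_replace_one)
  finally show ?thesis .
qed

text \<open>
  For fixed positions, the basis tensors \<open>overwrite w \<kappa> v\<close> span a copy of the tensor power of degree
  \<open>length w\<close>, up to a permutation of the factors; \<open>Q\<close> contains the row indices that matter for the
  letters of \<open>v\<close>.
\<close>

lemma tensor_act_overwrite:
  assumes \<kappa>: "\<kappa> \<in> positions (length w)" and v: "length v = length w"
    and Q: "finite Q" "\<And>r c. c \<in> set v \<Longrightarrow> g r c \<noteq> 0 \<Longrightarrow> r \<in> Q"
  shows "tensor_act g (basis_tensor i (overwrite w \<kappa> v)) =
    (\<Sum>u | length u = length w \<and> set u \<subseteq> Q. tensor_scale (\<Prod>j<length w. g (u ! j) (v ! j)) (basis_tensor i (overwrite w \<kappa> u)))"
proof (rule ext, clarify)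
  fix i' and z :: "nat list"
  let ?z0 = "overwrite w \<kappa> v" and ?e = "length w" and ?u0 = "map ((!) z) \<kappa>"
  let ?U = "{u. length u = ?e \<and> set u \<subseteq> Q}"
  have k: "length \<kappa> = ?e" "distinct \<kappa>" "set \<kappa> = {..<?e}" using \<kappa> by (auto simp: positions_def)
  have U: "finite ?U" using finite_lists_length_eq[OF Q(1), of ?e] by (simp add: conj_commute)
  have z0: "?z0 ! (\<kappa> ! j) = v ! j" if "j < ?e" for j
    by (rule nth_overwrite_positions[OF \<kappa> v that])
  have "tensor_act g (basis_tensor i ?z0) (i', z) =
      Sum_any (\<lambda>w'. if w' = ?z0 then (if i' = i \<and> length z = ?e then \<Prod>l<?e. g (z ! l) (?z0 ! l) else 0) else 0)"
    unfolding tensor_act_def basis_tensor_def prod.case by (intro arg_cong[of _ _ Sum_any] ext) auto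
  also have "\<dots> = (if i' = i \<and> length z = ?e then \<Prod>l<?e. g (z ! l) (?z0 ! l) else 0)"
    by (subst Sum_any.expand_superset[of "{?z0}"]) auto
  also have "(\<Prod>l<?e. g (z ! l) (?z0 ! l)) = (\<Prod>j<?e. g (z ! (\<kappa> ! j)) (v ! j))"
  proof -
    from prod.reindex_bij_betw[OF bij_betw_nth_positions[OF \<kappa>], of "\<lambda>l. g (z ! l) (?z0 ! l)"] show ?thesis
      using z0 by (auto intro!: prod.cong)
  qed
  also have "\<dots> = (\<Prod>j<?e. g (?u0 ! j) (v ! j))" using k by (intro prod.cong) auto
  finally have lhs: "tensor_act g (basis_tensor i ?z0) (i', z) =
      (if i' = i \<and> length z = ?e then \<Prod>j<?e. g (?u0 ! j) (v ! j) else 0)" .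
  have "(\<Sum>u\<in>?U. tensor_scale (\<Prod>j<?e. g (u ! j) (v ! j)) (basis_tensor i (overwrite w \<kappa> u))) (i', z)
      = (\<Sum>u\<in>?U. if u = ?u0 then (if i' = i \<and> length z = ?e then \<Prod>j<?e. g (?u0 ! j) (v ! j) else 0) else 0)"
    unfolding sum_fun_apply tensor_scale_def basis_tensor_def
  proof (intro sum.cong refl)
    fix u assume "u \<in> ?U"
    hence "overwrite w \<kappa> u = z \<longleftrightarrow> length z = ?e \<and> ?u0 = u" using overwrite_eq_iff[OF \<kappa>, of u z] by simp
    thus "(\<Prod>j<?e. g (u ! j) (v ! j)) * (if (i', z) = (i, overwrite w \<kappa> u) then 1 else 0) =
        (if u = ?u0 then (if i' = i \<and> length z = ?e then \<Prod>j<?e. g (?u0 ! j) (v ! j) else 0) else 0)" by auto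
  qed
  also have "\<dots> = (if ?u0 \<in> ?U then (if i' = i \<and> length z = ?e then \<Prod>j<?e. g (?u0 ! j) (v ! j) else 0) else 0)"
    using U by (simp add: sum.delta)
  also have "\<dots> = (if i' = i \<and> length z = ?e then \<Prod>j<?e. g (?u0 ! j) (v ! j) else 0)"
  proof (cases "?u0 \<in> ?U")
    case False
    hence "\<not> set ?u0 \<subseteq> Q" using k by simp
    then obtain j where j: "j < ?e" "?u0 ! j \<notin> Q" using k(1) by (metis in_set_conv_nth length_map subsetI)
    hence "g (?u0 ! j) (v ! j) = 0" using Q(2)[of "v ! j" "?u0 ! j"] v by auto
    hence "(\<Prod>j<?e. g (?u0 ! j) (v ! j)) = 0" using j by (intro prod_zero) auto
    thus ?thesis by simp
  qed simp
  finally show "tensor_act g (basis_tensor i ?z0) (i', z) =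
      (\<Sum>u\<in>?U. tensor_scale (\<Prod>j<?e. g (u ! j) (v ! j)) (basis_tensor i (overwrite w \<kappa> u))) (i', z)"
    using lhs by simp
qed

lemma finite_support_basis: "finite {x. basis_tensor i w x \<noteq> (0 :: 'k::field)}"
  by (rule finite_subset[of _ "{(i, w)}"]) (auto simp: basis_tensor_def)

lemma finite_support_add:
  "finite {x. s x \<noteq> 0} \<Longrightarrow> finite {x. t x \<noteq> 0} \<Longrightarrow> finite {x. (s + t) x \<noteq> (0 :: 'k::field)}"
  by (rule finite_subset[of _ "{x. s x \<noteq> 0} \<union> {x. t x \<noteq> 0}"]) auto

lemma finite_support_scale:
  "finite {x. t x \<noteq> 0} \<Longrightarrow> finite {x. tensor_scale c t x \<noteq> (0 :: 'k::field)}"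
  by (rule finite_subset[of _ "{x. t x \<noteq> 0}"]) (auto simp: tensor_scale_def)

lemma finite_support_sum:
  "(\<And>x. x \<in> A \<Longrightarrow> finite {z. F x z \<noteq> 0}) \<Longrightarrow> finite {z. (\<Sum>x\<in>A. F x) z \<noteq> (0 :: 'k::field)}"
proof (induction A rule: infinite_finite_induct)
  case (insert x A)
  have "(\<Sum>x\<in>insert x A. F x) = F x + (\<Sum>x\<in>A. F x)" using insert.hyps by (rule sum.insert)
  thus ?case using finite_support_add[of "F x" "\<Sum>x\<in>A. F x"] insert by (metis insertCI)
qed auto

lemma tensor_act_add:
  fixes s t :: "'i \<times> nat list \<Rightarrow> 'k::field"
  assumes "finite {x. s x \<noteq> 0}" "finite {x. t x \<noteq> 0}"
  shows "tensor_act g (s + t) = tensor_act g s + tensor_act g t"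
proof (rule ext, clarify)
  fix i :: 'i and v :: "nat list"
  let ?f = "\<lambda>t w. if length w = length v then (\<Prod>k<length v. g (v ! k) (w ! k)) * t (i, w) else 0"
  have fin: "finite {w. ?f t w \<noteq> 0}" if "finite {x. t x \<noteq> 0}" for t
    by (rule finite_subset[OF _ finite_support_slice[OF that, of i]]) (auto split: if_splits)
  have "Sum_any (?f (s + t)) = Sum_any (\<lambda>w. ?f s w + ?f t w)"
    by (intro arg_cong[of _ _ Sum_any] ext) (auto simp: algebra_simps)
  thus "tensor_act g (s + t) (i, v) = (tensor_act g s + tensor_act g t) (i, v)"
    using Sum_any.distrib[OF fin[OF assms(1)] fin[OF assms(2)]] by (simp add: tensor_act_def)
qed

lemma tensor_act_scale:
  fixes t :: "'i \<times> nat list \<Rightarrow> 'k::field"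
  assumes "finite {x. t x \<noteq> 0}"
  shows "tensor_act g (tensor_scale c t) = tensor_scale c (tensor_act g t)"
proof (rule ext, clarify)
  fix i :: 'i and v :: "nat list"
  let ?f = "\<lambda>t w. if length w = length v then (\<Prod>k<length v. g (v ! k) (w ! k)) * t (i, w) else 0"
  have fin: "finite {w. ?f t w \<noteq> 0}"
    by (rule finite_subset[OF _ finite_support_slice[OF assms, of i]]) (auto split: if_splits)
  have "tensor_act g (tensor_scale c t) (i, v) = Sum_any (?f (tensor_scale c t))"
    by (simp add: tensor_act_def)
  also have "\<dots> = Sum_any (\<lambda>w. c * ?f t w)"
    by (intro arg_cong[of _ _ Sum_any] ext) (auto simp: tensor_scale_def)
  also have "\<dots> = c * Sum_any (?f t)" by (rule Sum_any_right_distrib[OF fin, symmetric])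
  also have "\<dots> = tensor_scale c (tensor_act g t) (i, v)" by (simp add: tensor_act_def tensor_scale_def)
  finally show "tensor_act g (tensor_scale c t) (i, v) = tensor_scale c (tensor_act g t) (i, v)" .
qed

lemma tensor_act_0: "tensor_act g 0 = 0"
  by (auto simp: tensor_act_def fun_eq_iff cong: if_cong)

lemma tensor_act_sum:
  "(\<And>x. x \<in> A \<Longrightarrow> finite {z. F x z \<noteq> 0}) \<Longrightarrow> tensor_act g (\<Sum>x\<in>A. F x) = (\<Sum>x\<in>A. tensor_act g (F x))"
proof (induction A rule: infinite_finite_induct)
  case (insert x A)
  have "tensor_act g (F x + (\<Sum>x\<in>A. F x)) = tensor_act g (F x) + tensor_act g (\<Sum>x\<in>A. F x)"
    using insert.prems by (intro tensor_act_add finite_support_sum) auto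
  also have "tensor_act g (\<Sum>x\<in>A. F x) = (\<Sum>x\<in>A. tensor_act g (F x))"
    using insert by blast
  finally show ?case by (simp only: sum.insert[OF insert.hyps])
qed (simp_all only: sum.empty sum.infinite tensor_act_0 not_False_eq_True)

section \<open>Polarisation\<close>

text \<open>
  The part of degree \<open>e\<close> of \<open>m\<close>, with the word \<open>as\<close> replaced by \<open>v\<close> in all possible ways. As a function of
  \<open>v\<close> it is an equivariant map from the tensor power of degree \<open>e\<close>.
\<close>

definition polarisation ::
  "('i \<times> nat list \<Rightarrow> 'k::field) \<Rightarrow> nat \<Rightarrow> nat list \<Rightarrow> nat list \<Rightarrow> ('i \<times> nat list \<Rightarrow> 'k)" where
  "polarisation m e as v = (\<Sum>x | m x \<noteq> 0 \<and> length (snd x) = e.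
     \<Sum>\<kappa>\<in>occurrences (snd x) as. tensor_scale (m x) (basis_tensor (fst x) (overwrite (snd x) \<kappa> v)))"

text \<open>
  Replace \<open>as\<close> by a word \<open>bs\<close> of distinct fresh letters and then \<open>bs\<close> by \<open>v\<close>. The detour is needed because
  letters of \<open>v\<close> may occur in \<open>as\<close>. Words shorter than \<open>e\<close> do not have enough letters and are killed.
\<close>

lemma polarisation_in_subrep:
  fixes M :: "('i \<times> nat list \<Rightarrow> 'k::field_char_0) set"
  assumes M: "tensor_subrep d M" "m \<in> M" and e: "\<And>x. m x \<noteq> 0 \<Longrightarrow> length (snd x) \<le> e"
    and len: "length as = e" "length v = e"
  shows "polarisation m e as v \<in> M"
proof -
  have fin: "finite {x. m x \<noteq> 0}" using M by (auto simp: tensor_subrep_def tensor_sum_def)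
  define N where "N = Suc (Max (insert 0 (set as \<union> set v)))"
  define bs where "bs = [N..<N + e]"
  have bs: "length bs = e" "distinct bs" by (auto simp: bs_def)
  have len_as: "length as = length bs" using len bs by simp
  have lt: "x < N" if "x \<in> set as \<union> set v" for x
    using that Max_ge[of "insert 0 (set as \<union> set v)" x] by (simp add: N_def less_Suc_eq_le)
  have disj: "set as \<inter> set bs = {}" "set bs \<inter> set v = {}"
    using lt by (auto simp: bs_def simp flip: not_less)
  let ?B = "\<lambda>x \<kappa> u. tensor_scale (m x) (basis_tensor (fst x) (overwrite (snd x) \<kappa> u))"
  let ?X = "{x. m x \<noteq> 0 \<and> length (snd x) = e}"
  have "letter_derivs as bs m = letter_derivs as bs (\<Sum>x | m x \<noteq> 0. tensor_scale (m x) (basis_tensor (fst x) (snd x)))"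
    by (rule arg_cong[OF tensor_eq_sum_basis[OF fin]])
  also have "\<dots> = (\<Sum>x | m x \<noteq> 0. \<Sum>\<kappa>\<in>occurrences (snd x) as. ?B x \<kappa> bs)"
    by (simp only: letter_derivs_basis[OF len_as disj(1)] letter_derivs_sum letter_derivs_linear(2) tensor.scale_sum_right)
  also have "\<dots> = (\<Sum>x\<in>?X. \<Sum>\<kappa>\<in>occurrences (snd x) as. ?B x \<kappa> bs)"
  proof (rule sum.mono_neutral_right[OF fin])
    show "\<forall>x\<in>{x. m x \<noteq> 0} - ?X. (\<Sum>\<kappa>\<in>occurrences (snd x) as. ?B x \<kappa> bs) = 0"
    proof
      fix x assume x: "x \<in> {x. m x \<noteq> 0} - ?X"
      hence short: "length (snd x) < e" using e[of x] by auto
      have "\<kappa> \<notin> occurrences (snd x) as" for \<kappa>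
      proof
        assume "\<kappa> \<in> occurrences (snd x) as"
        hence \<kappa>: "length \<kappa> = e" "distinct \<kappa>" "set \<kappa> \<subseteq> {..<length (snd x)}"
          using len(1) unfolding occurrences_def by simp_all
        thus False using short card_mono[OF _ \<kappa>(3)] distinct_card[OF \<kappa>(2)] by simp
      qed
      hence "occurrences (snd x) as = {}" by blast
      thus "(\<Sum>\<kappa>\<in>occurrences (snd x) as. ?B x \<kappa> bs) = 0" by (simp only: sum.empty)
    qed
  qed auto
  finally have "letter_derivs bs v (letter_derivs as bs m) =
      (\<Sum>x\<in>?X. \<Sum>\<kappa>\<in>occurrences (snd x) as. letter_derivs bs v (?B x \<kappa> bs))"
    by (simp only: letter_derivs_sum)
  also have "\<dots> = polarisation m e as v"
    unfolding polarisation_def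
  proof (intro sum.cong refl)
    fix x \<kappa> assume x: "x \<in> ?X" and \<kappa>: "\<kappa> \<in> occurrences (snd x) as"
    have "\<kappa> \<in> positions (length (snd x))" using occurrences_positions[OF \<kappa>] x len by simp
    thus "letter_derivs bs v (?B x \<kappa> bs) = ?B x \<kappa> v"
      using letter_derivs_overwrite[of \<kappa> "snd x" bs v "fst x"] x bs len disj(2)
      by (simp add: letter_derivs_linear)
  qed
  finally show ?thesis
    using letter_derivs_in_subrep[OF M(1) letter_derivs_in_subrep[OF M disj(1)] disj(2)] by simp
qed

lemma letter_deriv_sum: "letter_deriv a b (\<Sum>x\<in>A. F x) = (\<Sum>x\<in>A. letter_deriv a b (F x))"
  by (induction A rule: infinite_finite_induct)
    (simp_all only: sum.infinite sum.empty sum.insert letter_deriv_linear not_False_eq_True)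

lemma sum_sum_list_swap: "(\<Sum>x\<in>A. \<Sum>u\<leftarrow>L. F x u) = (\<Sum>u\<leftarrow>L. \<Sum>x\<in>A. F x u)"
  by (induction L) (simp_all add: sum.distrib)

lemma tensor_scale_sum_list: "tensor_scale c (\<Sum>u\<leftarrow>L. F u) = (\<Sum>u\<leftarrow>L. tensor_scale c (F u))"
  by (induction L) (simp_all only: list.map sum_list.Nil sum_list.Cons tensor.scale_zero_right tensor.scale_right_distrib)

lemma letter_deriv_polarisation:
  assumes len: "length as = e" "length v = e"
  shows "letter_deriv a b (polarisation m e as v) = (\<Sum>u\<leftarrow>replace_one a b v. polarisation m e as u)"
proof -
  have "letter_deriv a b (polarisation m e as v) = (\<Sum>x | m x \<noteq> 0 \<and> length (snd x) = e.
     \<Sum>\<kappa>\<in>occurrences (snd x) as. \<Sum>u\<leftarrow>replace_one a b v.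
       tensor_scale (m x) (basis_tensor (fst x) (overwrite (snd x) \<kappa> u)))"
    unfolding polarisation_def letter_deriv_sum
  proof (intro sum.cong refl)
    fix x \<kappa> assume x: "x \<in> {x. m x \<noteq> 0 \<and> length (snd x) = e}" and \<kappa>: "\<kappa> \<in> occurrences (snd x) as"
    have "\<kappa> \<in> positions (length (snd x))" using occurrences_positions[OF \<kappa>] x len by simp
    moreover have "length v = length (snd x)" using x len by simp
    ultimately show "letter_deriv a b (tensor_scale (m x) (basis_tensor (fst x) (overwrite (snd x) \<kappa> v))) =
        (\<Sum>u\<leftarrow>replace_one a b v. tensor_scale (m x) (basis_tensor (fst x) (overwrite (snd x) \<kappa> u)))"
      by (simp only: letter_deriv_overwrite letter_deriv_linear tensor_scale_sum_list)
  qed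
  thus ?thesis by (simp only: polarisation_def sum_sum_list_swap)
qed

lemma tensor_act_polarisation:
  assumes len: "length as = e" "length v = e"
    and Q: "finite Q" "\<And>r c. c \<in> set v \<Longrightarrow> g r c \<noteq> 0 \<Longrightarrow> r \<in> Q"
  shows "tensor_act g (polarisation m e as v) =
    (\<Sum>u | length u = e \<and> set u \<subseteq> Q. tensor_scale (\<Prod>j<e. g (u ! j) (v ! j)) (polarisation m e as u))"
proof -
  let ?X = "{x. m x \<noteq> 0 \<and> length (snd x) = e}" and ?U = "{u. length u = e \<and> set u \<subseteq> Q}"
  let ?B = "\<lambda>x \<kappa> u. basis_tensor (fst x) (overwrite (snd x) \<kappa> u)"
  let ?c = "\<lambda>u. \<Prod>j<e. g (u ! j) (v ! j)"
  have "tensor_act g (polarisation m e as v)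
      = (\<Sum>x\<in>?X. \<Sum>\<kappa>\<in>occurrences (snd x) as. tensor_scale (m x) (tensor_act g (?B x \<kappa> v)))"
    by (simp only: polarisation_def tensor_act_sum tensor_act_scale finite_support_sum finite_support_scale
        finite_support_basis)
  also have "\<dots> = (\<Sum>x\<in>?X. \<Sum>\<kappa>\<in>occurrences (snd x) as. \<Sum>u\<in>?U. tensor_scale (?c u) (tensor_scale (m x) (?B x \<kappa> u)))"
  proof (intro sum.cong refl)
    fix x \<kappa> assume x: "x \<in> ?X" and \<kappa>: "\<kappa> \<in> occurrences (snd x) as"
    have "\<kappa> \<in> positions (length (snd x))" using occurrences_positions[OF \<kappa>] x len by simp
    from tensor_act_overwrite[OF this _ Q, where g = g and i = "fst x" and v = v]
    have "tensor_act g (?B x \<kappa> v) = (\<Sum>u\<in>?U. tensor_scale (?c u) (?B x \<kappa> u))"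
      using x len by simp
    thus "tensor_scale (m x) (tensor_act g (?B x \<kappa> v)) =
        (\<Sum>u\<in>?U. tensor_scale (?c u) (tensor_scale (m x) (?B x \<kappa> u)))"
      by (simp only: tensor.scale_sum_right tensor.scale_scale mult.commute)
  qed
  also have "\<dots> = (\<Sum>x\<in>?X. \<Sum>u\<in>?U. \<Sum>\<kappa>\<in>occurrences (snd x) as. tensor_scale (?c u) (tensor_scale (m x) (?B x \<kappa> u)))"
    by (intro sum.cong refl sum.swap)
  also have "\<dots> = (\<Sum>u\<in>?U. \<Sum>x\<in>?X. \<Sum>\<kappa>\<in>occurrences (snd x) as. tensor_scale (?c u) (tensor_scale (m x) (?B x \<kappa> u)))"
    by (rule sum.swap)
  also have "\<dots> = (\<Sum>u\<in>?U. tensor_scale (?c u) (polarisation m e as u))"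
    by (simp only: polarisation_def tensor.scale_sum_right)
  finally show ?thesis .
qed

lemma finite_positions: "finite (positions e)" and positions_nonempty: "positions e \<noteq> {}"
proof -
  show "finite (positions e)"
    by (rule finite_subset[OF _ finite_lists_length_eq[of "{..<e}" e]]) (auto simp: positions_def)
  have "[0..<e] \<in> positions e" by (auto simp: positions_def)
  thus "positions e \<noteq> {}" by blast
qed

text \<open>
  Replacing \<open>as\<close> by itself changes nothing, so every word \<open>w\<close> of length \<open>e\<close> is reproduced once for each
  ordering \<open>\<kappa>\<close> of its positions, namely in the summand in which \<open>as\<close> is \<open>w\<close> read in that order.
\<close>

lemma sum_polarisation:
  fixes m :: "'i \<times> nat list \<Rightarrow> 'k::field_char_0"
  assumes fin: "finite {x. m x \<noteq> 0}"
  shows "\<exists>W c. finite W \<and> (\<forall>as\<in>W. length as = e) \<and> c \<noteq> 0 \<and> (\<Sum>as\<in>W. polarisation m e as as) =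
    tensor_scale c (\<Sum>x | m x \<noteq> 0 \<and> length (snd x) = e. tensor_scale (m x) (basis_tensor (fst x) (snd x)))"
proof -
  let ?X = "{x. m x \<noteq> 0 \<and> length (snd x) = e}"
  let ?B = "\<lambda>x. tensor_scale (m x) (basis_tensor (fst x) (snd x))"
  define W where "W = (\<Union>x\<in>?X. (\<lambda>\<kappa>. map ((!) (snd x)) \<kappa>) ` positions e)"
  have W: "finite W" "\<And>as. as \<in> W \<Longrightarrow> length as = e"
    using fin finite_positions by (auto simp: W_def positions_def)
  have const: "(\<Sum>\<kappa>\<in>P. t) = tensor_scale (of_nat (card P)) t" for P :: "nat list set" and t :: "'i \<times> nat list \<Rightarrow> 'k"
    by (auto simp: fun_eq_iff sum_fun_apply tensor_scale_def)
  have "(\<Sum>as\<in>W. polarisation m e as as) = (\<Sum>as\<in>W. \<Sum>x\<in>?X. \<Sum>\<kappa>\<in>occurrences (snd x) as. ?B x)"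
    unfolding polarisation_def
  proof (intro sum.cong refl)
    fix as x \<kappa> assume as: "as \<in> W" and x: "x \<in> ?X" and \<kappa>: "\<kappa> \<in> occurrences (snd x) as"
    have "\<kappa> \<in> positions (length (snd x))" using occurrences_positions[OF \<kappa>] x W(2)[OF as] by simp
    hence "overwrite (snd x) \<kappa> as = snd x"
      using overwrite_eq_iff[of \<kappa> "snd x" as "snd x"] \<kappa> x W(2)[OF as] by (simp add: occurrences_def)
    thus "tensor_scale (m x) (basis_tensor (fst x) (overwrite (snd x) \<kappa> as)) = ?B x" by simp
  qed
  also have "\<dots> = (\<Sum>x\<in>?X. \<Sum>as\<in>W. \<Sum>\<kappa>\<in>occurrences (snd x) as. ?B x)" by (rule sum.swap)
  also have "\<dots> = (\<Sum>x\<in>?X. \<Sum>\<kappa>\<in>positions e. ?B x)"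
  proof (rule sum.cong[OF refl])
    fix x assume x: "x \<in> ?X"
    have "(\<Sum>as\<in>W. \<Sum>\<kappa> | \<kappa> \<in> positions e \<and> map ((!) (snd x)) \<kappa> = as. ?B x) = (\<Sum>\<kappa>\<in>positions e. ?B x)"
      using x by (intro sum.group finite_positions W) (auto simp: W_def)
    moreover have "{\<kappa>. \<kappa> \<in> positions e \<and> map ((!) (snd x)) \<kappa> = as} = occurrences (snd x) as" if "as \<in> W" for as
    proof (intro subset_antisym subsetI)
      have len: "length as = e" "length (snd x) = e" using W(2)[OF that] x by simp_all
      fix \<kappa> assume "\<kappa> \<in> {\<kappa>. \<kappa> \<in> positions e \<and> map ((!) (snd x)) \<kappa> = as}"
      thus "\<kappa> \<in> occurrences (snd x) as"
        unfolding occurrences_def positions_def len by blast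
    next
      have len: "length as = e" "length (snd x) = e" using W(2)[OF that] x by simp_all
      fix \<kappa> assume "\<kappa> \<in> occurrences (snd x) as"
      moreover from this have "\<kappa> \<in> positions e" using occurrences_positions[of \<kappa> "snd x" as] len by simp
      ultimately show "\<kappa> \<in> {\<kappa>. \<kappa> \<in> positions e \<and> map ((!) (snd x)) \<kappa> = as}"
        unfolding occurrences_def by blast
    qed
    ultimately show "(\<Sum>as\<in>W. \<Sum>\<kappa>\<in>occurrences (snd x) as. ?B x) = (\<Sum>\<kappa>\<in>positions e. ?B x)" by simp
  qed
  also have "\<dots> = (\<Sum>x\<in>?X. tensor_scale (of_nat (card (positions e))) (?B x))"
    by (simp only: const)
  also have "\<dots> = tensor_scale (of_nat (card (positions e))) (\<Sum>x\<in>?X. ?B x)"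
    by (simp only: tensor.scale_sum_right)
  finally have "(\<Sum>as\<in>W. polarisation m e as as) =
    tensor_scale (of_nat (card (positions e))) (\<Sum>x\<in>?X. ?B x)" .
  moreover have "(of_nat (card (positions e)) :: 'k) \<noteq> 0"
    using finite_positions positions_nonempty by simp
  ultimately show ?thesis using W by blast
qed

definition equivariant_tensor ::
  "('i \<times> nat list \<Rightarrow> 'k::field) set \<Rightarrow> nat \<Rightarrow> (nat list \<Rightarrow> 'i \<times> nat list \<Rightarrow> 'k) \<Rightarrow> bool" where
  "equivariant_tensor M e x \<longleftrightarrow> (\<forall>v. length v = e \<longrightarrow> x v \<in> M \<and>
     (\<forall>a b. letter_deriv a b (x v) = (\<Sum>u\<leftarrow>replace_one a b v. x u)) \<and>
     (\<forall>g\<in>carrier GL. tensor_act g (x v) \<in> tensor.span (x ` {u. length u = e})))"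

lemma GL_column_finite:
  assumes "g \<in> carrier GL"
  shows "finite {r. g r c \<noteq> 0}"
proof -
  obtain n A where A: "A \<in> carrier_mat n n" "g = stabilise A" using assms by (auto simp: GL_def)
  have "{r. g r c \<noteq> 0} \<subseteq> insert c {..<n}" using A by (auto simp: stabilise_def split: if_splits)
  thus ?thesis by (rule finite_subset) simp
qed

text \<open>
  Split off the part of highest degree by \<open>sum_polarisation\<close>; it lies in \<open>M\<close> along with the
  polarisations, so that the rest is in \<open>M\<close> and has lower degree.
\<close>

theorem span_equivariant_tensors:
  fixes M :: "('i \<times> nat list \<Rightarrow> 'k::field_char_0) set"
  assumes M: "tensor_subrep d M" and m: "m \<in> M"
  shows "\<exists>X. finite X \<and> (\<forall>(e, x)\<in>X. equivariant_tensor M e x) \<and>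
    m \<in> tensor.span (\<Union>(e, x)\<in>X. x ` {u. length u = e})"
proof -
  have sub: "tensor.subspace M" using M by (simp add: tensor_subrep_def)
  have finM: "finite {x. m x \<noteq> 0}" if "m \<in> M" for m
    using M that by (auto simp: tensor_subrep_def tensor_sum_def)
  have "\<forall>x. m x \<noteq> 0 \<longrightarrow> length (snd x) < e \<Longrightarrow> ?thesis" for e
    using m
  proof (induction e arbitrary: m)
    case 0
    hence "m = 0" by (auto simp: fun_eq_iff)
    show ?case unfolding \<open>m = 0\<close> by (intro exI[of _ "{}"] conjI tensor.span_zero) simp_all
  next
    case (Suc e)
    note fin = finM[OF Suc.prems(2)]
    have le: "length (snd x) \<le> e" if "m x \<noteq> 0" for x using Suc.prems(1)[rule_format, OF that] by simp
    define top_part where "top_part = (\<Sum>x | m x \<noteq> 0 \<and> length (snd x) = e. tensor_scale (m x) (basis_tensor (fst x) (snd x)))"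
    from sum_polarisation[OF fin, of e, folded top_part_def] obtain W c
      where W': "finite W" "\<forall>as\<in>W. length as = e" "c \<noteq> 0"
        "(\<Sum>as\<in>W. polarisation m e as as) = tensor_scale c top_part" by blast
    note W = W'(1) W'(2)[rule_format] W'(3,4)
    define X where "X = (\<lambda>as. (e, polarisation m e as)) ` W"
    have polM: "polarisation m e as v \<in> M" if "as \<in> W" "length v = e" for as v
      using polarisation_in_subrep[OF M Suc.prems(2) le W(2)[OF that(1)] that(2)] .
    have X: "equivariant_tensor M e' x" if Xin: "(e', x) \<in> X" for e' x
    proof -
      obtain as where as: "as \<in> W" "e' = e" "x = polarisation m e as" using Xin by (auto simp: X_def)
      show ?thesis
        unfolding equivariant_tensor_def as(2,3)
      proof (intro allI impI conjI ballI)
        fix v :: "nat list" assume v: "length v = e"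
        show "polarisation m e as v \<in> M" by (rule polM[OF as(1) v])
        show "letter_deriv a b (polarisation m e as v) = (\<Sum>u\<leftarrow>replace_one a b v. polarisation m e as u)" for a b
          by (rule letter_deriv_polarisation[OF W(2)[OF as(1)] v])
        fix g :: "nat \<Rightarrow> nat \<Rightarrow> 'k" assume g: "g \<in> carrier GL"
        have "finite (\<Union>c\<in>set v. {r. g r c \<noteq> 0})" using GL_column_finite[OF g] by blast
        from tensor_act_polarisation[OF W(2)[OF as(1)] v this, of g m]
        have "tensor_act g (polarisation m e as v) = (\<Sum>u | length u = e \<and> set u \<subseteq> (\<Union>c\<in>set v. {r. g r c \<noteq> 0}).
            tensor_scale (\<Prod>j<e. g (u ! j) (v ! j)) (polarisation m e as u))" by blast
        moreover have "tensor_scale k (polarisation m e as u) \<in> tensor.span (polarisation m e as ` {u. length u = e})"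
          if "length u = e" for k u
          by (rule tensor.span_scale, rule tensor.span_base) (use that in blast)
        ultimately show "tensor_act g (polarisation m e as v) \<in> tensor.span (polarisation m e as ` {u. length u = e})"
          by (simp only:) (rule tensor.span_sum, simp)
      qed
    qed
    have top_part: "top_part = tensor_scale (inverse c) (\<Sum>as\<in>W. polarisation m e as as)"
      using W(3,4) by simp
    have top_partM: "top_part \<in> M" unfolding top_part
      by (intro tensor.subspace_scale[OF sub] tensor.subspace_sum[OF sub] polM W(2))
    have "polarisation m e as as \<in> tensor.span (\<Union>(e, x)\<in>X. x ` {u. length u = e})" if "as \<in> W" for as
    proof (rule tensor.span_base)
      have "(e, polarisation m e as) \<in> X" using that by (simp add: X_def)
      thus "polarisation m e as as \<in> (\<Union>(e, x)\<in>X. x ` {u. length u = e})" using W(2)[OF that] by blast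
    qed
    hence top_span: "top_part \<in> tensor.span (\<Union>(e, x)\<in>X. x ` {u. length u = e})"
      unfolding top_part by (intro tensor.span_scale[OF tensor.span_sum])
    have restM: "m - top_part \<in> M" by (rule tensor.subspace_diff[OF sub Suc.prems(2) top_partM])
    have top_part_value: "top_part x = (if length (snd x) = e then m x else 0)" for x
    proof -
      have "top_part x = (\<Sum>z | m z \<noteq> 0 \<and> length (snd z) = e. if z = x then m x else 0)"
        by (auto simp: top_part_def sum_fun_apply tensor_scale_def basis_tensor_def intro!: sum.cong)
      thus ?thesis using fin by simp
    qed
    have "\<forall>x. (m - top_part) x \<noteq> 0 \<longrightarrow> length (snd x) < e"
    proof (intro allI impI)
      fix x assume "(m - top_part) x \<noteq> 0"
      hence "length (snd x) \<noteq> e" "m x \<noteq> 0" using top_part_value[of x] by (auto simp: fun_diff_def split: if_splits)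
      thus "length (snd x) < e" using le[of x] by simp
    qed
    from Suc.IH[OF this restM] obtain X' where X': "finite X'" "\<forall>(e, x)\<in>X'. equivariant_tensor M e x"
      "m - top_part \<in> tensor.span (\<Union>(e, x)\<in>X'. x ` {u. length u = e})" by blast
    let ?S = "\<lambda>X. tensor.span (\<Union>(e, x)\<in>X. x ` {u. length u = e})"
    have "(m - top_part) + top_part \<in> ?S (X \<union> X')"
      using X'(3) top_span tensor.span_mono[of "\<Union>(e, x)\<in>X. x ` {u. length u = e}" "\<Union>(e, x)\<in>X \<union> X'. x ` {u. length u = e}"]
        tensor.span_mono[of "\<Union>(e, x)\<in>X'. x ` {u. length u = e}" "\<Union>(e, x)\<in>X \<union> X'. x ` {u. length u = e}"]
      by (intro tensor.span_add) auto
    thus ?case using X X'(1,2) W(1) by (intro exI[of _ "X \<union> X'"]) (auto simp: X_def)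
  qed
  moreover have "\<forall>x. m x \<noteq> 0 \<longrightarrow> length (snd x) < Suc (Max ((length \<circ> snd) ` {x. m x \<noteq> 0}))"
    using finM[OF m] by (auto simp: less_Suc_eq_le)
  ultimately show ?thesis by blast
qed

section \<open>Derivations of the function field\<close>

text \<open>
  The quotient rule, in a form without denominators. It determines \<open>D x\<close> independently of the fraction
  that represents \<open>x\<close>, as one sees by applying \<open>\<delta>\<close> to \<open>a b' = a' b\<close>.
\<close>

lemma derivation_of_fraction_field:
  assumes \<iota>: "fraction_field \<iota>" and add: "\<And>x y. \<delta> (x + y) = \<delta> x + \<delta> y"
    and mult: "\<And>x y. \<delta> (x * y) = \<iota> x * \<delta> y + \<iota> y * \<delta> x"
  shows "\<exists>D. derivation D \<and> (\<forall>x a b. b \<noteq> 0 \<longrightarrow> \<iota> a = x * \<iota> b \<longrightarrow> D x * \<iota> b = \<delta> a - x * \<delta> b)"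
proof -
  interpret \<iota>: comm_ring_hom \<iota> using \<iota> by (simp add: fraction_field_def)
  have \<iota>0: "\<iota> x = 0 \<longleftrightarrow> x = 0" for x
    using \<iota> \<iota>.hom_zero unfolding fraction_field_def inj_def by metis
  have ex: "\<exists>a b. b \<noteq> 0 \<and> \<iota> a = x * \<iota> b" for x
  proof -
    obtain a b where "b \<noteq> 0" "x = \<iota> a / \<iota> b" using \<iota> unfolding fraction_field_def by blast
    thus ?thesis using \<iota>0 by (intro exI[of _ a] exI[of _ b]) simp
  qed
  have eq_imp: "a = b" if "\<iota> a = \<iota> b" for a b using \<iota> that unfolding fraction_field_def inj_def by blast
  have indep: "\<iota> b' * (\<delta> a - x * \<delta> b) = \<iota> b * (\<delta> a' - x * \<delta> b')"
    if "\<iota> a = x * \<iota> b" "\<iota> a' = x * \<iota> b'" for a b a' b' x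
  proof -
    have "\<iota> (a * b') = \<iota> (a' * b)" using that by (simp add: \<iota>.hom_mult algebra_simps)
    hence "\<delta> (a * b') = \<delta> (a' * b)" using eq_imp by metis
    thus ?thesis using that by (simp add: mult algebra_simps)
  qed
  define D where "D x = (SOME y. \<exists>a b. b \<noteq> 0 \<and> \<iota> a = x * \<iota> b \<and> y * \<iota> b = \<delta> a - x * \<delta> b)" for x
  have D: "D x * \<iota> b = \<delta> a - x * \<delta> b" if b: "b \<noteq> 0" "\<iota> a = x * \<iota> b" for x a b
  proof -
    let ?Q = "\<lambda>y. \<exists>a b. b \<noteq> 0 \<and> \<iota> a = x * \<iota> b \<and> y * \<iota> b = \<delta> a - x * \<delta> b"
    have "(\<delta> a - x * \<delta> b) / \<iota> b * \<iota> b = \<delta> a - x * \<delta> b" using b \<iota>0 by simp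
    hence "?Q ((\<delta> a - x * \<delta> b) / \<iota> b)" using b by blast
    hence "?Q (D x)" unfolding D_def by (rule someI)
    then obtain a' b' where b': "b' \<noteq> 0" "\<iota> a' = x * \<iota> b'" "D x * \<iota> b' = \<delta> a' - x * \<delta> b'" by blast
    have "\<iota> b' * (D x * \<iota> b) = \<iota> b * (\<delta> a' - x * \<delta> b')"
      unfolding b'(3)[symmetric] by simp
    also have "\<dots> = \<iota> b' * (\<delta> a - x * \<delta> b)" using indep[OF b(2) b'(2)] by simp
    finally show ?thesis using b'(1) \<iota>0 by simp
  qed
  have "derivation D"
    unfolding derivation_def
  proof (intro conjI allI)
    fix x y
    obtain a b where b: "b \<noteq> 0" "\<iota> a = x * \<iota> b" using ex by blast
    obtain a' b' where b': "b' \<noteq> 0" "\<iota> a' = y * \<iota> b'" using ex by blast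
    have nz: "\<iota> b \<noteq> 0" "\<iota> b' \<noteq> 0" "b * b' \<noteq> 0" using b b' \<iota>0 by (auto simp: \<iota>0[of "b * b'", symmetric] \<iota>.hom_mult)
    have "D (x + y) * \<iota> (b * b') = \<delta> (a * b' + a' * b) - (x + y) * \<delta> (b * b')"
      using b b' by (intro D nz) (simp add: \<iota>.hom_mult \<iota>.hom_add algebra_simps)
    also have "\<dots> = \<iota> b' * (\<delta> a - x * \<delta> b) + \<iota> b * (\<delta> a' - y * \<delta> b')"
      using b b' by (simp add: add mult algebra_simps)
    also have "\<dots> = (D x + D y) * \<iota> (b * b')"
      by (simp add: D[OF b, symmetric] D[OF b', symmetric] \<iota>.hom_mult algebra_simps)
    finally show "D (x + y) = D x + D y" using nz by (simp add: \<iota>0)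
    have "D (x * y) * \<iota> (b * b') = \<delta> (a * a') - (x * y) * \<delta> (b * b')"
      using b b' by (intro D nz) (simp add: \<iota>.hom_mult algebra_simps)
    also have "\<dots> = x * \<iota> b * (\<delta> a' - y * \<delta> b') + y * \<iota> b' * (\<delta> a - x * \<delta> b)"
      using b b' by (simp add: mult algebra_simps)
    also have "\<dots> = (x * D y + y * D x) * \<iota> (b * b')"
      by (simp add: D[OF b, symmetric] D[OF b', symmetric] \<iota>.hom_mult algebra_simps)
    finally show "D (x * y) = x * D y + y * D x" using nz by (simp add: \<iota>0)
  qed
  thus ?thesis using D by blast
qed

text \<open>
  The coordinate ring \<open>'a\<close> with its function field \<open>'l\<close>, presented as the quotient \<open>\<phi>\<close> of a representation
  \<open>M\<close> by tensors.
\<close>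

locale GL_domain =
  fixes scale :: "'k::field_char_0 \<Rightarrow> 'a::comm_ring_1 \<Rightarrow> 'a"
    and act :: "(nat \<Rightarrow> nat \<Rightarrow> 'k) \<Rightarrow> 'a \<Rightarrow> 'a"
    and \<iota> :: "'a \<Rightarrow> 'l::field"
    and d :: "'i \<Rightarrow> nat" and M :: "('i \<times> nat list \<Rightarrow> 'k) set" and \<phi>
  assumes K_algebra: "K_algebra scale"
    and rep: "GL_representation scale act"
    and act_hom: "g \<in> carrier GL \<Longrightarrow> comm_ring_hom (act g)"
    and \<iota>: "fraction_field \<iota>"
    and M: "tensor_subrep d M"
    and \<phi>_add: "s \<in> M \<Longrightarrow> t \<in> M \<Longrightarrow> \<phi> (s + t) = \<phi> s + \<phi> t"
    and \<phi>_scale: "t \<in> M \<Longrightarrow> \<phi> (tensor_scale c t) = scale c (\<phi> t)"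
    and \<phi>_act: "g \<in> carrier GL \<Longrightarrow> t \<in> M \<Longrightarrow> \<phi> (tensor_act g t) = act g (\<phi> t)"
    and \<phi>_surj: "\<phi> ` M = UNIV"
begin

sublocale \<iota>: comm_ring_hom \<iota>
  using \<iota> by (simp add: fraction_field_def)

lemma \<iota>_0: "\<iota> x = 0 \<longleftrightarrow> x = 0"
  using \<iota> \<iota>.hom_zero unfolding fraction_field_def inj_def by metis

lemma fraction: obtains a b where "b \<noteq> 0" "x = \<iota> a / \<iota> b" "\<iota> b \<noteq> 0"
  using \<iota> \<iota>_0 unfolding fraction_field_def by metis

lemma subspace_M: "tensor.subspace M"
  using M by (simp add: tensor_subrep_def)

lemma act_simps:
  assumes "g \<in> carrier GL"
  shows "act g (scale c x) = scale c (act g x)" "act g (x + y) = act g x + act g y"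
    "act g (x * y) = act g x * act g y" "act g 1 = 1"
proof -
  interpret l: Vector_Spaces.linear scale scale "act g"
    using rep assms unfolding GL_representation_def by blast
  interpret h: comm_ring_hom "act g" by (rule act_hom[OF assms])
  show "act g (scale c x) = scale c (act g x)" "act g (x + y) = act g x + act g y"
    "act g (x * y) = act g x * act g y" "act g 1 = 1"
    by (simp_all add: l.scale h.hom_add h.hom_mult)
qed

lemma act_inj: "g \<in> carrier GL \<Longrightarrow> inj (act g)"
  using rep group_action.bij_prop0[of GL UNIV act g] unfolding GL_representation_def
  by (auto simp: Bij_def bij_betw_def group_action_def)

definition \<kappa> :: "'k \<Rightarrow> 'l" where "\<kappa> c = \<iota> (scale c 1)"

lemma \<iota>_scale: "\<iota> (scale c x) = \<kappa> c * \<iota> x"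
  using K_algebra unfolding K_algebra_def \<kappa>_def by (metis \<iota>.hom_mult mult_1)

lemma \<kappa>_simps: "\<kappa> 0 = 0" "\<kappa> 1 = 1" "\<kappa> (b + c) = \<kappa> b + \<kappa> c" "\<kappa> (b * c) = \<kappa> b * \<kappa> c"
proof -
  interpret vector_space scale using K_algebra by (simp add: K_algebra_def)
  show "\<kappa> 0 = 0" "\<kappa> 1 = 1" "\<kappa> (b + c) = \<kappa> b + \<kappa> c"
    by (simp_all add: \<kappa>_def scale_left_distrib \<iota>.hom_add)
  show "\<kappa> (b * c) = \<kappa> b * \<kappa> c" using \<iota>_scale[of b "scale c 1"] by (simp add: \<kappa>_def)
qed

lemma \<kappa>_power: "\<kappa> (c ^ p) = \<kappa> c ^ p"
  by (induction p) (simp_all add: \<kappa>_simps)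

lemma \<kappa>_of_nat: "\<kappa> (of_nat p) = of_nat p"
  by (induction p) (simp_all add: \<kappa>_simps)

lemma \<kappa>_nonzero: "c \<noteq> 0 \<Longrightarrow> \<kappa> c \<noteq> 0"
  using \<kappa>_simps(4)[of c "inverse c"] \<kappa>_simps(2) by auto

lemma char0: "(of_nat (Suc n) :: 'l) \<noteq> 0"
  using \<kappa>_nonzero[of "of_nat (Suc n)"] \<kappa>_of_nat[of "Suc n"] by (metis of_nat_neq_0)

lemma poly_eq_on_constants:
  assumes "\<And>t. poly p (\<kappa> t) = poly q (\<kappa> t)"
  shows "p = q"
proof (rule ccontr)
  assume "p \<noteq> q"
  hence "finite {x. poly (p - q) x = 0}" by (intro poly_roots_finite) simp
  moreover have "range \<kappa> \<subseteq> {x. poly (p - q) x = 0}" using assms by auto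
  ultimately have fin: "finite (range \<kappa>)" by (rule rev_finite_subset)
  have "inj \<kappa>"
  proof (rule injI)
    fix s t assume "\<kappa> s = \<kappa> t"
    hence "\<kappa> (s - t) = 0" using \<kappa>_simps(3)[of "s - t" t] by simp
    thus "s = t" using \<kappa>_nonzero[of "s - t"] by auto
  qed
  from finite_imageD[OF fin this] show False using infinite_UNIV_char_0[where 'a = 'k] by simp
qed

text \<open>The action of a transvection on the coordinate ring is polynomial in its parameter.\<close>

definition act_poly :: "nat \<Rightarrow> nat \<Rightarrow> 'a \<Rightarrow> 'l poly" where
  "act_poly a b x = (THE p. \<forall>t. \<iota> (act (transvection a b t) x) = poly p (\<kappa> t))"

lemma \<phi>_0: "\<phi> 0 = 0"
proof -
  have "0 \<in> M" by (rule tensor.subspace_0[OF subspace_M])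
  from \<phi>_add[OF this this] show ?thesis by (simp only: add_0_right add_cancel_right_right)
qed

lemma \<phi>_sum:
  "(\<And>x. x \<in> A \<Longrightarrow> f x \<in> M) \<Longrightarrow> \<phi> (\<Sum>x\<in>A. f x) = (\<Sum>x\<in>A. \<phi> (f x))"
proof (induction A rule: infinite_finite_induct)
  case (insert x A)
  have "\<phi> (f x + (\<Sum>x\<in>A. f x)) = \<phi> (f x) + \<phi> (\<Sum>x\<in>A. f x)"
    using insert.prems by (intro \<phi>_add tensor.subspace_sum[OF subspace_M]) auto
  also have "\<phi> (\<Sum>x\<in>A. f x) = (\<Sum>x\<in>A. \<phi> (f x))" using insert by blast
  finally show ?case by (simp only: sum.insert[OF insert.hyps])
qed (simp_all only: sum.empty sum.infinite \<phi>_0 not_False_eq_True)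

lemma \<phi>_sum_list:
  "(\<And>x. x \<in> set xs \<Longrightarrow> f x \<in> M) \<Longrightarrow> (\<Sum>x\<leftarrow>xs. f x) \<in> M \<and> \<phi> (\<Sum>x\<leftarrow>xs. f x) = (\<Sum>x\<leftarrow>xs. \<phi> (f x))"
proof (induction xs)
  case Nil
  show ?case using tensor.subspace_0[OF subspace_M] by (simp only: list.map sum_list.Nil \<phi>_0)
next
  case (Cons x xs)
  hence "f x \<in> M" "(\<Sum>x\<leftarrow>xs. f x) \<in> M" "\<phi> (\<Sum>x\<leftarrow>xs. f x) = (\<Sum>x\<leftarrow>xs. \<phi> (f x))" by auto
  thus ?case using \<phi>_add tensor.subspace_add[OF subspace_M] by (simp only: list.map sum_list.Cons)
qed

lemma act_transvection_polynomial:
  assumes m: "m \<in> M" and ab: "a \<noteq> b"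
  shows "\<exists>p. (\<forall>t. \<iota> (act (transvection a b t) (\<phi> m)) = poly p (\<kappa> t)) \<and> coeff p 1 = \<iota> (\<phi> (letter_deriv a b m))"
proof -
  obtain e c where c: "\<And>t. tensor_act (transvection a b t) m = (\<Sum>p\<le>e. tensor_scale (t ^ p) (c p))"
      "c 1 = letter_deriv a b m" and cM: "\<And>p. p \<le> e \<Longrightarrow> c p \<in> M" and e1: "1 \<le> e"
    using transvection_expansion[OF M m ab] by metis
  define q where "q = (\<Sum>p\<le>e. monom (\<iota> (\<phi> (c p))) p)"
  have "\<iota> (act (transvection a b t) (\<phi> m)) = poly q (\<kappa> t)" for t
  proof -
    have "act (transvection a b t) (\<phi> m) = \<phi> (\<Sum>p\<le>e. tensor_scale (t ^ p) (c p))"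
      by (simp only: \<phi>_act[OF transvection_in_GL[OF ab] m, symmetric] c(1))
    also have "\<dots> = (\<Sum>p\<le>e. \<phi> (tensor_scale (t ^ p) (c p)))"
      using cM by (intro \<phi>_sum tensor.subspace_scale[OF subspace_M]) simp
    also have "\<dots> = (\<Sum>p\<le>e. scale (t ^ p) (\<phi> (c p)))"
      using cM by (intro sum.cong refl \<phi>_scale) simp
    finally show ?thesis by (simp add: q_def \<iota>.hom_sum \<iota>_scale \<kappa>_power poly_sum poly_monom mult.commute)
  qed
  moreover have "coeff q 1 = \<iota> (\<phi> (letter_deriv a b m))"
  proof -
    have "coeff q 1 = (\<Sum>p\<le>e. if p = 1 then \<iota> (\<phi> (c p)) else 0)" by (simp add: q_def coeff_sum)
    thus ?thesis using e1 c(2) by simp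
  qed
  ultimately show ?thesis by blast
qed

lemma act_poly:
  assumes "a \<noteq> b"
  shows "\<iota> (act (transvection a b t) x) = poly (act_poly a b x) (\<kappa> t)"
    and "m \<in> M \<Longrightarrow> coeff (act_poly a b (\<phi> m)) 1 = \<iota> (\<phi> (letter_deriv a b m))"
proof -
  have eq: "act_poly a b x = p" if "\<forall>t. \<iota> (act (transvection a b t) x) = poly p (\<kappa> t)" for x p
    unfolding act_poly_def using that
    by (intro the_equality) (simp_all add: poly_eq_on_constants)
  obtain m' where "m' \<in> M" "x = \<phi> m'" using \<phi>_surj by (metis UNIV_I imageE)
  thus "\<iota> (act (transvection a b t) x) = poly (act_poly a b x) (\<kappa> t)"
    using act_transvection_polynomial[OF _ assms] eq by metis
  show "m \<in> M \<Longrightarrow> coeff (act_poly a b (\<phi> m)) 1 = \<iota> (\<phi> (letter_deriv a b m))"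
    using act_transvection_polynomial[OF _ assms] eq by metis
qed

text \<open>
  Since the constants are infinitely many, evaluating at them is injective on polynomials, and
  multiplicativity carries over from the action. The constant coefficient belongs to the parameter \<open>0\<close>,
  for which the transvection is the identity.
\<close>

lemma act_poly_hom:
  assumes "a \<noteq> b"
  shows "act_poly a b (x + y) = act_poly a b x + act_poly a b y"
    and "act_poly a b (x * y) = act_poly a b x * act_poly a b y"
    and "coeff (act_poly a b x) 0 = \<iota> x"
proof -
  note act = act_simps[OF transvection_in_GL[OF assms]]
  show "act_poly a b (x + y) = act_poly a b x + act_poly a b y"
    by (rule poly_eq_on_constants)
      (simp add: act_poly(1)[OF assms, symmetric] act \<iota>.hom_add)
  show "act_poly a b (x * y) = act_poly a b x * act_poly a b y"
    by (rule poly_eq_on_constants)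
      (simp add: act_poly(1)[OF assms, symmetric] act \<iota>.hom_mult)
  have "transvection a b (0 :: 'k) = \<one>\<^bsub>GL\<^esub>" by (auto simp: transvection_def GL_def fun_eq_iff)
  moreover have "act \<one>\<^bsub>GL\<^esub> x = x"
    using rep group_action.id_eq_one[of GL UNIV act] unfolding GL_representation_def by (metis UNIV_I restrict_apply)
  ultimately show "coeff (act_poly a b x) 0 = \<iota> x"
    using act_poly(1)[OF assms, of 0 x] by (simp add: \<kappa>_simps poly_0_coeff_0)
qed

lemma infinitesimal_action:
  assumes "a \<noteq> b"
  shows "\<exists>D. derivation D \<and> (\<forall>x u v. v \<noteq> 0 \<longrightarrow> \<iota> u = x * \<iota> v \<longrightarrow>
    D x * \<iota> v = coeff (act_poly a b u) 1 - x * coeff (act_poly a b v) 1)"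
proof (rule derivation_of_fraction_field[OF \<iota>])
  show "coeff (act_poly a b (x + y)) 1 = coeff (act_poly a b x) 1 + coeff (act_poly a b y) 1" for x y
    by (simp add: act_poly_hom[OF assms])
  show "coeff (act_poly a b (x * y)) 1 = \<iota> x * coeff (act_poly a b y) 1 + \<iota> y * coeff (act_poly a b x) 1" for x y
  proof -
    have "coeff (p * q) 1 = coeff p 0 * coeff q 1 + coeff q 0 * coeff p 1" for p q :: "'l poly"
      by (simp add: coeff_mult atMost_Suc mult.commute)
    thus ?thesis by (simp only: act_poly_hom[OF assms])
  qed
qed

end

section \<open>The field of invariants\<close>

context GL_domain
begin

definition infinitesimal :: "nat \<Rightarrow> nat \<Rightarrow> 'l \<Rightarrow> 'l" where
  "infinitesimal a b = (SOME D. derivation D \<and> (\<forall>x u v. v \<noteq> 0 \<longrightarrow> \<iota> u = x * \<iota> v \<longrightarrow>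
    D x * \<iota> v = coeff (act_poly a b u) 1 - x * coeff (act_poly a b v) 1))"

lemma infinitesimal:
  assumes "a \<noteq> b"
  shows "derivation (infinitesimal a b)"
    and "v \<noteq> 0 \<Longrightarrow> \<iota> u = x * \<iota> v \<Longrightarrow>
      infinitesimal a b x * \<iota> v = coeff (act_poly a b u) 1 - x * coeff (act_poly a b v) 1"
  using someI_ex[OF infinitesimal_action[OF assms]] unfolding infinitesimal_def[symmetric] by blast+

lemma infinitesimal_value:
  assumes "a \<noteq> b" "m \<in> M"
  shows "infinitesimal a b (\<iota> (\<phi> m)) = \<iota> (\<phi> (letter_deriv a b m))"
proof -
  have "act_poly a b 1 = 1"
    by (rule poly_eq_on_constants)
      (simp add: act_poly(1)[OF assms(1), symmetric] act_simps[OF transvection_in_GL[OF assms(1)]])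
  moreover have "(1 :: 'a) \<noteq> 0" using \<iota>_0[of 1] by auto
  ultimately show ?thesis
    using infinitesimal(2)[OF assms(1), of 1 "\<phi> m" "\<iota> (\<phi> m)"] act_poly(2)[OF assms] by simp
qed

lemma fraction_map_act:
  assumes "g \<in> carrier GL" "v \<noteq> 0"
  shows "fraction_map \<iota> (act g) (\<iota> u / \<iota> v) = \<iota> (act g u) / \<iota> (act g v)"
  by (rule fraction_map_divide[OF \<iota> act_hom[OF assms(1)] act_inj[OF assms(1)] assms(2)])

lemma act_nonzero: "g \<in> carrier GL \<Longrightarrow> v \<noteq> 0 \<Longrightarrow> \<iota> (act g v) \<noteq> 0"
  using act_inj[of g] act_simps(2)[of g 0 0] \<iota>_0 unfolding inj_def by (metis add_0 add_cancel_right_right)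

text \<open>
  If \<open>x = u / v\<close> is invariant, then \<open>g u = x (g v)\<close> for all transvections \<open>g\<close> with parameter \<open>t\<close>, so the
  polynomials in \<open>t\<close> that describe both sides agree; compare the coefficients of \<open>t\<close>.
\<close>

lemma infinitesimal_invariant:
  assumes ab: "a \<noteq> b" and x: "x \<in> invariant_field \<iota> act"
  shows "infinitesimal a b x = 0"
proof -
  obtain u v where uv: "v \<noteq> 0" "x = \<iota> u / \<iota> v" "\<iota> v \<noteq> 0" using fraction .
  have "act_poly a b u = smult x (act_poly a b v)"
  proof (rule poly_eq_on_constants)
    fix t :: 'k
    let ?g = "transvection a b t"
    have "\<iota> (act ?g u) / \<iota> (act ?g v) = x"
    proof -
      have "fraction_map \<iota> (act ?g) x = x"
        using x transvection_in_GL[OF ab] unfolding invariant_field_def by blast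
      thus ?thesis using fraction_map_act[OF transvection_in_GL[OF ab] uv(1), of t u] uv(2) by metis
    qed
    hence "\<iota> (act ?g u) = x * \<iota> (act ?g v)"
      using act_nonzero[OF transvection_in_GL[OF ab] uv(1), of t] by (simp add: field_simps)
    thus "poly (act_poly a b u) (\<kappa> t) = poly (smult x (act_poly a b v)) (\<kappa> t)"
      by (simp add: act_poly(1)[OF ab, symmetric])
  qed
  hence "infinitesimal a b x * \<iota> v = 0"
    using infinitesimal(2)[OF ab uv(1), of u x] uv by simp
  thus ?thesis using uv(3) by simp
qed

lemma subfield_invariant_field: "is_subfield (invariant_field \<iota> act)"
proof -
  let ?F = "\<lambda>g. fraction_map \<iota> (act g)"
  have F: "?F g 0 = 0" "?F g 1 = 1" "?F g (x + y) = ?F g x + ?F g y" "?F g (x * y) = ?F g x * ?F g y"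
    "?F g (- x) = - ?F g x" "?F g (inverse x) = inverse (?F g x)" if g: "g \<in> carrier GL" for g x y
  proof -
    note act = act_simps[OF g] and nz = act_nonzero[OF g]
    interpret h: comm_ring_hom "act g" by (rule act_hom[OF g])
    have one: "(1 :: 'a) \<noteq> 0" using \<iota>_0[of 1] by auto
    show F0: "?F g 0 = 0" using fraction_map_act[OF g one, of 0] by simp
    show "?F g 1 = 1" using fraction_map_act[OF g one, of 1] by simp
    obtain u v where x: "v \<noteq> 0" "x = \<iota> u / \<iota> v" "\<iota> v \<noteq> 0" using fraction .
    obtain u' v' where y: "v' \<noteq> 0" "y = \<iota> u' / \<iota> v'" "\<iota> v' \<noteq> 0" using fraction .
    have vv: "v * v' \<noteq> 0" using x(3) y(3) \<iota>_0[of "v * v'"] by (simp add: \<iota>.hom_mult)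
    have sum_prod: "x + y = \<iota> (u * v' + u' * v) / \<iota> (v * v')" "x * y = \<iota> (u * u') / \<iota> (v * v')"
      using x(3) y(3) unfolding x(2) y(2) by (simp_all add: \<iota>.hom_mult \<iota>.hom_add add_frac_eq)
    have Fxy: "?F g x = \<iota> (act g u) / \<iota> (act g v)" "?F g y = \<iota> (act g u') / \<iota> (act g v')"
      unfolding x(2) y(2) by (rule fraction_map_act[OF g x(1)], rule fraction_map_act[OF g y(1)])
    show "?F g (x + y) = ?F g x + ?F g y" "?F g (x * y) = ?F g x * ?F g y"
      using nz[OF x(1)] nz[OF y(1)] unfolding Fxy sum_prod fraction_map_act[OF g vv]
      by (simp_all add: act \<iota>.hom_mult \<iota>.hom_add add_frac_eq)
    have minus: "- x = \<iota> (- u) / \<iota> v" using x(2) by (simp add: \<iota>.hom_uminus)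
    show "?F g (- x) = - ?F g x"
      unfolding Fxy minus fraction_map_act[OF g x(1)] by (simp add: h.hom_uminus \<iota>.hom_uminus)
    show "?F g (inverse x) = inverse (?F g x)"
    proof (cases "u = 0")
      case True
      thus ?thesis using x F0 by simp
    next
      case False
      have inv: "inverse x = \<iota> v / \<iota> u" using x(2) by simp
      show ?thesis unfolding Fxy inv fraction_map_act[OF g False] by simp
    qed
  qed
  show ?thesis unfolding is_subfield_def invariant_field_def by (simp add: F)
qed

lemma constant_field_invariant: "constant_field scale \<iota> \<subseteq> invariant_field \<iota> act"
proof -
  have "fraction_map \<iota> (act g) (\<iota> (scale c 1)) = \<iota> (scale c 1)" if g: "g \<in> carrier GL" for g c
  proof -
    have "(1 :: 'a) \<noteq> 0" using \<iota>_0[of 1] by auto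
    from fraction_map_act[OF g this, of "scale c 1"] show ?thesis by (simp add: act_simps[OF g])
  qed
  thus ?thesis by (auto simp: constant_field_def invariant_field_def)
qed

text \<open>
  Polarising representatives of the finitely many generators of the coordinate ring gives finitely
  many families of tensors whose values generate the function field.
\<close>

lemma function_field_generated_by_tensors:
  assumes fin: "finite S" and gen: "subalgebra scale hull (\<Union>s\<in>S. orbit GL act s) = UNIV"
  shows "\<exists>Y. finite Y \<and> (\<forall>(e, y)\<in>Y. tensor_family infinitesimal 0 e y) \<and>
    gen_field (constant_field scale \<iota> \<union> tensor_values 0 Y) = UNIV"
proof -
  have "\<exists>m\<in>M. s = \<phi> m" for s using \<phi>_surj by (metis UNIV_I imageE)
  then obtain m where m: "\<And>s. m s \<in> M" "\<And>s. s = \<phi> (m s)" by metis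
  obtain X where X: "\<And>s. finite (X s)" "\<And>s e x. (e, x) \<in> X s \<Longrightarrow> equivariant_tensor M e x"
      "\<And>s. m s \<in> tensor.span (\<Union>(e, x)\<in>X s. x ` {u. length u = e})"
    using span_equivariant_tensors[OF M m(1)] by (metis (no_types, lifting) case_prodD)
  define Y where "Y = (\<lambda>(e, x). (e, \<lambda>w. \<iota> (\<phi> (x w)))) ` (\<Union>s\<in>S. X s)"
  define E where "E = gen_field (constant_field scale \<iota> \<union> tensor_values 0 Y)"
  have E: "is_subfield E" by (simp add: E_def)
  have "finite Y" using fin X(1) by (simp add: Y_def)
  moreover have "tensor_family infinitesimal 0 e y" if ey: "(e, y) \<in> Y" for e y
  proof -
    obtain s x where x: "(e, x) \<in> X s" "y = (\<lambda>w. \<iota> (\<phi> (x w)))" using ey by (auto simp: Y_def)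
    have eq: "equivariant_tensor M e x" by (rule X(2)[OF x(1)])
    show ?thesis
      unfolding tensor_family_def
    proof (intro allI impI)
      fix a b :: nat and w :: "nat list" assume ab: "a \<noteq> b" and w: "length w = e"
      have xM: "x v \<in> M" if "v \<in> set (replace_one a b w)" for v
        using eq replace_one_length[OF that] w by (simp add: equivariant_tensor_def)
      have "infinitesimal a b (y w) = \<iota> (\<phi> (\<Sum>v\<leftarrow>replace_one a b w. x v))"
        using eq w infinitesimal_value[OF ab, of "x w"] by (simp add: equivariant_tensor_def x(2))
      also have "\<dots> = \<iota> (\<Sum>v\<leftarrow>replace_one a b w. \<phi> (x v))"
        using \<phi>_sum_list[of "replace_one a b w" x] xM by simp
      also have "\<dots> = (\<Sum>v\<leftarrow>replace_one a b w. \<iota> (\<phi> (x v)))"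
        by (induction "replace_one a b w") (simp_all add: \<iota>.hom_sum_list comp_def)
      finally show "infinitesimal a b (y w) = (\<Sum>v\<leftarrow>replace_one a b w. y v)" by (simp add: x(2))
    qed
  qed
  moreover have "E = UNIV"
  proof -
    have \<kappa>E: "\<kappa> c \<in> E" for c
      unfolding E_def by (rule hull_inc) (auto simp: constant_field_def \<kappa>_def)
    define W where "W = {t \<in> M. \<iota> (\<phi> t) \<in> E}"
    have W: "tensor.subspace W"
    proof (rule tensor.subspaceI)
      show "0 \<in> W" using tensor.subspace_0[OF subspace_M] \<phi>_0 subfield_closed(1)[OF E] by (simp add: W_def)
      show "s + t \<in> W" if "s \<in> W" "t \<in> W" for s t
        using that tensor.subspace_add[OF subspace_M] subfield_closed(3)[OF E]
        by (simp add: W_def \<phi>_add \<iota>.hom_add)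
      show "tensor_scale c t \<in> W" if "t \<in> W" for c t
        using that tensor.subspace_scale[OF subspace_M] subfield_closed(4)[OF E \<kappa>E]
        by (simp add: W_def \<phi>_scale \<iota>_scale)
    qed
    have xW: "x ` {u. length u = e} \<subseteq> W" if "(e, x) \<in> X s" "s \<in> S" for e x s
    proof
      fix t assume "t \<in> x ` {u. length u = e}"
      then obtain u where u: "t = x u" "length u = e" by blast
      have "(e, \<lambda>w. \<iota> (\<phi> (x w))) \<in> Y" using that unfolding Y_def by force
      hence "\<iota> (\<phi> (x u)) \<in> tensor_values 0 Y" using u(2) by (force simp: tensor_values_def)
      hence "\<iota> (\<phi> t) \<in> E" unfolding E_def u(1) by (intro hull_inc) simp
      moreover have "t \<in> M" using X(2)[OF that(1)] u by (simp add: equivariant_tensor_def)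
      ultimately show "t \<in> W" by (simp add: W_def)
    qed
    have orbit: "\<iota> (act g s) \<in> E" if s: "s \<in> S" and g: "g \<in> carrier GL" for g s
    proof -
      have finM: "finite {z. t z \<noteq> 0}" if "t \<in> M" for t
        using M that by (auto simp: tensor_subrep_def tensor_sum_def)
      define W' where "W' = {t \<in> M. tensor_act g t \<in> W}"
      have "tensor.subspace W'"
      proof (rule tensor.subspaceI)
        show "0 \<in> W'"
          using tensor.subspace_0[OF subspace_M] tensor.subspace_0[OF W] by (simp only: W'_def tensor_act_0 mem_Collect_eq simp_thms)
        show "s + t \<in> W'" if "s \<in> W'" "t \<in> W'" for s t
          using that tensor.subspace_add[OF subspace_M] tensor.subspace_add[OF W] finM
          by (simp add: W'_def tensor_act_add)
        show "tensor_scale c t \<in> W'" if "t \<in> W'" for c t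
          using that tensor.subspace_scale[OF subspace_M] tensor.subspace_scale[OF W] finM
          by (simp add: W'_def tensor_act_scale)
      qed
      moreover have "x u \<in> W'" if x: "(e, x) \<in> X s" and u: "length u = e" for e x u
      proof -
        have "x u \<in> M" "tensor_act g (x u) \<in> tensor.span (x ` {u. length u = e})"
          using X(2)[OF x] u g by (auto simp: equivariant_tensor_def)
        moreover have "tensor.span (x ` {u. length u = e}) \<subseteq> W"
          by (rule tensor.span_minimal[OF xW[OF x s] W])
        ultimately show ?thesis by (auto simp: W'_def)
      qed
      ultimately have "tensor.span (\<Union>(e, x)\<in>X s. x ` {u. length u = e}) \<subseteq> W'"
        by (intro tensor.span_minimal) auto
      hence "tensor_act g (m s) \<in> W" using X(3)[of s] by (auto simp: W'_def)
      thus ?thesis using \<phi>_act[OF g m(1)] m(2)[of s] by (simp add: W_def)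
    qed
    define R where "R = {x. \<iota> x \<in> E}"
    interpret scale: vector_space scale using K_algebra by (simp add: K_algebra_def)
    have "subalgebra scale R"
      unfolding subalgebra_def
    proof (intro conjI ballI)
      show "scale.subspace R"
        by (rule scale.subspaceI)
          (auto simp: R_def \<iota>.hom_add \<iota>_scale intro: subfield_closed[OF E] \<kappa>E)
    qed (auto simp: R_def \<iota>.hom_mult intro: subfield_closed[OF E])
    moreover have "(\<Union>s\<in>S. orbit GL act s) \<subseteq> R" using orbit by (auto simp: R_def orbit_def)
    ultimately have "UNIV \<subseteq> R" unfolding gen[symmetric] by (intro hull_minimal)
    hence in_E: "\<iota> x \<in> E" for x by (auto simp: R_def)
    have "x \<in> E" for x
    proof -
      obtain u v where "x = \<iota> u / \<iota> v" using fraction .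
      thus ?thesis using subfield_closed(8)[OF E in_E in_E] by simp
    qed
    thus ?thesis by blast
  qed
  ultimately show ?thesis unfolding E_def by blast
qed

end

theorem proposition5p8:
  fixes scale :: "'k::field_char_0 \<Rightarrow> 'a::comm_ring_1 \<Rightarrow> 'a"
    and act :: "(nat \<Rightarrow> nat \<Rightarrow> 'k) \<Rightarrow> 'a \<Rightarrow> 'a"
    and \<iota> :: "'a \<Rightarrow> 'l::field"
  assumes "affine_GL_variety TYPE('i) scale act"
    and "irreducible_space (Spec :: 'a set topology)"
    and "fraction_field \<iota>"
  shows "finitely_generated_extension (constant_field scale \<iota>) (invariant_field \<iota> act)"
proof -
  have alg: "K_algebra scale" "polynomial_representation TYPE('i) scale act"
      "\<And>g. g \<in> carrier GL \<Longrightarrow> comm_ring_hom (act g)" "finitely_GL_generated scale act"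
    using assms(1) by (auto simp: affine_GL_variety_def GL_algebra_def)
  obtain d :: "'i \<Rightarrow> nat" and M N \<phi> where rep: "GL_representation scale act" "tensor_subrep d M"
      "\<forall>s\<in>M. \<forall>t\<in>M. \<phi> (s + t) = \<phi> s + \<phi> t" "\<forall>c. \<forall>t\<in>M. \<phi> (tensor_scale c t) = scale c (\<phi> t)"
      "\<forall>g\<in>carrier GL. \<forall>t\<in>M. \<phi> (tensor_act g t) = act g (\<phi> t)" "\<phi> ` M = UNIV"
    using alg(2) unfolding polynomial_representation_def by blast
  interpret GL_domain scale act \<iota> d M \<phi>
    by (intro GL_domain.intro) (use alg(1,3) rep assms(3) in blast)+
  obtain S where S: "finite S" "subalgebra scale hull (\<Union>s\<in>S. orbit GL act s) = UNIV"
    using alg(4) unfolding finitely_GL_generated_def by blast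
  obtain Y where Y: "finite Y" "\<forall>(e, y)\<in>Y. tensor_family infinitesimal 0 e y"
      "gen_field (constant_field scale \<iota> \<union> tensor_values 0 Y) = UNIV"
    using function_field_generated_by_tensors[OF S] by blast
  interpret derivation_family infinitesimal "invariant_field \<iota> act"
    by unfold_locales (use infinitesimal(1) subfield_invariant_field infinitesimal_invariant char0 in auto)
  have "\<exists>S. finite S \<and> S \<subseteq> invariant_field \<iota> act \<and>
      gen_field (constant_field scale \<iota> \<union> S) = invariant_field \<iota> act"
    by (rule constants_finitely_generated[OF Y(1) _ constant_field_invariant Y(3)]) (use Y(2) in blast)
  thus ?thesis unfolding finitely_generated_extension_def .
qed

end
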